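(* Fix an o-minimal expansion $\mathcal R=(R,0,1,+,\cdot,\ldots)$ of a real closed field $R$, let $r\ge 0$ be an integer, and let $M$ be an affine definable $C^r$ manifold. Let $A,B\in \operatorname{SL}(n,C_{\text{df}}^0(M))$, viewed as definable continuous maps $M\to \operatorname{SL}(n,R)$, and assume they are definably homotopic, i.e. there exists a definable continuous map $H:M\times[0,1]\to\operatorname{SL}(n,R)$ with $H(\cdot,0)=A(\cdot)$ and $H(\cdot,1)=B(\cdot)$. Then the images of $A$ and $B$ in $\operatorname{SK}_1(C_{\text{df}}^0(M))$ coincide.
   Context: "Definable" means definable (with parameters) in $\mathcal R$; $[0,1]=\{t\in R: 0\le t\le 1\}$. An affine definable $C^r$ manifold is a definable $C^r$ manifold that is (definably $C^r$ diffeomorphic to) a definable $C^r$ submanifold of some $R^N$. $C_{\text{df}}^0(M)$ is the ring of definable continuous functions $M\to R$. For a commutative ring $A$: $\operatorname{GL}(A)=\bigcup_n\operatorname{GL}(n,A)$ with $\operatorname{GL}(n,A)\subset\operatorname{GL}(n+1,A)$ via $g\mapsto \operatorname{diag}(g,1)$; $\operatorname{SL}(A)$ is the subgroup of determinant-one matrices; $\operatorname{Comm}(A)=[\operatorname{GL}(A),\operatorname{GL}(A)]$; $\operatorname{SK}_1(A)=\operatorname{SL}(A)/\operatorname{Comm}(A)$. *)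

theory Defs
  imports
    "HOL-Algebra.Generated_Groups"
    "HOL-Analysis.T1_Spaces"
    "HOL-Analysis.Product_Topology"
    "Jordan_Normal_Form.Determinant"
begin

section \<open>Real closed fields and the topology of \<open>R\<^sup>n\<close>\<close>

text \<open>The type class carries the order topology, so that limits in \<open>R\<close> are the library's.\<close>

class real_closed_field = linordered_field + linorder_topology +
  assumes ex_square_root: "0 \<le> a \<Longrightarrow> \<exists>b. b * b = a"
    and ex_root_odd_degree: "odd n \<Longrightarrow> c n \<noteq> 0 \<Longrightarrow> \<exists>x. (\<Sum>i\<le>n. c i * x ^ i) = 0"

text \<open>\<open>R\<^sup>n\<close> is \<^term>\<open>carrier_vec n\<close> with the product topology.\<close>

definition Rn :: "nat \<Rightarrow> 'a::real_closed_field vec topology" where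
  "Rn n = pullback_topology (carrier_vec n) (\<lambda>v. \<lambda>i\<in>{..<n}. v $ i)
            (product_topology (\<lambda>_. euclidean) {..<n})"

lemma topspace_Rn: "topspace (Rn n) = carrier_vec n"
  by (auto simp: Rn_def topspace_pullback_topology)


section \<open>Expansions of a real closed field and definability\<close>

text \<open>
  An expansion of the field \<open>R\<close> interprets further function symbols \<open>'f\<close> and relation symbols
  \<open>'p\<close> on \<open>R\<close>. Arities are not recorded: a symbol is interpreted at every arity, which
  amounts to one symbol for each arity. The field operations are part of the term language;
  arbitrary elements of \<open>R\<close> (in particular \<open>0\<close> and \<open>1\<close>) occur as parameters, and the order is
  definable from the squares.
\<close>

record ('f, 'p, 'a) expansion =
  fun_interp :: "'f \<Rightarrow> 'a list \<Rightarrow> 'a"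
  rel_interp :: "'p \<Rightarrow> 'a list \<Rightarrow> bool"

datatype ('f, 'a) tm =
    Var nat
  | Param 'a
  | Plus "('f, 'a) tm" "('f, 'a) tm"
  | Times "('f, 'a) tm" "('f, 'a) tm"
  | Fun 'f "('f, 'a) tm list"

datatype ('f, 'p, 'a) fm =
    Eq "('f, 'a) tm" "('f, 'a) tm"
  | Rel 'p "('f, 'a) tm list"
  | Neg "('f, 'p, 'a) fm"
  | Conj "('f, 'p, 'a) fm" "('f, 'p, 'a) fm"
  | Ex nat "('f, 'p, 'a) fm"

primrec tm_val :: "('f, 'p, 'a::real_closed_field) expansion \<Rightarrow> (nat \<Rightarrow> 'a) \<Rightarrow> ('f, 'a) tm \<Rightarrow> 'a" where
  "tm_val S e (Var i) = e i"
| "tm_val S e (Param a) = a"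
| "tm_val S e (Plus s t) = tm_val S e s + tm_val S e t"
| "tm_val S e (Times s t) = tm_val S e s * tm_val S e t"
| "tm_val S e (Fun f ts) = fun_interp S f (map (tm_val S e) ts)"

primrec sat :: "('f, 'p, 'a::real_closed_field) expansion \<Rightarrow> (nat \<Rightarrow> 'a) \<Rightarrow> ('f, 'p, 'a) fm \<Rightarrow> bool" where
  "sat S e (Eq s t) \<longleftrightarrow> tm_val S e s = tm_val S e t"
| "sat S e (Rel p ts) \<longleftrightarrow> rel_interp S p (map (tm_val S e) ts)"
| "sat S e (Neg F) \<longleftrightarrow> \<not> sat S e F"
| "sat S e (Conj F G) \<longleftrightarrow> sat S e F \<and> sat S e G"
| "sat S e (Ex i F) \<longleftrightarrow> (\<exists>a. sat S (e(i := a)) F)"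

text \<open>The variables \<open>0, \<dots>, m - 1\<close> stand for the coordinates of \<open>R\<^sup>m\<close>; all others are set to \<open>0\<close>.\<close>

definition definable_set :: "('f, 'p, 'a::real_closed_field) expansion \<Rightarrow> nat \<Rightarrow> 'a vec set \<Rightarrow> bool" where
  "definable_set S m X \<longleftrightarrow>
     (\<exists>F. X = {v \<in> carrier_vec m. sat S (\<lambda>i. if i < m then v $ i else 0) F})"

text \<open>The coordinate line \<open>R\<^sup>1\<close> is identified with \<open>R\<close>.\<close>

definition vec1 :: "'a \<Rightarrow> 'a vec" where
  "vec1 t = vec 1 (\<lambda>_. t)"

definition o_minimal :: "('f, 'p, 'a::real_closed_field) expansion \<Rightarrow> bool" where
  "o_minimal S \<longleftrightarrow>
     (\<forall>X. definable_set S 1 (vec1 ` X) \<longrightarrow>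
       (\<exists>\<I>. finite \<I> \<and> X = \<Union>\<I> \<and>
         (\<forall>J\<in>\<I>. (\<exists>a. J = {a}) \<or> (\<exists>a b. J = {a<..<b}) \<or> (\<exists>a. J = {a<..}) \<or> (\<exists>b. J = {..<b}) \<or>
           J = UNIV)))"

definition definable_map ::
    "('f, 'p, 'a::real_closed_field) expansion \<Rightarrow> nat \<Rightarrow> nat \<Rightarrow> 'a vec set \<Rightarrow> ('a vec \<Rightarrow> 'a vec) \<Rightarrow> bool" where
  "definable_map S m k X f \<longleftrightarrow>
     X \<subseteq> carrier_vec m \<and> f ` X \<subseteq> carrier_vec k \<and> definable_set S (m + k) ((\<lambda>x. x @\<^sub>v f x) ` X)"


section \<open>Differentiability over \<open>R\<close>\<close>

definition has_partial_derivative ::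
    "nat \<Rightarrow> ('a::real_closed_field vec \<Rightarrow> 'a) \<Rightarrow> nat \<Rightarrow> 'a vec \<Rightarrow> 'a \<Rightarrow> bool" where
  "has_partial_derivative m f i x D \<longleftrightarrow>
     ((\<lambda>h. (f (x + h \<cdot>\<^sub>v unit_vec m i) - f x) / h) \<longlongrightarrow> D) (at 0)"

text \<open>Functions of class \<open>C\<^sup>r\<close> on a subset \<open>U\<close> of \<open>R\<^sup>m\<close>; only used for open \<open>U\<close>.\<close>

primrec Cr_on :: "nat \<Rightarrow> nat \<Rightarrow> 'a::real_closed_field vec set \<Rightarrow> ('a vec \<Rightarrow> 'a) \<Rightarrow> bool" where
  "Cr_on 0 m U f \<longleftrightarrow> continuous_map (subtopology (Rn m) U) euclidean f"
| "Cr_on (Suc r) m U f \<longleftrightarrow> continuous_map (subtopology (Rn m) U) euclidean f \<and>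
     (\<forall>i<m. \<exists>g. (\<forall>x\<in>U. has_partial_derivative m f i x (g x)) \<and> Cr_on r m U g)"

definition definable_open :: "('f, 'p, 'a::real_closed_field) expansion \<Rightarrow> nat \<Rightarrow> 'a vec set \<Rightarrow> bool" where
  "definable_open S m U \<longleftrightarrow> definable_set S m U \<and> openin (Rn m) U"

definition definable_Cr_map ::
    "('f, 'p, 'a::real_closed_field) expansion \<Rightarrow> nat \<Rightarrow> nat \<Rightarrow> nat \<Rightarrow> 'a vec set \<Rightarrow> ('a vec \<Rightarrow> 'a vec) \<Rightarrow> bool"
  where
  "definable_Cr_map S r m k U f \<longleftrightarrow>
     definable_open S m U \<and> definable_map S m k U f \<and> (\<forall>j<k. Cr_on r m U (\<lambda>x. f x $ j))"


section \<open>Definable \<open>C\<^sup>r\<close> manifolds\<close>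

text \<open>A manifold is a set of points with an atlas of charts \<open>\<phi> : U \<rightarrow> R\<^sup>d\<close>.\<close>

record ('m, 'a) manifold =
  points :: "'m set"
  mdim :: nat
  charts :: "('m set \<times> ('m \<Rightarrow> 'a vec)) set"

definition manifold_topology :: "('m, 'a::real_closed_field) manifold \<Rightarrow> 'm topology" where
  "manifold_topology M = topology (\<lambda>W. W \<subseteq> points M \<and>
     (\<forall>(U, \<phi>) \<in> charts M. openin (Rn (mdim M)) (\<phi> ` (W \<inter> U))))"

text \<open>The case of two equal charts says that \<open>\<phi> ` U\<close> is open and definable.\<close>

definition definable_Cr_manifold ::
    "('f, 'p, 'a::real_closed_field) expansion \<Rightarrow> nat \<Rightarrow> ('m, 'a) manifold \<Rightarrow> bool" where
  "definable_Cr_manifold S r M \<longleftrightarrow>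
     finite (charts M) \<and>
     points M = (\<Union>(U, \<phi>) \<in> charts M. U) \<and>
     Hausdorff_space (manifold_topology M) \<and>
     (\<forall>(U, \<phi>) \<in> charts M. inj_on \<phi> U \<and>
       (\<forall>(V, \<psi>) \<in> charts M. definable_open S (mdim M) (\<phi> ` (U \<inter> V)) \<and>
          definable_Cr_map S r (mdim M) (mdim M) (\<phi> ` (U \<inter> V)) (\<lambda>x. \<psi> (inv_into U \<phi> x))))"

lemma istopology_manifold:
  fixes M :: "('m, 'a::real_closed_field) manifold"
  assumes "definable_Cr_manifold S r M"
  shows "istopology (\<lambda>W. W \<subseteq> points M \<and>
     (\<forall>(U, \<phi>) \<in> charts M. openin (Rn (mdim M)) (\<phi> ` (W \<inter> U))))"
proof -
  have inj: "inj_on \<phi> U" if "(U, \<phi>) \<in> charts M" for U \<phi>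
    using assms that unfolding definable_Cr_manifold_def by fastforce
  have int: "openin (Rn (mdim M)) (\<phi> ` (V \<inter> W \<inter> U))"
    if "(U, \<phi>) \<in> charts M" "openin (Rn (mdim M)) (\<phi> ` (V \<inter> U))" "openin (Rn (mdim M)) (\<phi> ` (W \<inter> U))"
    for U V W \<phi>
  proof -
    have "\<phi> ` (V \<inter> W \<inter> U) = \<phi> ` (V \<inter> U) \<inter> \<phi> ` (W \<inter> U)"
      using inj_on_image_Int[OF inj[OF that(1)], of "V \<inter> U" "W \<inter> U"] by (simp add: Int_ac)
    then show ?thesis using that by auto
  qed
  have un: "openin (Rn (mdim M)) (\<phi> ` (\<Union>\<K> \<inter> U))"
    if "\<And>W. W \<in> \<K> \<Longrightarrow> openin (Rn (mdim M)) (\<phi> ` (W \<inter> U))" for \<K> U and \<phi> :: "'m \<Rightarrow> 'a vec"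
  proof -
    have "\<phi> ` (\<Union>\<K> \<inter> U) = (\<Union>W\<in>\<K>. \<phi> ` (W \<inter> U))" by auto
    then show ?thesis using that by auto
  qed
  show ?thesis
    unfolding istopology_def
  proof (intro conjI allI impI)
    fix V W
    assume "V \<subseteq> points M \<and> (\<forall>(U, \<phi>) \<in> charts M. openin (Rn (mdim M)) (\<phi> ` (V \<inter> U)))"
      and "W \<subseteq> points M \<and> (\<forall>(U, \<phi>) \<in> charts M. openin (Rn (mdim M)) (\<phi> ` (W \<inter> U)))"
    then show "V \<inter> W \<subseteq> points M"
      and "\<forall>(U, \<phi>) \<in> charts M. openin (Rn (mdim M)) (\<phi> ` (V \<inter> W \<inter> U))"
      by (blast, fast intro: int)
  next
    fix \<K>
    assume "\<forall>W\<in>\<K>. W \<subseteq> points M \<and> (\<forall>(U, \<phi>) \<in> charts M. openin (Rn (mdim M)) (\<phi> ` (W \<inter> U)))"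
    then show "\<Union>\<K> \<subseteq> points M"
      and "\<forall>(U, \<phi>) \<in> charts M. openin (Rn (mdim M)) (\<phi> ` (\<Union>\<K> \<inter> U))"
      by (blast, fast intro: un)
  qed
qed

lemma openin_manifold_topology:
  assumes "definable_Cr_manifold S r M"
  shows "openin (manifold_topology M) W \<longleftrightarrow> W \<subseteq> points M \<and>
     (\<forall>(U, \<phi>) \<in> charts M. openin (Rn (mdim M)) (\<phi> ` (W \<inter> U)))"
  unfolding manifold_topology_def using topology_inverse'[OF istopology_manifold[OF assms]] by simp

lemma topspace_manifold_topology:
  assumes "definable_Cr_manifold S r M"
  shows "topspace (manifold_topology M) = points M"
proof -
  have "openin (Rn (mdim M)) (\<phi> ` (points M \<inter> U))" if "(U, \<phi>) \<in> charts M" for U \<phi>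
  proof -
    have "U \<subseteq> points M" "openin (Rn (mdim M)) (\<phi> ` (U \<inter> U))"
      using assms that unfolding definable_Cr_manifold_def definable_open_def by fast+
    then show ?thesis by (simp add: inf.absorb2)
  qed
  then have "openin (manifold_topology M) (points M)"
    by (auto simp: openin_manifold_topology[OF assms])
  then show ?thesis
    by (meson assms openin_manifold_topology openin_subset openin_topspace subset_antisym)
qed

text \<open>Submanifolds of \<open>R\<^sup>N\<close>: locally, a definable \<open>C\<^sup>r\<close> diffeomorphism \<open>\<phi>\<close> between open sets of \<open>R\<^sup>N\<close>,
  with inverse \<open>\<psi>\<close>, straightens \<open>X\<close> to \<open>R\<^sup>d \<times> {0}\<close>.\<close>

definition definable_Cr_submanifold ::
    "('f, 'p, 'a::real_closed_field) expansion \<Rightarrow> nat \<Rightarrow> nat \<Rightarrow> nat \<Rightarrow> 'a vec set \<Rightarrow> bool" where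
  "definable_Cr_submanifold S r N d X \<longleftrightarrow>
     d \<le> N \<and> definable_set S N X \<and>
     (\<forall>x\<in>X. \<exists>U V \<phi> \<psi>. x \<in> U \<and>
        definable_Cr_map S r N N U \<phi> \<and> definable_Cr_map S r N N V \<psi> \<and>
        \<phi> ` U = V \<and> \<psi> ` V = U \<and> (\<forall>u\<in>U. \<psi> (\<phi> u) = u) \<and>
        \<phi> ` (X \<inter> U) = {v \<in> V. \<forall>i. d \<le> i \<and> i < N \<longrightarrow> v $ i = 0})"

text \<open>A definable \<open>C\<^sup>r\<close> diffeomorphism from a manifold onto a submanifold \<open>X\<close> of \<open>R\<^sup>N\<close>. The inverse is
  of class \<open>C\<^sup>r\<close> in the usual sense for maps on a submanifold: in each chart it locally extends to
  a definable \<open>C\<^sup>r\<close> map on an open subset of \<open>R\<^sup>N\<close>.\<close>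

definition definable_Cr_diffeo ::
    "('f, 'p, 'a::real_closed_field) expansion \<Rightarrow> nat \<Rightarrow> ('m, 'a) manifold \<Rightarrow> nat \<Rightarrow> 'a vec set \<Rightarrow>
       ('m \<Rightarrow> 'a vec) \<Rightarrow> bool" where
  "definable_Cr_diffeo S r M N X F \<longleftrightarrow>
     bij_betw F (points M) X \<and>
     (\<forall>(U, \<phi>) \<in> charts M.
        definable_Cr_map S r (mdim M) N (\<phi> ` U) (\<lambda>x. F (inv_into U \<phi> x)) \<and>
        openin (subtopology (Rn N) X) (F ` U) \<and>
        (\<forall>x \<in> F ` U. \<exists>W g. x \<in> W \<and> definable_Cr_map S r N (mdim M) W g \<and>
           (\<forall>y \<in> W \<inter> F ` U. g y = \<phi> (inv_into (points M) F y))))"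

definition affine_definable_Cr_manifold ::
    "('f, 'p, 'a::real_closed_field) expansion \<Rightarrow> nat \<Rightarrow> ('m, 'a) manifold \<Rightarrow> bool" where
  "affine_definable_Cr_manifold S r M \<longleftrightarrow>
     definable_Cr_manifold S r M \<and>
     (\<exists>N X F. definable_Cr_submanifold S r N (mdim M) X \<and> definable_Cr_diffeo S r M N X F)"


section \<open>The ring of definable continuous functions\<close>

definition definable_function ::
    "('f, 'p, 'a::real_closed_field) expansion \<Rightarrow> ('m, 'a) manifold \<Rightarrow> ('m \<Rightarrow> 'a) \<Rightarrow> bool" where
  "definable_function S M f \<longleftrightarrow>
     (\<forall>(U, \<phi>) \<in> charts M. definable_set S (mdim M + 1) ((\<lambda>p. \<phi> p @\<^sub>v vec1 (f p)) ` U))"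

definition Cdf0 ::
    "('f, 'p, 'a::real_closed_field) expansion \<Rightarrow> ('m, 'a) manifold \<Rightarrow> ('m \<Rightarrow> 'a) ring" where
  "Cdf0 S M =
     \<lparr>carrier = {f \<in> extensional (points M).
          definable_function S M f \<and> continuous_map (manifold_topology M) euclidean f},
      monoid.mult = (\<lambda>f g. \<lambda>p\<in>points M. f p * g p),
      one = (\<lambda>p\<in>points M. 1),
      zero = (\<lambda>p\<in>points M. 0),
      add = (\<lambda>f g. \<lambda>p\<in>points M. f p + g p)\<rparr>"


section \<open>General and special linear groups, and \<open>SK\<^sub>1\<close>\<close>

definition matrix_monoid :: "('r, 'x) ring_scheme \<Rightarrow> nat \<Rightarrow> 'r mat monoid" where
  "matrix_monoid A n =
     \<lparr>carrier = {g \<in> carrier_mat n n. elements_mat g \<subseteq> carrier A},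
      monoid.mult = (\<lambda>g h. mat n n (\<lambda>(i, j). \<Oplus>\<^bsub>A\<^esub>k\<in>{0..<n}. g $$ (i, k) \<otimes>\<^bsub>A\<^esub> h $$ (k, j))),
      one = mat n n (\<lambda>(i, j). if i = j then \<one>\<^bsub>A\<^esub> else \<zero>\<^bsub>A\<^esub>)\<rparr>"

definition GLn :: "('r, 'x) ring_scheme \<Rightarrow> nat \<Rightarrow> 'r mat monoid" where
  "GLn A n = units_of (matrix_monoid A n)"

definition ring_det :: "('r, 'x) ring_scheme \<Rightarrow> nat \<Rightarrow> 'r mat \<Rightarrow> 'r" where
  "ring_det A n g =
     (\<Oplus>\<^bsub>A\<^esub>p\<in>{p. p permutes {0..<n}}.
        (if evenperm p then \<one>\<^bsub>A\<^esub> else \<ominus>\<^bsub>A\<^esub> \<one>\<^bsub>A\<^esub>) \<otimes>\<^bsub>A\<^esub> (\<Otimes>\<^bsub>A\<^esub>i\<in>{0..<n}. g $$ (i, p i)))"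

definition SLn :: "('r, 'x) ring_scheme \<Rightarrow> nat \<Rightarrow> 'r mat set" where
  "SLn A n = {g \<in> carrier (GLn A n). ring_det A n g = \<one>\<^bsub>A\<^esub>}"

text \<open>Identifying \<open>g\<close> with \<open>diag(g, 1)\<close> amounts to regarding an \<open>n \<times> n\<close> matrix \<open>g\<close> as the infinite
  matrix \<open>diag(g, 1, 1, \<dots>)\<close>.\<close>

definition stab :: "('r, 'x) ring_scheme \<Rightarrow> 'r mat \<Rightarrow> nat \<Rightarrow> nat \<Rightarrow> 'r" where
  "stab A g = (\<lambda>i j. if i < dim_row g \<and> j < dim_col g then g $$ (i, j)
                     else if i = j then \<one>\<^bsub>A\<^esub> else \<zero>\<^bsub>A\<^esub>)"

text \<open>In the product of infinite matrices, the sum ranges over the nonzero summands, of which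
  there are finitely many.\<close>

definition GL :: "('r, 'x) ring_scheme \<Rightarrow> (nat \<Rightarrow> nat \<Rightarrow> 'r) monoid" where
  "GL A =
     \<lparr>carrier = (\<Union>n. stab A ` carrier (GLn A n)),
      monoid.mult = (\<lambda>g h i j. \<Oplus>\<^bsub>A\<^esub>k\<in>{k. g i k \<otimes>\<^bsub>A\<^esub> h k j \<noteq> \<zero>\<^bsub>A\<^esub>}. g i k \<otimes>\<^bsub>A\<^esub> h k j),
      one = (\<lambda>i j. if i = j then \<one>\<^bsub>A\<^esub> else \<zero>\<^bsub>A\<^esub>)\<rparr>"

definition SL :: "('r, 'x) ring_scheme \<Rightarrow> (nat \<Rightarrow> nat \<Rightarrow> 'r) monoid" where
  "SL A = (GL A)\<lparr>carrier := (\<Union>n. stab A ` SLn A n)\<rparr>"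

definition Comm :: "('r, 'x) ring_scheme \<Rightarrow> (nat \<Rightarrow> nat \<Rightarrow> 'r) set" where
  "Comm A = derived (GL A) (carrier (GL A))"

definition SK1 :: "('r, 'x) ring_scheme \<Rightarrow> (nat \<Rightarrow> nat \<Rightarrow> 'r) set monoid" where
  "SK1 A = SL A Mod Comm A"

text \<open>The image in \<^term>\<open>SK1 A\<close> of a matrix in \<^term>\<open>SLn A n\<close>.\<close>

definition SK1_class :: "('r, 'x) ring_scheme \<Rightarrow> 'r mat \<Rightarrow> (nat \<Rightarrow> nat \<Rightarrow> 'r) set" where
  "SK1_class A g = Comm A #>\<^bsub>SL A\<^esub> stab A g"

lemma SK1_class_in_SK1: "g \<in> SLn A n \<Longrightarrow> SK1_class A g \<in> carrier (SK1 A)"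
  by (auto simp: SK1_class_def SK1_def FactGroup_def RCOSETS_def SL_def)


section \<open>Definable homotopies\<close>

text \<open>The space of \<open>n \<times> n\<close> matrices over \<open>R\<close> is identified with \<open>R\<^bsup>n * n\<^esup>\<close>.\<close>

definition flatten_mat :: "nat \<Rightarrow> 'a mat \<Rightarrow> 'a vec" where
  "flatten_mat n g = vec (n * n) (\<lambda>l. g $$ (l div n, l mod n))"

definition SLn_R :: "nat \<Rightarrow> 'a::real_closed_field mat set" where
  "SLn_R n = {g \<in> carrier_mat n n. det g = 1}"

definition definable_homotopy ::
    "('f, 'p, 'a::real_closed_field) expansion \<Rightarrow> ('m, 'a) manifold \<Rightarrow> nat \<Rightarrow> ('m \<times> 'a \<Rightarrow> 'a mat) \<Rightarrow> bool" where
  "definable_homotopy S M n H \<longleftrightarrow>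
     H ` (points M \<times> {0..1}) \<subseteq> SLn_R n \<and>
     continuous_map (prod_topology (manifold_topology M) (top_of_set {0..1})) (Rn (n * n))
       (\<lambda>z. flatten_mat n (H z)) \<and>
     (\<forall>(U, \<phi>) \<in> charts M. definable_set S (mdim M + 1 + n * n)
        ((\<lambda>(p, t). \<phi> p @\<^sub>v vec1 t @\<^sub>v flatten_mat n (H (p, t))) ` (U \<times> {0..1})))"

definition value_at :: "('m \<Rightarrow> 'a) mat \<Rightarrow> 'm \<Rightarrow> 'a mat" where
  "value_at A p = map_mat (\<lambda>f. f p) A"

definition definably_homotopic ::
    "('f, 'p, 'a::real_closed_field) expansion \<Rightarrow> ('m, 'a) manifold \<Rightarrow> nat \<Rightarrow>
       ('m \<Rightarrow> 'a) mat \<Rightarrow> ('m \<Rightarrow> 'a) mat \<Rightarrow> bool" where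
  "definably_homotopic S M n A B \<longleftrightarrow>
     (\<exists>H. definable_homotopy S M n H \<and>
       (\<forall>p\<in>points M. H (p, 0) = value_at A p \<and> H (p, 1) = value_at B p))"

end

theory Submission
  imports Defs
begin

text \<open>
  Gram-Schmidt orthonormalisation, applied to the homotopy, writes \<open>H(p, u) = Q(p, u) T(p, u)\<close> with
  \<open>Q\<close> orthogonal, hence with bounded entries, and \<open>T\<close> upper triangular with positive diagonal. By
  uniform finiteness, the number of times that an entry of \<open>Q(p, \<sqdot>)\<close> oscillates by a fixed amount is
  bounded independently of \<open>p\<close>. So there are finitely many definable continuous functions
  \<open>0 = t\<^sub>0 \<le> t\<^sub>1 \<le> \<dots> \<le> t\<^sub>K = 1\<close> on \<open>M\<close> such that \<open>Q(p, t\<^sub>j(p))\<close> and \<open>Q(p, t\<^sub>j\<^sub>+\<^sub>1(p))\<close> are always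
  close, although \<open>M\<close> need not be compact. Then \<open>Q(p, t\<^sub>j(p))\<^sup>T Q(p, t\<^sub>j\<^sub>+\<^sub>1(p))\<close> defines a positive
  form, so that Gaussian elimination without row exchanges, with definable continuous coefficients,
  reduces it to a diagonal matrix; as its determinant is \<open>1\<close>, it lies in the commutator subgroup.
  The same holds for \<open>T\<close>, whose diagonal has product \<open>1\<close>.
\<close>

section \<open>Definable predicates and functions\<close>

text \<open>Neither M nor, over a general R, the segment [0,1] need be compact, so there is no
  Lebesgue number for the homotopy. A count replaces it: a function with values in [-1,1] that moves
  by 1/m has to cross one of the levels -1 + l/m with l \<le> 2m, and the crossing times form a
  definable family of finite sets. Finitely many levels suffice only for bounded functions; this is
  why the homotopy is orthonormalised before it is subdivided. The closeness needed is read off from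
  polarisation: |Qv - Q'v|^2 < 2 |v|^2 says that Qv and Q'v have positive inner product. Positivity
  passes to Schur complements, so the pivots are nonzero on all of M at once and elimination makes
  no choice that could break continuity. Whether a diagonal matrix dies in the abelianisation
  depends only on the product of its entries: permutation matrices conjugate every diag(1, ..., u,
  ..., 1) to the same place, so diag(d1, ..., dn) has the class of the 1 x 1 matrix d1 ...
  dn.\<close>

definition dpred :: "('f, 'p, 'a::real_closed_field) expansion \<Rightarrow> ((nat \<Rightarrow> 'a) \<Rightarrow> bool) \<Rightarrow> bool" where
  "dpred S P \<longleftrightarrow> (\<exists>F. \<forall>e. sat S e F = P e)"

text \<open>Bound variables are kept at position 0, as with de Bruijn indices: \<open>Q e a\<close>
  with parameters \<open>e\<close> and bound variable \<open>a\<close> is encoded as a predicate on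
  \<open>push a e\<close>.\<close>

abbreviation push :: "'a \<Rightarrow> (nat \<Rightarrow> 'a) \<Rightarrow> nat \<Rightarrow> 'a" where
  "push a e \<equiv> case_nat a e"

lemma push_eta: "push (e 0) (\<lambda>i. e (Suc i)) = e"
  by (auto simp: fun_eq_iff split: nat.split)

lemma push_eta': "push (e 0) (\<lambda>i. e (Suc i)) k = e k"
  by (cases k) auto

text \<open>Encoded by the graph and not by a term, so that functions given by a description (roots,
  minima, selected fibre points) are covered.\<close>

definition dfun :: "('f, 'p, 'a::real_closed_field) expansion \<Rightarrow> ((nat \<Rightarrow> 'a) \<Rightarrow> 'a) \<Rightarrow> bool" where
  "dfun S f \<longleftrightarrow> dpred S (\<lambda>e. e 0 = f (\<lambda>i. e (Suc i)))"

section \<open>Renaming of variables and finite support of formulas\<close>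

primrec tm_ren :: "(nat \<Rightarrow> nat) \<Rightarrow> ('f, 'a) tm \<Rightarrow> ('f, 'a) tm" where
  "tm_ren r (Var i) = Var (r i)"
| "tm_ren r (Param a) = Param a"
| "tm_ren r (Plus s t) = Plus (tm_ren r s) (tm_ren r t)"
| "tm_ren r (Times s t) = Times (tm_ren r s) (tm_ren r t)"
| "tm_ren r (Fun f ts) = Fun f (map (tm_ren r) ts)"

lemma tm_val_ren: "tm_val S e (tm_ren r t) = tm_val S (\<lambda>i. e (r i)) t"
proof (induction t)
  case (Fun f ts)
  then show ?case by (simp add: comp_def cong: map_cong)
qed auto

text \<open>Formulas mention finitely many variables. This provides a fresh variable when a bound
  one must be renamed, and lets an infinite substitution be carried out in finitely many
  steps.\<close>

definition fin_support :: "((nat \<Rightarrow> 'a) \<Rightarrow> 'b) \<Rightarrow> bool" where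
  "fin_support f \<longleftrightarrow> (\<exists>N. \<forall>e e'. (\<forall>i<N. e i = e' i) \<longrightarrow> f e = f e')"

lemma fin_support_const: "fin_support (\<lambda>e. c)"
  by (simp add: fin_support_def)

lemma fin_support_comp2:
  assumes "fin_support f" "fin_support g"
  shows "fin_support (\<lambda>e. h (f e) (g e))"
proof -
  obtain N1 N2 where N: "\<forall>e e'. (\<forall>i<N1. e i = e' i) \<longrightarrow> f e = f e'"
    "\<forall>e e'. (\<forall>i<N2. e i = e' i) \<longrightarrow> g e = g e'"
    using assms unfolding fin_support_def by blast
  show ?thesis
    unfolding fin_support_def
  proof (intro exI[of _ "max N1 N2"] allI impI)
    fix e e' :: "nat \<Rightarrow> 'a"
    assume "\<forall>i<max N1 N2. e i = e' i"
    then have "f e = f e'" "g e = g e'" using N by simp_all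
    then show "h (f e) (g e) = h (f e') (g e')" by simp
  qed
qed

lemma fin_support_map: "(\<And>t. t \<in> set ts \<Longrightarrow> fin_support (\<lambda>e. v e t)) \<Longrightarrow> fin_support (\<lambda>e. map (v e) ts)"
proof (induction ts)
  case Nil
  show ?case by (simp add: fin_support_const)
next
  case (Cons t ts)
  then show ?case using fin_support_comp2[of "\<lambda>e. v e t" "\<lambda>e. map (v e) ts" Cons] by simp
qed

lemma fin_support_tm_val: "fin_support (\<lambda>e. tm_val S e t)"
proof (induction t)
  case (Var i)
  show ?case unfolding fin_support_def by (rule exI[of _ "Suc i"]) auto
next
  case (Fun f ts)
  then show ?case
    using fin_support_comp2[OF fin_support_const fin_support_map, of ts "\<lambda>e t. tm_val S e t" "\<lambda>_::unit. fun_interp S f"] by simp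
qed (use fin_support_const fin_support_comp2 in auto)

lemma fin_support_sat: "fin_support (\<lambda>e. sat S e F)"
proof (induction F)
  case (Rel p ts)
  then show ?case
    using fin_support_comp2[OF fin_support_const fin_support_map, of ts "\<lambda>e t. tm_val S e t" "\<lambda>_::unit. rel_interp S p"]
    by (simp add: fin_support_tm_val)
next
  case (Neg F)
  then show ?case using fin_support_comp2[OF fin_support_const Neg, of "\<lambda>_::unit. Not"] by simp
next
  case (Ex k F)
  then obtain N where "\<forall>e e'. (\<forall>i<N. e i = e' i) \<longrightarrow> sat S e F = sat S e' F"
    unfolding fin_support_def by blast
  then have "\<forall>e e'. (\<forall>i<N. e i = e' i) \<longrightarrow> (\<forall>a. sat S (e(k := a)) F = sat S (e'(k := a)) F)"
    by (simp add: fun_upd_def)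
  then show ?case unfolding fin_support_def by (intro exI[of _ N]) auto
qed (simp_all add: fin_support_tm_val fin_support_comp2[where h = "(=)"] fin_support_comp2[where h = "(\<and>)"])

lemma sat_ren: "\<exists>G. \<forall>e. sat S e G = sat S (\<lambda>i. e (r i)) F"
proof (induction F arbitrary: r)
  case (Eq s t)
  show ?case by (rule exI[of _ "Eq (tm_ren r s) (tm_ren r t)"]) (simp add: tm_val_ren)
next
  case (Rel p ts)
  show ?case by (rule exI[of _ "Rel p (map (tm_ren r) ts)"]) (simp add: tm_val_ren comp_def)
next
  case (Neg F)
  then show ?case by (metis sat.simps(3))
next
  case (Conj F G)
  then show ?case by (metis sat.simps(4))
next
  case (Ex k F)
  obtain N where N: "\<forall>e e'. (\<forall>i<N. e i = e' i) \<longrightarrow> sat S e F = sat S e' F"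
    using fin_support_sat unfolding fin_support_def by metis
  \<comment> \<open>The map \<open>r\<close> is arbitrary and need not be injective. The new bound
    variable lies above the images of all variables on which \<open>F\<close> depends, so nothing is
    captured.\<close>
  define m where "m = Suc (Max (insert 0 (r ` {..<N})))"
  have m: "r i \<noteq> m" if "i < N" for i
  proof -
    have "r i \<le> Max (insert 0 (r ` {..<N}))" using that by (intro Max_ge) auto
    then show ?thesis by (simp add: m_def)
  qed
  obtain G where G: "\<forall>e. sat S e G = sat S (\<lambda>i. e ((r(k := m)) i)) F" using Ex by blast
  have "sat S ((\<lambda>i. e (r i))(k := a)) F = sat S (e(m := a)) G" for e a
    unfolding G[rule_format] by (rule N[rule_format]) (use m in auto)
  then show ?case by (intro exI[of _ "Ex m G"]) simp
qed

section \<open>Closure properties of definable predicates and functions\<close>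

lemma dpred_support:
  assumes "dpred S P"
  obtains N where "\<And>e e'. (\<And>i. i < N \<Longrightarrow> e i = e' i) \<Longrightarrow> P e = P e'"
  using assms fin_support_sat unfolding dpred_def fin_support_def by metis

lemma dpred_ren: "dpred S P \<Longrightarrow> dpred S (\<lambda>e. P (\<lambda>i. e (r i)))"
  unfolding dpred_def by (metis sat_ren)

lemma dpred_not: "dpred S P \<Longrightarrow> dpred S (\<lambda>e. \<not> P e)"
  unfolding dpred_def by (metis sat.simps(3))

lemma dpred_conj: "dpred S P \<Longrightarrow> dpred S Q \<Longrightarrow> dpred S (\<lambda>e. P e \<and> Q e)"
  unfolding dpred_def by (metis sat.simps(4))

lemma dpred_disj: "dpred S P \<Longrightarrow> dpred S Q \<Longrightarrow> dpred S (\<lambda>e. P e \<or> Q e)"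
  using dpred_not[OF dpred_conj[OF dpred_not dpred_not]] by fastforce

lemma dpred_imp: "dpred S P \<Longrightarrow> dpred S Q \<Longrightarrow> dpred S (\<lambda>e. P e \<longrightarrow> Q e)"
  using dpred_disj[OF dpred_not] by fastforce

lemma dpred_iff: "dpred S P \<Longrightarrow> dpred S Q \<Longrightarrow> dpred S (\<lambda>e. P e = Q e)"
  unfolding iff_conv_conj_imp by (intro dpred_conj dpred_imp)

lemma dpred_const: "dpred S (\<lambda>e. b)"
proof -
  have "dpred S (\<lambda>e. e 0 = e 0)" unfolding dpred_def by (rule exI[of _ "Eq (Var 0) (Var 0)"]) simp
  then show ?thesis using dpred_not by (cases b) fastforce+
qed

lemma dpred_ex:
  assumes "dpred S (\<lambda>e. Q (\<lambda>i. e (Suc i)) (e 0))"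
  shows "dpred S (\<lambda>e. \<exists>a. Q e a)"
proof -
  obtain F where "\<forall>e. sat S e F = Q (\<lambda>i. e (Suc i)) (e 0)" using assms unfolding dpred_def by blast
  then have "dpred S (\<lambda>e. \<exists>a. Q (\<lambda>i. e (Suc i)) a)"
    unfolding dpred_def by (intro exI[of _ "Ex 0 F"]) simp
  \<comment> \<open>Renaming by truncated subtraction undoes the shift: position
    \<open>Suc i\<close> reads \<open>e i\<close>, and the value at position 0 is no longer
    consulted.\<close>
  from dpred_ren[OF this, of "\<lambda>i. i - 1"] show ?thesis by simp
qed

lemma dpred_all: "dpred S (\<lambda>e. Q (\<lambda>i. e (Suc i)) (e 0)) \<Longrightarrow> dpred S (\<lambda>e. \<forall>a. Q e a)"
  using dpred_not[OF dpred_ex[of S "\<lambda>e a. \<not> Q e a"]] dpred_not by fastforce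

lemma dpred_fin_Bex: "finite I \<Longrightarrow> (\<And>i. i \<in> I \<Longrightarrow> dpred S (P i)) \<Longrightarrow> dpred S (\<lambda>e. \<exists>i\<in>I. P i e)"
  by (induction I rule: finite_induct) (simp_all add: dpred_const dpred_disj)

lemma dpred_fin_Ball: "finite I \<Longrightarrow> (\<And>i. i \<in> I \<Longrightarrow> dpred S (P i)) \<Longrightarrow> dpred S (\<lambda>e. \<forall>i\<in>I. P i e)"
  by (induction I rule: finite_induct) (simp_all add: dpred_const dpred_conj)

lemma dfun_var: "dfun S (\<lambda>e. e i)"
  unfolding dfun_def dpred_def by (rule exI[of _ "Eq (Var 0) (Var (Suc i))"]) simp

lemma dfun_const: "dfun S (\<lambda>e. c)"
  unfolding dfun_def dpred_def by (rule exI[of _ "Eq (Var 0) (Param c)"]) simp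

lemma dfun_ren: "dfun S f \<Longrightarrow> dfun S (\<lambda>e. f (\<lambda>i. e (r i)))"
  unfolding dfun_def using dpred_ren[of S _ "case_nat 0 (\<lambda>i. Suc (r i))"] by fastforce

text \<open>The environment is interleaved: even positions hold the arguments of \<open>h\<close>,
  odd positions the current arguments of \<open>P\<close>. Each step overwrites one odd position by
  a value of \<open>h\<close>, which cannot disturb the even ones. Once the support of
  \<open>P\<close> is exhausted, renaming by \<open>i div 2\<close> merges the two halves.\<close>

lemma dpred_subst:
  fixes S :: "('f, 'p, 'a::real_closed_field) expansion"
  assumes P: "dpred S P" and h: "\<And>i. dfun S (\<lambda>e. h e i)"
  shows "dpred S (\<lambda>e. P (h e))"
proof -
  have step: "dpred S (\<lambda>e. P (\<lambda>i. if i < k then h (\<lambda>j. e (2 * j)) i else e (2 * i + 1)))" for k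
  proof (induction k)
    case 0
    show ?case using dpred_ren[OF P] by simp
  next
    case (Suc k)
    let ?B = "\<lambda>e. P (\<lambda>i. if i < k then h (\<lambda>j. e (2 * j)) i else e (2 * i + 1))"
    let ?U = "\<lambda>e a. e(2 * k + 1 := a)"
    have 1: "dpred S (\<lambda>e. ?B (?U (\<lambda>i. e (Suc i)) (e 0)))"
    proof -
      have "(?U (\<lambda>i. e (Suc i)) (e 0)) = (\<lambda>i. e (if i = 2 * k + 1 then 0 else Suc i))" for e :: "nat \<Rightarrow> 'a" by auto
      then have "?B (?U (\<lambda>i. e (Suc i)) (e 0)) = ?B (\<lambda>i. e (if i = 2 * k + 1 then 0 else Suc i))" for e :: "nat \<Rightarrow> 'a"
        by (simp only:)
      then show ?thesis
        using dpred_ren[OF Suc, of "\<lambda>i. if i = 2 * k + 1 then 0 else Suc i"] by (simp only:)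
    qed
    have 2: "dpred S (\<lambda>e. e 0 = h (\<lambda>j. e (Suc (2 * j))) k)"
      using dfun_ren[OF h[of k], of "\<lambda>j. 2 * j"] unfolding dfun_def by simp
    have "dpred S (\<lambda>e. \<exists>a. a = h (\<lambda>j. e (2 * j)) k \<and> ?B (?U e a))"
      by (rule dpred_ex[where Q = "\<lambda>e a. a = h (\<lambda>j. e (2 * j)) k \<and> ?B (?U e a)"])
        (rule dpred_conj[OF 2 1])
    moreover have "(\<lambda>i. if i < k then h (\<lambda>j. (?U e (h (\<lambda>j. e (2 * j)) k)) (2 * j)) i
          else (?U e (h (\<lambda>j. e (2 * j)) k)) (2 * i + 1)) =
        (\<lambda>i. if i < Suc k then h (\<lambda>j. e (2 * j)) i else e (2 * i + 1))" for e :: "nat \<Rightarrow> 'a"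
    proof -
      have "2 * j \<noteq> 2 * k + 1" for j by presburger
      then show ?thesis by (auto simp: fun_eq_iff less_Suc_eq)
    qed
    ultimately show ?case by (simp del: fun_upd_apply)
  qed
  obtain N where N: "\<And>e e'. (\<And>i. i < N \<Longrightarrow> e i = e' i) \<Longrightarrow> P e = P e'"
    using dpred_support[OF P] by metis
  have "P (h e) = P (\<lambda>i. if i < N then h e i else e i)" for e by (rule N) auto
  with dpred_ren[OF step, of N "\<lambda>i. i div 2"] show ?thesis by (simp cong: if_cong)
qed

lemma dpred_subst1:
  assumes "dpred S (\<lambda>e. Q (\<lambda>i. e (Suc i)) (e 0))" "\<And>i. dfun S (\<lambda>e. h e i)" "dfun S f"
  shows "dpred S (\<lambda>e. Q (h e) (f e))"
proof -
  have "dfun S (\<lambda>e. push (f e) (h e) i)" for i using assms(2,3) by (cases i) auto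
  from dpred_subst[OF assms(1), of "\<lambda>e. push (f e) (h e)", OF this] show ?thesis by simp
qed

lemma dfun_subst:
  assumes "dfun S f" "\<And>i. dfun S (\<lambda>e. h e i)" 
  shows "dfun S (\<lambda>e. f (h e))"
  unfolding dfun_def
  by (rule dpred_subst1[where Q = "\<lambda>e a. a = f e" and h = "\<lambda>e. h (\<lambda>i. e (Suc i))" and f = "\<lambda>e. e 0"])
    (use assms dfun_ren[OF assms(2), of Suc] in \<open>simp_all add: dfun_def[symmetric] dfun_var\<close>)

lemma dpred_eq: "dfun S f \<Longrightarrow> dfun S g \<Longrightarrow> dpred S (\<lambda>e. f e = g e)"
  using dpred_subst1[of S "\<lambda>e a. a = g e" "\<lambda>e. e" f] by (simp add: dfun_def dfun_var[unfolded dfun_def])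

lemma dfun_plus: "dfun S f \<Longrightarrow> dfun S g \<Longrightarrow> dfun S (\<lambda>e. f e + g e)"
proof -
  assume "dfun S f" "dfun S g"
  moreover have "dfun S (\<lambda>e. e 0 + e (Suc 0))"
    unfolding dfun_def dpred_def by (rule exI[of _ "Eq (Var 0) (Plus (Var 1) (Var 2))"]) (simp add: numeral_2_eq_2)
  moreover have "dfun S (\<lambda>e. if i = 0 then f e else g e)" for i :: nat
    using calculation by (cases "i = 0") auto
  ultimately show ?thesis using dfun_subst[of S "\<lambda>e. e 0 + e (Suc 0)" "\<lambda>e i. if i = 0 then f e else g e"] by (simp split: if_split)
qed

lemma dfun_times: "dfun S f \<Longrightarrow> dfun S g \<Longrightarrow> dfun S (\<lambda>e. f e * g e)"
proof -
  assume "dfun S f" "dfun S g"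
  moreover have "dfun S (\<lambda>e. e 0 * e (Suc 0))"
    unfolding dfun_def dpred_def by (rule exI[of _ "Eq (Var 0) (Times (Var 1) (Var 2))"]) (simp add: numeral_2_eq_2)
  moreover have "dfun S (\<lambda>e. if i = 0 then f e else g e)" for i :: nat
    using calculation by (cases "i = 0") auto
  ultimately show ?thesis using dfun_subst[of S "\<lambda>e. e 0 * e (Suc 0)" "\<lambda>e i. if i = 0 then f e else g e"] by (simp split: if_split)
qed

lemma dfun_graph:
  assumes "dpred S (\<lambda>e. Q (\<lambda>i. e (Suc i)) (e 0))" "\<And>e a. Q e a \<longleftrightarrow> a = f e"
  shows "dfun S f"
  using assms unfolding dfun_def by simp

lemma dfun_uminus: "dfun S f \<Longrightarrow> dfun S (\<lambda>e. - f e)"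
  using dfun_times[OF dfun_const[of S "-1"]] by fastforce

lemma dfun_minus: "dfun S f \<Longrightarrow> dfun S g \<Longrightarrow> dfun S (\<lambda>e. f e - g e)"
  using dfun_plus[OF _ dfun_uminus] by fastforce

lemma dfun_if: 
  assumes "dpred S P" "dfun S f" "dfun S g"
  shows "dfun S (\<lambda>e. if P e then f e else g e)"
proof -
  have "dpred S (\<lambda>e. (P (\<lambda>i. e (Suc i)) \<longrightarrow> e 0 = f (\<lambda>i. e (Suc i))) \<and> (\<not> P (\<lambda>i. e (Suc i)) \<longrightarrow> e 0 = g (\<lambda>i. e (Suc i))))"
    by (intro dpred_conj dpred_imp dpred_not dpred_ren[OF assms(1)] assms(2,3)[unfolded dfun_def])
  then show ?thesis unfolding dfun_def by (rule back_subst[of "dpred S"]) auto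
qed

text \<open>Terms and atomic formulas have no built-in order symbol; squares make the order
  expressible.\<close>

lemma le_iff_square: "(a::'a::real_closed_field) \<le> b \<longleftrightarrow> (\<exists>c. c * c = b - a)"
  by (metis ex_square_root zero_le_square diff_ge_0_iff_ge)

lemma dpred_le: "dfun S f \<Longrightarrow> dfun S g \<Longrightarrow> dpred S (\<lambda>e. f e \<le> g e)"
  unfolding le_iff_square
  by (rule dpred_ex, rule dpred_eq)
    (intro dfun_times dfun_var, intro dfun_minus, auto intro: dfun_ren)

lemma dpred_less: "dfun S f \<Longrightarrow> dfun S g \<Longrightarrow> dpred S (\<lambda>e. f e < g e)"
  using dpred_not[OF dpred_le] by (fastforce simp: not_le)

lemma dfun_abs: "dfun S f \<Longrightarrow> dfun S (\<lambda>e. \<bar>f e\<bar>)"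
  unfolding abs_if by (intro dfun_if dpred_less dfun_const dfun_uminus)

lemma dfun_max: "dfun S f \<Longrightarrow> dfun S g \<Longrightarrow> dfun S (\<lambda>e. max (f e) (g e))"
  unfolding max_def by (intro dfun_if dpred_le)

lemma dfun_min: "dfun S f \<Longrightarrow> dfun S g \<Longrightarrow> dfun S (\<lambda>e. min (f e) (g e))"
  unfolding min_def by (intro dfun_if dpred_le)

lemma dfun_inverse: "dfun S f \<Longrightarrow> dfun S (\<lambda>e. inverse (f e))"
proof (rule dfun_graph)
  assume f: "dfun S f"
  show "dpred S (\<lambda>e. if f (\<lambda>i. e (Suc i)) = 0 then e 0 = 0 else e 0 * f (\<lambda>i. e (Suc i)) = 1)"
    unfolding if_bool_eq_conj
    by (intro dpred_conj dpred_imp dpred_not dpred_eq dfun_times dfun_var dfun_const dfun_ren[OF f])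
qed (auto simp: field_simps)

lemma dfun_divide: "dfun S f \<Longrightarrow> dfun S g \<Longrightarrow> dfun S (\<lambda>e. f e / g e)"
  unfolding divide_inverse by (intro dfun_times dfun_inverse)

lemma dpred_ex1: "dpred S (\<lambda>e. Q (\<lambda>i. e (Suc i)) (e 0)) \<Longrightarrow>
  dpred S (\<lambda>e. Q (\<lambda>i. e (Suc (Suc i))) (e 0)) \<Longrightarrow> dpred S (\<lambda>e. \<exists>!a. Q e a)"
  unfolding Ex1_def
  by (intro dpred_ex dpred_conj dpred_all dpred_imp dpred_eq dfun_var)

text \<open>Only the first \<open>d\<close> values of \<open>v\<close> are read, so this is
  quantification over \<open>R\<^sup>d\<close>; it serves to quantify over the points of a chart or
  over the entries of a matrix.\<close>

lemma dpred_exn: "dpred S P \<Longrightarrow> dpred S (\<lambda>e. \<exists>v. P (\<lambda>i. if i < d then v i else e (i - d)))"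
proof (induction d)
  case 0
  then show ?case by simp
next
  case (Suc d)
  have "(\<exists>v. P (\<lambda>i. if i < Suc d then v i else e (i - Suc d))) \<longleftrightarrow>
    (\<exists>a v. P (\<lambda>i. if i < d then v i else push a e (i - d)))" for e
  proof (safe, goal_cases)
    case (1 v)
    have "(\<lambda>i. if i < Suc d then v i else e (i - Suc d)) =
      (\<lambda>i. if i < d then v i else push (v d) e (i - d))"
      by (auto simp: fun_eq_iff less_Suc_eq split: nat.split) (metis Suc_diff_Suc diff_Suc_Suc not_less_eq nat.inject linorder_neqE_nat diff_Suc_eq_diff_pred)
    then show ?case using 1 by (intro exI[of _ "v d"] exI[of _ v]) simp
  next
    case (2 a v)
    have "(\<lambda>i. if i < d then v i else push a e (i - d)) =
      (\<lambda>i. if i < Suc d then (v(d := a)) i else e (i - Suc d))"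
      by (auto simp: fun_eq_iff less_Suc_eq Suc_diff_Suc split: nat.split) (metis Suc_diff_Suc nat.inject diff_Suc_Suc linorder_neqE_nat not_less_eq)
    then show ?case using 2 by (intro exI[of _ "v(d := a)"]) simp
  qed
  moreover have "dpred S (\<lambda>e. \<exists>a v. P (\<lambda>i. if i < d then v i else push a e (i - d)))"
  proof (rule dpred_ex)
    show "dpred S (\<lambda>e. \<exists>v. P (\<lambda>i. if i < d then v i else push (e 0) (\<lambda>i. e (Suc i)) (i - d)))"
      using Suc by (simp add: push_eta' cong: if_cong)
  qed
  ultimately show ?case by simp
qed

lemmas dintros = dpred_not dpred_conj dpred_disj dpred_imp dpred_iff dpred_ex1 dpred_ex dpred_all
  dpred_eq dpred_le dpred_less dfun_plus dfun_times dfun_uminus dfun_minus dfun_if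
  dfun_abs dfun_max dfun_min dfun_inverse dfun_divide dfun_var dfun_const

text \<open>The bridge between sets in a fixed dimension and predicates on environments: passing to
  \<open>vec m e\<close> discards exactly the coordinates that \<open>definable_set\<close> sets to
  0.\<close>

lemma definable_set_iff_dpred:
  "definable_set S m X \<longleftrightarrow> X \<subseteq> carrier_vec m \<and> dpred S (\<lambda>e. vec m e \<in> X)"
proof safe
  assume "definable_set S m X"
  then obtain F where F: "X = {v \<in> carrier_vec m. sat S (\<lambda>i. if i < m then v $ i else 0) F}"
    unfolding definable_set_def by blast
  then show "v \<in> carrier_vec m" if "v \<in> X" for v using that by auto
  have "dpred S (\<lambda>e. sat S e F)" unfolding dpred_def by blast
  moreover have "dfun S (\<lambda>e. if i < m then e i else 0)" for i by (intro dintros dpred_const)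
  ultimately have "dpred S (\<lambda>e. sat S (\<lambda>i. if i < m then e i else 0) F)" by (rule dpred_subst)
  moreover have "(vec m e \<in> X) = sat S (\<lambda>i. if i < m then e i else 0) F" for e
    unfolding F by (auto cong: if_cong)
  ultimately show "dpred S (\<lambda>e. vec m e \<in> X)" by simp
next
  assume X: "X \<subseteq> carrier_vec m" and "dpred S (\<lambda>e. vec m e \<in> X)"
  then obtain F where F: "\<forall>e. sat S e F = (vec m e \<in> X)" unfolding dpred_def by blast
  have "vec m (\<lambda>i. if i < m then v $ i else 0) = v" if "v \<in> carrier_vec m" for v
    using that by auto
  then have "X = {v \<in> carrier_vec m. sat S (\<lambda>i. if i < m then v $ i else 0) F}"
    using X F by auto
  then show "definable_set S m X" unfolding definable_set_def by blast
qed

section \<open>Definable subsets and functions of one variable\<close>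

lemma dpred1_comp: "dpred S (\<lambda>e. P (e 0)) \<Longrightarrow> dfun S f \<Longrightarrow> dpred S (\<lambda>e. P (f e))"
  by (rule dpred_subst1[where Q = "\<lambda>_ a. P a" and h = "\<lambda>e. e"]) (auto intro: dfun_var)

lemma dfun1_comp: "dfun S (\<lambda>e. g (e 0)) \<Longrightarrow> dfun S f \<Longrightarrow> dfun S (\<lambda>e. g (f e))"
  using dfun_subst[of S "\<lambda>e. g (e 0)" "\<lambda>e i. f e"] by simp

text \<open>Like the next two notions, written out with absolute values and not through the
  topology: as first-order conditions they are definable by the closure rules.\<close>

definition frontier_pt :: "('a::real_closed_field \<Rightarrow> bool) \<Rightarrow> 'a \<Rightarrow> bool" where
  "frontier_pt P x \<longleftrightarrow> (\<forall>d>0. (\<exists>z. \<bar>z - x\<bar> < d \<and> P z) \<and> (\<exists>z. \<bar>z - x\<bar> < d \<and> \<not> P z))"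

definition cont_at :: "('a::real_closed_field \<Rightarrow> 'a) \<Rightarrow> 'a \<Rightarrow> bool" where
  "cont_at f x \<longleftrightarrow> (\<forall>r>0. \<exists>d>0. \<forall>y. \<bar>y - x\<bar> < d \<longrightarrow> \<bar>f y - f x\<bar> < r)"

definition right_lim :: "('a::real_closed_field \<Rightarrow> 'a) \<Rightarrow> 'a \<Rightarrow> 'a \<Rightarrow> bool" where
  "right_lim f x L \<longleftrightarrow> (\<forall>r>0. \<exists>d>0. \<forall>y. x < y \<and> y < x + d \<longrightarrow> \<bar>f y - L\<bar> < r)"

lemma right_lim_unique:
  assumes "right_lim f x L" "right_lim f x L'"
  shows "L = (L' :: 'a::real_closed_field)"
proof (rule ccontr)
  assume "L \<noteq> L'"
  then have r: "\<bar>L - L'\<bar> / 2 > 0" by simp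
  obtain d where d: "d > 0" "\<And>y. x < y \<Longrightarrow> y < x + d \<Longrightarrow> \<bar>f y - L\<bar> < \<bar>L - L'\<bar> / 2"
    using assms(1) r unfolding right_lim_def by blast
  obtain d' where d': "d' > 0" "\<And>y. x < y \<Longrightarrow> y < x + d' \<Longrightarrow> \<bar>f y - L'\<bar> < \<bar>L - L'\<bar> / 2"
    using assms(2) r unfolding right_lim_def by blast
  define y where "y = x + min d d' / 2"
  have "x < y" "y < x + d" "y < x + d'" using d(1) d'(1) by (auto simp: y_def min_def)
  then have "\<bar>f y - L\<bar> < \<bar>L - L'\<bar> / 2" "\<bar>f y - L'\<bar> < \<bar>L - L'\<bar> / 2" using d d' by auto
  then show False by (auto simp: abs_if split: if_splits)
qed

section \<open>Consequences of o-minimality on the line\<close>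

context
  fixes S :: "('f, 'p, 'a::real_closed_field) expansion"
  assumes om: "o_minimal S"
begin

lemma o_minimal_pieces:
  assumes "dpred S (\<lambda>e. P (e 0))"
  obtains \<I> where "finite \<I>" "{a. P a} = \<Union>\<I>"
    "\<And>J. J \<in> \<I> \<Longrightarrow> (\<exists>a. J = {a}) \<or> (\<exists>a b. J = {a<..<b}) \<or> (\<exists>a. J = {a<..}) \<or> (\<exists>b. J = {..<b}) \<or> J = UNIV"
proof -
  have "(vec 1 e \<in> vec1 ` {a. P a}) = P (e 0)" for e
  proof -
    have "vec 1 e = vec1 (e 0)" by (auto simp: vec1_def)
    moreover have "vec1 a $ 0 = a" for a :: 'a by (simp add: vec1_def)
    then have "vec1 a = vec1 b \<longleftrightarrow> a = b" for a b :: 'a by metis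
    ultimately show ?thesis by auto
  qed
  then have "definable_set S 1 (vec1 ` {a. P a})"
    using assms by (auto simp: definable_set_iff_dpred vec1_def)
  then show thesis using om that unfolding o_minimal_def by metis
qed

text \<open>Rays and points have a constant germ to the right of \<open>x\<close>, and this property
  passes to finite intersections and unions, hence to finite unions of o-minimal pieces.\<close>

lemma definable_right_germ:
  assumes "dpred S (\<lambda>e. P (e 0))"
  shows "\<exists>d>0. (\<forall>y. x < y \<and> y < x + d \<longrightarrow> P y) \<or> (\<forall>y. x < y \<and> y < x + d \<longrightarrow> \<not> P y)"
proof -
  obtain \<I> where I: "finite \<I>" "{a. P a} = \<Union>\<I>"
    "\<And>J. J \<in> \<I> \<Longrightarrow> (\<exists>a. J = {a}) \<or> (\<exists>a b. J = {a<..<b}) \<or> (\<exists>a. J = {a<..}) \<or> (\<exists>b. J = {..<b}) \<or> J = UNIV"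
    using o_minimal_pieces[OF assms] by metis
  let ?G = "\<lambda>J. \<exists>d>0. (\<forall>y. x < y \<and> y < x + d \<longrightarrow> y \<in> J) \<or> (\<forall>y. x < y \<and> y < x + d \<longrightarrow> y \<notin> J)"
  have ray: "?G {a<..}" for a
    by (cases "x < a") (rule exI[of _ "a - x"], force, rule exI[of _ 1], force)
  have ray': "?G {..<a}" for a
    by (cases "x < a") (rule exI[of _ "a - x"], force, rule exI[of _ 1], force)
  have int: "?G (A \<inter> B)" if GA: "?G A" and GB: "?G B" for A B
  proof -
    obtain d where "d > 0" "(\<forall>y. x < y \<and> y < x + d \<longrightarrow> y \<in> A) \<or> (\<forall>y. x < y \<and> y < x + d \<longrightarrow> y \<notin> A)"
      using GA by (elim exE conjE)
    moreover obtain d' where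
      "d' > 0" "(\<forall>y. x < y \<and> y < x + d' \<longrightarrow> y \<in> B) \<or> (\<forall>y. x < y \<and> y < x + d' \<longrightarrow> y \<notin> B)"
      using GB by (elim exE conjE)
    ultimately show ?thesis by (intro exI[of _ "min d d'"]) auto
  qed
  have un: "?G (A \<union> B)" if GA: "?G A" and GB: "?G B" for A B
  proof -
    obtain d where "d > 0" "(\<forall>y. x < y \<and> y < x + d \<longrightarrow> y \<in> A) \<or> (\<forall>y. x < y \<and> y < x + d \<longrightarrow> y \<notin> A)"
      using GA by (elim exE conjE)
    moreover obtain d' where
      "d' > 0" "(\<forall>y. x < y \<and> y < x + d' \<longrightarrow> y \<in> B) \<or> (\<forall>y. x < y \<and> y < x + d' \<longrightarrow> y \<notin> B)"
      using GB by (elim exE conjE)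
    ultimately show ?thesis by (intro exI[of _ "min d d'"]) auto
  qed
  have sing: "?G {a}" for a
    by (cases "x < a") (rule exI[of _ "a - x"], force, rule exI[of _ 1], force)
  have "?G J" if "J \<in> \<I>" for J
  proof -
    have ivl: "?G {a<..<b}" for a b
      using int[OF ray[of a] ray'[of b]] by (simp add: greaterThanLessThan_def)
    have univ: "?G UNIV" by (rule exI[of _ 1]) auto
    from I(3)[OF that] show ?thesis
      by (elim disjE exE) (hypsubst, (rule ivl ray ray' sing univ))+
  qed
  with I(1) have "?G (\<Union>\<I>)"
  proof (induction \<I> rule: finite_induct)
    case empty
    show ?case by (rule exI[of _ 1]) auto
  next
    case (insert J \<I>)
    have "?G (J \<union> \<Union>\<I>)" by (rule un[OF insert.prems insert.IH]) (use insert.prems in auto)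
    then show ?case by simp
  qed
  then show ?thesis unfolding I(2)[symmetric] by simp
qed

lemma definable_infinite_interval:
  assumes "dpred S (\<lambda>e. P (e 0))" "infinite {a. P a}"
  obtains a b where "a < b" "\<And>x. a < x \<Longrightarrow> x < b \<Longrightarrow> P x"
proof -
  obtain \<I> where I: "finite \<I>" "{a. P a} = \<Union>\<I>"
    "\<And>J. J \<in> \<I> \<Longrightarrow> (\<exists>a. J = {a}) \<or> (\<exists>a b. J = {a<..<b}) \<or> (\<exists>a. J = {a<..}) \<or> (\<exists>b. J = {..<b}) \<or> J = UNIV"
    using o_minimal_pieces[OF assms(1)] by metis
  then obtain J where J: "J \<in> \<I>" "infinite J" using assms(2) finite_Union by metis
  have "\<exists>a b. a < b \<and> {a<..<b} \<subseteq> J"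
    using I(3)[OF J(1)]
  proof (elim disjE exE)
    fix a b assume "J = {a<..<b}"
    moreover from this J(2) have "a < b" by (metis finite.emptyI greaterThanLessThan_empty not_le)
    ultimately show ?thesis by blast
  next
    fix a assume "J = {a<..}"
    then show ?thesis by (intro exI[of _ a] exI[of _ "a + 1"]) auto
  next
    fix b assume "J = {..<b}"
    then show ?thesis by (intro exI[of _ "b - 1"] exI[of _ b]) auto
  next
    assume "J = UNIV"
    then show ?thesis by (intro exI[of _ 0] exI[of _ 1]) auto
  qed (use J(2) in auto)
  then obtain a b where "a < b" "{a<..<b} \<subseteq> {a. P a}" using I(2) J(1) by (metis Union_upper subset_trans)
  then have "P x" if "a < x" "x < b" for x using that by auto
  then show thesis using that[of a b] \<open>a < b\<close> by blast
qed

text \<open>R need not be complete, but a bounded definable set is a finite union of points and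
  intervals, so the largest right end of its nonempty pieces is its supremum.\<close>

lemma definable_sup:
  assumes "dpred S (\<lambda>e. P (e 0))" "P a0" "\<And>a. P a \<Longrightarrow> a \<le> u"
  obtains s where "\<And>a. P a \<Longrightarrow> a \<le> s" "\<And>c. c < s \<Longrightarrow> \<exists>a>c. P a"
proof -
  obtain \<I> where I: "finite \<I>" "{a. P a} = \<Union>\<I>"
    "\<And>J. J \<in> \<I> \<Longrightarrow> (\<exists>a. J = {a}) \<or> (\<exists>a b. J = {a<..<b}) \<or> (\<exists>a. J = {a<..}) \<or> (\<exists>b. J = {..<b}) \<or> J = UNIV"
    using o_minimal_pieces[OF assms(1)] by metis
  have bd: "a \<le> u" if "a \<in> J" "J \<in> \<I>" for a J using that I(2) assms(3) by blast
  let ?L = "\<lambda>J s. (\<forall>a\<in>J. a \<le> s) \<and> (\<forall>c<s. \<exists>a\<in>J. c < a)"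
  have piece: "\<exists>s. ?L J s" if "J \<in> \<I>" "J \<noteq> {}" for J
    using I(3)[OF that(1)]
  proof (elim disjE exE)
    fix a assume "J = {a}"
    then show ?thesis by (intro exI[of _ a]) auto
  next
    fix a b assume J: "J = {a<..<b}"
    with that(2) have "a < b" by auto
    then have "\<exists>x\<in>J. c < x" if "c < b" for c
      using dense[of "max a c" b] that J by auto
    then show ?thesis using J by (intro exI[of _ b]) auto
  next
    fix a assume "J = {a<..}"
    then have "max u a + 1 \<in> J" by (simp add: max_def)
    from bd[OF this that(1)] show ?thesis by (simp add: max_def split: if_splits)
  next
    fix b assume "J = {..<b}"
    then show ?thesis using dense by (intro exI[of _ b]) (auto intro: dense)
  next
    assume "J = UNIV"
    then have "u + 1 \<in> J" by simp
    from bd[OF this that(1)] show ?thesis by simp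
  qed
  obtain s where s: "\<And>J. J \<in> \<I> \<Longrightarrow> J \<noteq> {} \<Longrightarrow> ?L J (s J)" using piece by metis
  let ?I = "{J \<in> \<I>. J \<noteq> {}}"
  have fin: "finite (s ` ?I)" "s ` ?I \<noteq> {}" using I(1,2) assms(2) by auto
  show thesis
  proof (rule that[of "Max (s ` ?I)"])
    fix a assume "P a"
    then obtain J where "J \<in> \<I>" "a \<in> J" using I(2) by blast
    then have "a \<le> s J" "s J \<le> Max (s ` ?I)" using s fin by (blast, intro Max_ge) auto
    then show "a \<le> Max (s ` ?I)" by simp
  next
    fix c assume "c < Max (s ` ?I)"
    moreover obtain J where "J \<in> ?I" "Max (s ` ?I) = s J" using Max_in[OF fin] by blast
    moreover from this have "\<forall>c<s J. \<exists>a\<in>J. c < a" using s by blast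
    ultimately obtain a where "a \<in> J" "c < a" by auto
    then show "\<exists>a>c. P a" using I(2) \<open>J \<in> ?I\<close> by blast
  qed
qed

text \<open>The substitute for connectedness and compactness of a segment. Let s be the supremum of
  the points up to which \<open>P\<close> holds; since \<open>P\<close> is locally constant near s,
  it holds beyond s unless s is the right end. Applied to a statement about [0,b) with b as
  variable, this extends local estimates to a whole segment.\<close>

lemma definable_connected:
  assumes P: "dpred S (\<lambda>e. P (e 0))" and "x1 \<le> x2" and "P x1"
    and loc: "\<And>y. x1 \<le> y \<Longrightarrow> y \<le> x2 \<Longrightarrow> \<exists>d>0. \<forall>z z'. x1 \<le> z \<and> z \<le> x2 \<and> x1 \<le> z' \<and> z' \<le> x2 \<and>
      \<bar>z - y\<bar> < d \<and> \<bar>z' - y\<bar> < d \<and> P z \<longrightarrow> P z'"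
  shows "P x2"
proof -
  let ?X = "\<lambda>x. x1 \<le> x \<and> x \<le> x2 \<and> (\<forall>y. x1 \<le> y \<and> y \<le> x \<longrightarrow> P y)"
  have "dpred S (\<lambda>e. ?X (e 0))"
    by (intro dintros dpred1_comp[OF P])
  moreover have "?X x1" using assms(2,3) by (auto dest: antisym)
  ultimately obtain s where s: "\<And>a. ?X a \<Longrightarrow> a \<le> s" "\<And>c. c < s \<Longrightarrow> \<exists>a>c. ?X a"
    using definable_sup[of ?X x1 x2] by blast
  have "x1 \<le> s" using s(1)[OF \<open>?X x1\<close>] .
  have "s \<le> x2" using s(2)[of x2] by force
  obtain d where d: "d > 0" "\<And>z z'. x1 \<le> z \<Longrightarrow> z \<le> x2 \<Longrightarrow> x1 \<le> z' \<Longrightarrow> z' \<le> x2 \<Longrightarrow>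
      \<bar>z - s\<bar> < d \<Longrightarrow> \<bar>z' - s\<bar> < d \<Longrightarrow> P z \<Longrightarrow> P z'"
    using loc[OF \<open>x1 \<le> s\<close> \<open>s \<le> x2\<close>] by blast
  obtain a where a: "a > s - d" "?X a" using s(2)[of "s - d"] d(1) by auto
  have near: "P z" if "x1 \<le> z" "z \<le> x2" "\<bar>z - s\<bar> < d" for z
    by (rule d(2)[of a]) (use a s(1)[OF a(2)] that d(1) in auto)
  \<comment> \<open>Either a point strictly to the right of \<open>s\<close> or \<open>x2\<close>;
    as \<open>?X z\<close> gives \<open>z \<le> s\<close>, only \<open>x2\<close> is left.\<close>
  define z where "z = min x2 (s + d / 2)"
  have "?X z"
  proof (intro conjI allI impI)
    show "x1 \<le> z" "z \<le> x2" using \<open>x1 \<le> s\<close> d(1) assms(2) by (auto simp: z_def min_def)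
    fix y assume y: "x1 \<le> y \<and> y \<le> z"
    show "P y"
    proof (cases "y < s")
      case True
      then show ?thesis using s(2) y by (meson less_imp_le)
    next
      case False
      moreover have "y \<le> s + d / 2" "y \<le> x2" using y by (auto simp: z_def min_def split: if_splits)
      ultimately show ?thesis using y d(1) by (intro near) (auto simp: abs_if)
    qed
  qed
  then have "z \<le> s" by (rule s(1))
  then have "z = x2" using d(1) by (auto simp: z_def min_def split: if_splits)
  then show ?thesis using \<open>?X z\<close> by auto
qed

text \<open>An infinite set of frontier points would contain an interval. Just to the right of its
  left end \<open>P\<close> is constant, so there is no frontier point there.\<close>

lemma finite_frontier:
  assumes P: "dpred S (\<lambda>e. P (e 0))"
  shows "finite {x. frontier_pt P x}"
proof (rule ccontr)
  assume inf: "infinite {x. frontier_pt P x}"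
  have "dpred S (\<lambda>e. frontier_pt P (e 0))"
    unfolding frontier_pt_def by (intro dintros dpred1_comp[OF P])
  then obtain a b where ab: "a < b" "\<And>x. a < x \<Longrightarrow> x < b \<Longrightarrow> frontier_pt P x"
    using inf definable_infinite_interval by metis
  obtain d where d: "d > 0" "(\<forall>y. a < y \<and> y < a + d \<longrightarrow> P y) \<or> (\<forall>y. a < y \<and> y < a + d \<longrightarrow> \<not> P y)"
    using definable_right_germ[OF P] by blast
  define r where "r = min (b - a) d / 2"
  have r: "r > 0" "a + r < b" "a + r + r \<le> a + d" using ab(1) d(1) by (auto simp: r_def min_def field_simps)
  then have "frontier_pt P (a + r)" using ab by simp
  then obtain z z' where "\<bar>z - (a + r)\<bar> < r" "P z" "\<bar>z' - (a + r)\<bar> < r" "\<not> P z'"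
    using r(1) unfolding frontier_pt_def by meson
  then have "a < z" "z < a + d" "a < z'" "z' < a + d" using r by (auto simp: abs_if split: if_splits)
  then show False using d(2) \<open>P z\<close> \<open>\<not> P z'\<close> by blast
qed

text \<open>Without a frontier point in between, both \<open>P\<close> and its negation are locally
  constant, and connectedness applies to whichever holds at \<open>x1\<close>.\<close>

lemma frontier_between:
  assumes P: "dpred S (\<lambda>e. P (e 0))" and "x1 \<le> x2" and "P x1 \<noteq> P x2"
  shows "\<exists>z. x1 \<le> z \<and> z \<le> x2 \<and> frontier_pt P z"
proof (rule ccontr)
  assume *: "\<not> ?thesis"
  have loc: "\<exists>d>0. (\<forall>z. \<bar>z - y\<bar> < d \<longrightarrow> P z) \<or> (\<forall>z. \<bar>z - y\<bar> < d \<longrightarrow> \<not> P z)" if "x1 \<le> y" "y \<le> x2" for y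
    using * that unfolding frontier_pt_def by blast
  have "P x2" if "P x1"
  proof (rule definable_connected[OF P assms(2) that])
    fix y assume "x1 \<le> y" "y \<le> x2"
    from loc[OF this] obtain d where "d > 0" "(\<forall>z. \<bar>z - y\<bar> < d \<longrightarrow> P z) \<or> (\<forall>z. \<bar>z - y\<bar> < d \<longrightarrow> \<not> P z)"
      by blast
    then show "\<exists>d>0. \<forall>z z'. x1 \<le> z \<and> z \<le> x2 \<and> x1 \<le> z' \<and> z' \<le> x2 \<and>
      \<bar>z - y\<bar> < d \<and> \<bar>z' - y\<bar> < d \<and> P z \<longrightarrow> P z'" by (intro exI[of _ d]) blast
  qed
  moreover have "\<not> P x2" if "\<not> P x1"
  proof (rule definable_connected[OF dpred_not[OF P] assms(2) that])
    fix y assume "x1 \<le> y" "y \<le> x2"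
    from loc[OF this] obtain d where "d > 0" "(\<forall>z. \<bar>z - y\<bar> < d \<longrightarrow> P z) \<or> (\<forall>z. \<bar>z - y\<bar> < d \<longrightarrow> \<not> P z)"
      by blast
    then show "\<exists>d>0. \<forall>z z'. x1 \<le> z \<and> z \<le> x2 \<and> x1 \<le> z' \<and> z' \<le> x2 \<and>
      \<bar>z - y\<bar> < d \<and> \<bar>z' - y\<bar> < d \<and> \<not> P z \<longrightarrow> \<not> P z'" by (intro exI[of _ d]) blast
  qed
  ultimately show False using assms(3) by blast
qed

section \<open>One-sided limits and finiteness of discontinuities\<close>

lemma right_lim_exists:
  assumes f: "dfun S (\<lambda>e. f (e 0))" and bd: "\<And>x. \<bar>f x\<bar> \<le> B"
  shows "\<exists>L. right_lim f x L"
proof -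
  \<comment> \<open>The limit is found as the supremum of the eventual lower bounds to the right of
    \<open>x\<close>.\<close>
  let ?Q = "\<lambda>c. \<exists>d>0. \<forall>y. x < y \<and> y < x + d \<longrightarrow> c \<le> f y"
  have "dpred S (\<lambda>e. ?Q (e 0))" by (intro dintros dfun1_comp[OF f])
  moreover have "?Q (- B)" using bd by (intro exI[of _ 1]) (auto simp: abs_le_iff minus_le_iff)
  moreover have "c \<le> B" if "?Q c" for c
  proof -
    obtain d where "d > 0" "\<forall>y. x < y \<and> y < x + d \<longrightarrow> c \<le> f y" using \<open>?Q c\<close> by blast
    then have "c \<le> f (x + d / 2)" by simp
    then show ?thesis using bd[of "x + d / 2"] by (simp add: abs_le_iff)
  qed
  ultimately obtain L where L: "\<And>a. ?Q a \<Longrightarrow> a \<le> L" "\<And>c. c < L \<Longrightarrow> \<exists>a>c. ?Q a"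
    using definable_sup[of ?Q "- B" B] by blast
  have "\<exists>d>0. \<forall>y. x < y \<and> y < x + d \<longrightarrow> \<bar>f y - L\<bar> < r" if "r > 0" for r
  proof -
    obtain c d where c: "c > L - r" "d > 0" "\<forall>y. x < y \<and> y < x + d \<longrightarrow> c \<le> f y"
      using L(2)[of "L - r"] \<open>r > 0\<close> by auto
    \<comment> \<open>The germ of \<open>L + r / 2 \<le> f\<close> is constant. It is not eventually
      true, because \<open>L\<close> bounds all eventual lower bounds, so it is eventually false;
      this gives the upper estimate.\<close>
    have "dpred S (\<lambda>e. L + r / 2 \<le> f (e 0))" by (intro dintros dfun1_comp[OF f])
    then obtain d' where d': "d' > 0" "(\<forall>y. x < y \<and> y < x + d' \<longrightarrow> L + r / 2 \<le> f y) \<or>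
        (\<forall>y. x < y \<and> y < x + d' \<longrightarrow> \<not> L + r / 2 \<le> f y)"
      using definable_right_germ[of "\<lambda>t. L + r / 2 \<le> f t"] by blast
    moreover have "\<not> ?Q (L + r / 2)" using L(1)[of "L + r / 2"] \<open>r > 0\<close> by auto
    ultimately have "\<forall>y. x < y \<and> y < x + d' \<longrightarrow> f y < L + r / 2" by (meson not_le)
    then have "\<bar>f y - L\<bar> < r" if "x < y" "y < x + min d d'" for y
    proof -
      have "c \<le> f y" "f y < L + r / 2" using that c \<open>\<forall>y. x < y \<and> y < x + d' \<longrightarrow> f y < L + r / 2\<close> by auto
      then show ?thesis using c(1) \<open>r > 0\<close> by (auto simp: abs_if field_simps)
    qed
    then show ?thesis using c(2) d'(1) by (intro exI[of _ "min d d'"]) auto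
  qed
  then show ?thesis unfolding right_lim_def by blast
qed

text \<open>The function \<open>\<bar>f x - f(x+)\<bar>\<close> has right limit \<open>0\<close> everywhere. If it were positive on an infinite set,
  its image there would contain an interval, and then it would be bounded below on an interval.\<close>

lemma finite_right_discontinuities:
  assumes f: "dfun S (\<lambda>e. f (e 0))" and bd: "\<And>x. \<bar>f x\<bar> \<le> B"
  shows "finite {x. \<not> right_lim f x (f x)}"
proof -
  define R where "R x = (THE L. right_lim f x L)" for x
  have R: "right_lim f x L \<longleftrightarrow> L = R x" for x L
    unfolding R_def using right_lim_exists[OF f bd] right_lim_unique by (metis theI')
  have dR: "dfun S (\<lambda>e. R (e 0))"
  proof (rule dfun_graph)
    show "dpred S (\<lambda>e. right_lim f (e (Suc 0)) (e 0))"
      unfolding right_lim_def by (intro dintros dfun1_comp[OF f])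
  qed (simp add: R)
  define h where "h x = \<bar>f x - R x\<bar>" for x
  have dh: "dfun S (\<lambda>e. h (e 0))" unfolding h_def by (intro dintros f dR)
  \<comment> \<open>If \<open>r \<le> h\<close> on an interval starting at \<open>a\<close>, take
    \<open>y\<close> slightly to the right of \<open>a\<close> and \<open>z\<close> slightly to the
    right of \<open>y\<close>. Then \<open>f y\<close> and \<open>f z\<close> are within
    \<open>r / 3\<close> of \<open>R a\<close>, and \<open>f z\<close> is within
    \<open>r / 3\<close> of \<open>R y\<close>, so \<open>h y < r\<close>.\<close>
  have fin: "finite {x. r \<le> h x}" if "r > 0" for r
  proof (rule ccontr)
    assume "infinite {x. r \<le> h x}"
    moreover have "dpred S (\<lambda>e. r \<le> h (e 0))" by (intro dintros dh)
    ultimately obtain a b where ab: "a < b" "\<And>x. a < x \<Longrightarrow> x < b \<Longrightarrow> r \<le> h x"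
      using definable_infinite_interval[of "\<lambda>t. r \<le> h t"] by metis
    have "r / 3 > 0" using that by simp
    then obtain d where d: "d > 0" "\<And>y. a < y \<Longrightarrow> y < a + d \<Longrightarrow> \<bar>f y - R a\<bar> < r / 3"
      using R[of a "R a"] unfolding right_lim_def by blast
    define y where "y = a + min d (b - a) / 2"
    have y: "a < y" "y < a + d" "y < b" using ab(1) d(1) by (auto simp: y_def min_def field_simps)
    obtain d' where d': "d' > 0" "\<And>z. y < z \<Longrightarrow> z < y + d' \<Longrightarrow> \<bar>f z - R y\<bar> < r / 3"
      using R[of y "R y"] \<open>r / 3 > 0\<close> unfolding right_lim_def by blast
    define z where "z = y + min d' (a + d - y) / 2"
    have z: "y < z" "z < y + d'" "z < a + d" using y d'(1) by (auto simp: z_def min_def field_simps)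
    have "\<bar>f y - R a\<bar> < r / 3" "\<bar>f z - R a\<bar> < r / 3" "\<bar>f z - R y\<bar> < r / 3"
      using y z d(2) d'(2) by auto
    then have "h y < r" unfolding h_def by (auto simp: abs_if split: if_splits)
    then show False using ab(2)[of y] y by auto
  qed
  have "finite {x. 0 < h x}"
  proof (rule ccontr)
    assume inf: "infinite {x. 0 < h x}"
    let ?I = "\<lambda>c. \<exists>x. 0 < h x \<and> c = h x"
    have eq: "{c. ?I c} = h ` {x. 0 < h x}" by auto
    show False
    proof (cases "finite {c. ?I c}")
      case True
      then have "finite (h ` {x. 0 < h x})" by (simp add: eq)
      from pigeonhole_infinite[OF inf this] obtain x0 where
        x0: "0 < h x0" "infinite {x \<in> {x. 0 < h x}. h x = h x0}" by blast
      from fin[OF x0(1)] have "finite {x \<in> {x. 0 < h x}. h x = h x0}"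
        by (rule finite_subset[rotated]) auto
      then show False using x0(2) by simp
    next
      case False
      have "dpred S (\<lambda>e. ?I (e 0))" by (intro dintros dfun1_comp[OF dh])
      then obtain a b where ab: "a < b" "\<And>c. a < c \<Longrightarrow> c < b \<Longrightarrow> ?I c"
        by (rule definable_infinite_interval[of ?I, OF _ False]) (rule that)
      \<comment> \<open>All of (a,b) consists of positive values of \<open>h\<close>, so
        \<open>m\<close> is positive and the infinite interval (m,b) lies in the image of the finite
        set where \<open>m \<le> h\<close>.\<close>
      obtain m where m: "a < m" "m < b" using dense[OF ab(1)] by blast
      then have "m > 0" using ab(2) by auto
      then have "finite (h ` {x. m \<le> h x})" using fin by simp
      moreover have "{m<..<b} \<subseteq> h ` {x. m \<le> h x}"
      proof
        fix c assume "c \<in> {m<..<b}"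
        then obtain x where "c = h x" "m \<le> h x" using ab(2)[of c] m(1) by auto
        then show "c \<in> h ` {x. m \<le> h x}" by simp
      qed
      ultimately have "finite {m<..<b}" by (rule finite_subset[rotated])
      then show False using infinite_Ioo[OF m(2)] by simp
    qed
  qed
  moreover have "{x. \<not> right_lim f x (f x)} = {x. 0 < h x}" by (auto simp: R h_def)
  ultimately show ?thesis by simp
qed

text \<open>Continuity is right continuity of the function and of its reflection.\<close>

lemma finite_discontinuities:
  assumes f: "dfun S (\<lambda>e. f (e 0))" and bd: "\<And>x. \<bar>f x\<bar> \<le> B"
  shows "finite {x. \<not> cont_at f x}"
proof -
  define g where "g x = f (- x)" for x
  have "dfun S (\<lambda>e. g (e 0))" unfolding g_def by (intro dintros dfun1_comp[OF f])
  then have "finite {x. \<not> right_lim g x (g x)}"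
    by (rule finite_right_discontinuities) (use bd in \<open>simp add: g_def\<close>)
  then have "finite (uminus ` {x. \<not> right_lim g x (g x)} \<union> {x. \<not> right_lim f x (f x)})"
    using finite_right_discontinuities[OF f bd] by simp
  moreover have "{x. \<not> cont_at f x} \<subseteq> uminus ` {x. \<not> right_lim g x (g x)} \<union> {x. \<not> right_lim f x (f x)}"
  proof (intro subsetI, rule ccontr)
    fix x assume x: "x \<in> {x. \<not> cont_at f x}"
      "x \<notin> uminus ` {x. \<not> right_lim g x (g x)} \<union> {x. \<not> right_lim f x (f x)}"
    then have "right_lim g (- x) (g (- x))" "right_lim f x (f x)" by (force+)
    moreover have "cont_at f x"
      unfolding cont_at_def
    proof (intro allI impI)
      fix r :: 'a assume r: "r > 0"
      obtain d where d: "d > 0" "\<And>y. - x < y \<Longrightarrow> y < - x + d \<Longrightarrow> \<bar>g y - g (- x)\<bar> < r"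
        using \<open>right_lim g (- x) (g (- x))\<close> r unfolding right_lim_def by blast
      obtain d' where d': "d' > 0" "\<And>y. x < y \<Longrightarrow> y < x + d' \<Longrightarrow> \<bar>f y - f x\<bar> < r"
        using \<open>right_lim f x (f x)\<close> r unfolding right_lim_def by blast
      have "\<bar>f y - f x\<bar> < r" if "\<bar>y - x\<bar> < min d d'" for y
      proof (cases y x rule: linorder_cases)
        case less
        then show ?thesis using d(2)[of "- y"] that by (auto simp: g_def abs_if)
      next
        case greater
        then show ?thesis using d'(2)[of y] that by (auto simp: abs_if)
      qed (use r in simp)
      then show "\<exists>d>0. \<forall>y. \<bar>y - x\<bar> < d \<longrightarrow> \<bar>f y - f x\<bar> < r"
        using d(1) d'(1) by (intro exI[of _ "min d d'"]) auto
    qed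
    ultimately show False using x by simp
  qed
  ultimately show ?thesis by (rule finite_subset[rotated])
qed

end

section \<open>Uniform finiteness\<close>

definition empty_near :: "('a::real_closed_field \<Rightarrow> 'a \<Rightarrow> bool) \<Rightarrow> 'a \<Rightarrow> 'a \<Rightarrow> bool" where
  "empty_near A a b \<longleftrightarrow> (\<exists>d>0. \<forall>x y. \<bar>x - a\<bar> < d \<and> \<bar>y - b\<bar> < d \<longrightarrow> \<not> A x y)"

text \<open>Near (a,b) the set is the graph of a function continuous at \<open>a\<close> with value
  \<open>b\<close>. Asking for uniqueness at every small radius \<open>r\<close> encodes both: the
  one point within a larger radius must come within \<open>r\<close> of \<open>b\<close>.\<close>

definition single_near :: "('a::real_closed_field \<Rightarrow> 'a \<Rightarrow> bool) \<Rightarrow> 'a \<Rightarrow> 'a \<Rightarrow> bool" where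
  "single_near A a b \<longleftrightarrow> A a b \<and> (\<exists>r0>0. \<forall>r. 0 < r \<and> r < r0 \<longrightarrow>
     (\<exists>d>0. \<forall>x. \<bar>x - a\<bar> < d \<longrightarrow> (\<exists>!y. \<bar>y - b\<bar> < r \<and> A x y)))"

definition normal_at :: "('a::real_closed_field \<Rightarrow> 'a \<Rightarrow> bool) \<Rightarrow> 'a \<Rightarrow> 'a \<Rightarrow> bool" where
  "normal_at A a b \<longleftrightarrow> empty_near A a b \<or> single_near A a b"

definition bad :: "('a::real_closed_field \<Rightarrow> 'a \<Rightarrow> bool) \<Rightarrow> 'a \<Rightarrow> bool" where
  "bad A a \<longleftrightarrow> (\<exists>b. \<not> normal_at A a b)"

lemma dpred_subst2:
  assumes "dpred S (\<lambda>e. A (\<lambda>i. e (Suc (Suc i))) (e (Suc 0)) (e 0))"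
    "\<And>i. dfun S (\<lambda>e. h e i)" "dfun S f" "dfun S g"
  shows "dpred S (\<lambda>e. A (h e) (f e) (g e))"
proof -
  have "dfun S (\<lambda>e. push (f e) (h e) i)" for i using assms(2,3) by (cases i) auto
  from dpred_subst1[where Q = "\<lambda>e. A (\<lambda>i. e (Suc i)) (e 0)" and h = "\<lambda>e. push (f e) (h e)", OF _ this assms(4)]
  show ?thesis using assms(1) by simp
qed

lemma dpred_normal_at:
  assumes "dpred S (\<lambda>e. A (\<lambda>i. e (Suc (Suc i))) (e (Suc 0)) (e 0))"
  shows "dpred S (\<lambda>e. normal_at (A (\<lambda>i. e (Suc (Suc i)))) (e (Suc 0)) (e 0))"
  unfolding normal_at_def empty_near_def single_near_def
  by (intro dintros dpred_subst2[OF assms])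

lemma dpred_bad:
  assumes "dpred S (\<lambda>e. A (\<lambda>i. e (Suc (Suc i))) (e (Suc 0)) (e 0))"
  shows "dpred S (\<lambda>e. bad (A (\<lambda>i. e (Suc i))) (e 0))"
  unfolding bad_def by (intro dintros dpred_normal_at[OF assms])

text \<open>Emptiness is open. If A is a graph near (a,b), then over points near \<open>a\<close>
  its only point near \<open>b\<close> is so close to \<open>b\<close> that a small box around
  (a,b') with b' different from b contains nothing.\<close>

lemma normal_at_open:
  assumes "normal_at A a b"
  shows "\<exists>d>0. \<forall>b'. \<bar>b' - b\<bar> < d \<longrightarrow> normal_at A a (b' :: 'a::real_closed_field)"
  using assms unfolding normal_at_def
proof
  assume "empty_near A a b"
  then obtain d where d: "d > 0" "\<And>x y. \<bar>x - a\<bar> < d \<Longrightarrow> \<bar>y - b\<bar> < d \<Longrightarrow> \<not> A x y"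
    unfolding empty_near_def by blast
  have "empty_near A a b'" if "\<bar>b' - b\<bar> < d / 2" for b'
    unfolding empty_near_def
  proof (intro exI[of _ "d / 2"] conjI allI impI)
    fix x y assume "\<bar>x - a\<bar> < d / 2 \<and> \<bar>y - b'\<bar> < d / 2"
    then have "\<bar>x - a\<bar> < d" "\<bar>y - b\<bar> < d" using that d(1) by linarith+
    then show "\<not> A x y" using d(2) by blast
  qed (use d in auto)
  then show "\<exists>d>0. \<forall>b'. \<bar>b' - b\<bar> < d \<longrightarrow> empty_near A a b' \<or> single_near A a b'"
    using d(1) by (intro exI[of _ "d / 2"]) auto
next
  assume s: "single_near A a b"
  then obtain r0 where r0: "r0 > 0" "\<And>r. 0 < r \<Longrightarrow> r < r0 \<Longrightarrow>
    \<exists>d>0. \<forall>x. \<bar>x - a\<bar> < d \<longrightarrow> (\<exists>!y. \<bar>y - b\<bar> < r \<and> A x y)"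
    unfolding single_near_def by blast
  have "normal_at A a b'" if b': "\<bar>b' - b\<bar> < r0 / 3" for b'
  proof (cases "b' = b")
    case True
    then show ?thesis using s by (simp add: normal_at_def)
  next
    case False
    define r where "r = \<bar>b' - b\<bar> / 2"
    have r: "r > 0" using False by (simp add: r_def)
    moreover have "r < r0 / 3" 
    proof -
      have "3 * \<bar>b' - b\<bar> < r0" using b' by (simp add: field_simps)
      then have "3 * \<bar>b' - b\<bar> < 2 * r0" using r0(1) by linarith
      then show ?thesis by (simp add: r_def field_simps)
    qed
    ultimately have r: "r > 0" "r < r0 / 3" by auto
    \<comment> \<open>Points within \<open>r\<close> of \<open>b'\<close> lie within
      \<open>2 * r0 / 3\<close> of \<open>b\<close> but not within \<open>r\<close> of it;
      uniqueness at the large radius against existence at the small one excludes them.\<close>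
    then have "r < r0" "2 * r0 / 3 < r0" "2 * r0 / 3 > 0" using r0(1) by linarith+
    then obtain d d' where d: "d > 0" "\<And>x. \<bar>x - a\<bar> < d \<Longrightarrow> (\<exists>!y. \<bar>y - b\<bar> < r \<and> A x y)"
      and d': "d' > 0" "\<And>x. \<bar>x - a\<bar> < d' \<Longrightarrow> (\<exists>!y. \<bar>y - b\<bar> < 2 * r0 / 3 \<and> A x y)"
      using r0(2)[of r] r0(2)[of "2 * r0 / 3"] r(1) by blast
    have "empty_near A a b'"
      unfolding empty_near_def
    proof (intro exI[of _ "min r (min d d')"] conjI allI impI notI)
      fix x y assume xy: "\<bar>x - a\<bar> < min r (min d d') \<and> \<bar>y - b'\<bar> < min r (min d d')" "A x y"
      have far: "\<not> \<bar>y - b\<bar> < r" using xy by (auto simp: r_def abs_if field_simps split: if_splits)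
      have near: "\<bar>y - b\<bar> < 2 * r0 / 3" using xy b' r by (auto simp: abs_if field_simps split: if_splits)
      obtain y' where y': "\<bar>y' - b\<bar> < r" "A x y'" using d(2)[of x] xy(1) by auto
      then have "\<bar>y' - b\<bar> < 2 * r0 / 3" using r by linarith
      moreover have "\<bar>x - a\<bar> < d'" using xy by simp
      ultimately have "y = y'" using d'(2)[of x] near xy(2) y'(2) by blast
      then show False using far y' by simp
    qed (use r d d' in auto)
    then show ?thesis by (simp add: normal_at_def)
  qed
  then show "\<exists>d>0. \<forall>b'. \<bar>b' - b\<bar> < d \<longrightarrow> empty_near A a b' \<or> single_near A a b'"
    using r0(1) unfolding normal_at_def by (intro exI[of _ "r0 / 3"]) auto
qed

lemma finite_Greatest:
  assumes "finite {y::'a::linorder. P y}" "P y0"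
  shows "\<exists>!m. P m \<and> (\<forall>y. P y \<longrightarrow> y \<le> m)"
proof (rule ex1I[of _ "Max {y. P y}"])
  show "P (Max {y. P y}) \<and> (\<forall>y. P y \<longrightarrow> y \<le> Max {y. P y})"
    using Max_in[of "{y. P y}"] Max_ge[of "{y. P y}"] assms by auto
qed (use Max_in[of "{y. P y}"] Max_ge[of "{y. P y}"] assms in \<open>auto intro!: antisym\<close>)

lemma finite_Least:
  assumes "finite {y::'a::linorder. P y}" "P y0"
  shows "\<exists>!m. P m \<and> (\<forall>y. P y \<longrightarrow> m \<le> y)"
proof (rule ex1I[of _ "Min {y. P y}"])
  show "P (Min {y. P y}) \<and> (\<forall>y. P y \<longrightarrow> Min {y. P y} \<le> y)"
    using Min_in[of "{y. P y}"] Min_le[of "{y. P y}"] assms by auto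
qed (use Min_in[of "{y. P y}"] Min_le[of "{y. P y}"] assms in \<open>auto intro!: antisym\<close>)

lemma finite_gap:
  assumes "finite (F :: 'a::linordered_field set)"
  shows "\<exists>r>0. \<forall>b\<in>F. \<forall>b'\<in>F. b \<noteq> b' \<longrightarrow> 2 * r \<le> \<bar>b - b'\<bar>"
proof -
  \<comment> \<open>The inserted 1 keeps the set nonempty when \<open>F\<close> has fewer than two
    points.\<close>
  let ?D = "insert 1 ((\<lambda>(b, b'). \<bar>b - b'\<bar> / 2) ` {p \<in> F \<times> F. fst p \<noteq> snd p})"
  have fin: "finite ?D" using assms by auto
  then have "Min ?D \<in> ?D" by (intro Min_in) auto
  then have "Min ?D > 0" by auto
  moreover have "Min ?D \<le> \<bar>b - b'\<bar> / 2" if "b \<in> F" "b' \<in> F" "b \<noteq> b'" for b b'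
    by (rule Min_le[OF fin]) (use that in force)
  ultimately show ?thesis by (intro exI[of _ "Min ?D"]) (auto simp: field_simps)
qed

lemma finite_common_radius:
  assumes "finite F" "\<And>b. b \<in> F \<Longrightarrow> \<exists>d>0. Q b (d :: 'a::linordered_field)"
    and "\<And>b d d'. Q b d \<Longrightarrow> 0 < d' \<Longrightarrow> d' \<le> d \<Longrightarrow> Q b d'"
  shows "\<exists>d>0. \<forall>b\<in>F. Q b d"
  using assms(1,2)
proof (induction F rule: finite_induct)
  case empty
  show ?case by (intro exI[of _ 1]) auto
next
  case (insert b F)
  then obtain d d' where "d > 0" "\<forall>b\<in>F. Q b d" "d' > 0" "Q b d'" by (metis insertCI)
  then have "Q x (min d d')" if "x \<in> insert b F" for x
    using that assms(3)[of x d "min d d'"] assms(3)[of x d' "min d d'"] by (cases "x = b") auto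
  then show ?case using \<open>d > 0\<close> \<open>d' > 0\<close> by (intro exI[of _ "min d d'"]) simp
qed

context
  fixes S :: "('f, 'p, 'a::real_closed_field) expansion"
  assumes om: "o_minimal S"
begin

context
  fixes A :: "'a \<Rightarrow> 'a \<Rightarrow> bool"
  assumes A: "dpred S (\<lambda>e. A (e (Suc 0)) (e 0))"
    and fin: "\<And>x. finite {y. A x y}"
    and range: "\<And>x y. A x y \<Longrightarrow> 0 \<le> y \<and> y \<le> 1"
begin

lemma A_subst: "dfun S f \<Longrightarrow> dfun S g \<Longrightarrow> dpred S (\<lambda>e. A (f e) (g e))"
  by (rule dpred_subst2[where A = "\<lambda>_. A" and h = "\<lambda>e. e", OF A dfun_var])

text \<open>The points that are not normal form a closed definable set, bounded below by 0 because A
  lies in the strip over [0,1]; so the infimum is attained. Reflection turns it into a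
  supremum.\<close>

lemma least_nonnormal:
  assumes "bad A a"
  shows "\<exists>!b. \<not> normal_at A a b \<and> (\<forall>b'. \<not> normal_at A a b' \<longrightarrow> b \<le> b')"
proof -
  let ?P = "\<lambda>b. \<not> normal_at A a (- b)"
  have d: "dpred S (\<lambda>e. ?P (e 0))"
    unfolding normal_at_def empty_near_def single_near_def by (intro dintros A_subst)
  have low: "0 \<le> b" if "\<not> normal_at A a b" for b
  proof (rule ccontr)
    assume "\<not> 0 \<le> b"
    then have "empty_near A a b"
      unfolding empty_near_def using range by (intro exI[of _ "- b"]) (fastforce simp: abs_if split: if_splits)
    then show False using that by (simp add: normal_at_def)
  qed
  obtain b0 where "?P (- b0)" using assms unfolding bad_def by auto
  then obtain s where s: "\<And>b. ?P b \<Longrightarrow> b \<le> s" "\<And>c. c < s \<Longrightarrow> \<exists>b>c. ?P b"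
    using definable_sup[OF om d, of "- b0" 0] low by (metis neg_0_le_iff_le)
  have "?P s"
  proof (rule ccontr)
    assume "\<not> ?P s"
    then obtain d where d: "d > 0" "\<And>b'. \<bar>b' + s\<bar> < d \<Longrightarrow> normal_at A a b'"
      using normal_at_open[of A a "- s"] by auto
    obtain b where "b > s - d" "?P b" using s(2)[of "s - d"] d(1) by auto
    then show False using s(1)[of b] d(2)[of "- b"] by (auto simp: abs_if split: if_splits)
  qed
  moreover have "- s \<le> b'" if "\<not> normal_at A a b'" for b' using s(1)[of "- b'"] that by simp
  ultimately show ?thesis by (intro ex1I[of _ "- s"]) (auto intro: antisym)
qed

text \<open>Over an interval of bad points, the least point that is not normal and its neighbours in
  the fibre below and above are definable functions. At some point all three are continuous and
  membership of the selected point in A is locally constant. There the selected point is isolated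
  from the rest of the fibre uniformly in x, hence is normal after all.\<close>

lemma finite_bad: "finite {a. bad A a}"
proof (rule ccontr)
  assume inf: "infinite {a. bad A a}"
  define beta where "beta a = (if bad A a then THE b. \<not> normal_at A a b \<and> (\<forall>b'. \<not> normal_at A a b' \<longrightarrow> b \<le> b') else 0)" for a
  have beta: "\<not> normal_at A a (beta a)" "\<not> normal_at A a b' \<Longrightarrow> beta a \<le> b'" if "bad A a" for a b'
    using theI'[OF least_nonnormal[OF that]] that unfolding beta_def by auto
  have dN: "dfun S f \<Longrightarrow> dfun S g \<Longrightarrow> dpred S (\<lambda>e. normal_at A (f e) (g e))" for f g
    unfolding normal_at_def empty_near_def single_near_def 
    by (rule dpred_subst2[where A = "\<lambda>_ a b. empty_near A a b \<or> single_near A a b" and h = "\<lambda>e. e", unfolded empty_near_def single_near_def])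
      (intro dintros A_subst | assumption)+
  have dB: "dfun S f \<Longrightarrow> dpred S (\<lambda>e. bad A (f e))" for f
    by (rule dpred1_comp) (auto simp: bad_def intro!: dintros dN)
  have dbeta: "dfun S (\<lambda>e. beta (e 0))"
  proof (rule dfun_graph)
    show "dpred S (\<lambda>e. (bad A (e (Suc 0)) \<longrightarrow> \<not> normal_at A (e (Suc 0)) (e 0) \<and>
        (\<forall>b'. \<not> normal_at A (e (Suc 0)) b' \<longrightarrow> e 0 \<le> b')) \<and> (\<not> bad A (e (Suc 0)) \<longrightarrow> e 0 = 0))"
      by (intro dintros dN dB)
    show "(bad A (e 0) \<longrightarrow> \<not> normal_at A (e 0) a \<and> (\<forall>b'. \<not> normal_at A (e 0) b' \<longrightarrow> a \<le> b')) \<and>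
        (\<not> bad A (e 0) \<longrightarrow> a = 0) \<longleftrightarrow> a = beta (e 0)" for e a
      using least_nonnormal[of "e 0"] beta[of "e 0"] by (auto simp: beta_def intro!: the1_equality[symmetric])
  qed
  have beta_range: "0 \<le> beta a \<and> beta a \<le> 1" for a
  proof (cases "bad A a")
    case True
    have "normal_at A a b" if "b < 0 \<or> 1 < b" for b
    proof -
      have "empty_near A a b"
        unfolding empty_near_def using that range
        by (intro exI[of _ "if b < 0 then - b else b - 1"]) (fastforce simp: abs_if split: if_splits)
      then show ?thesis by (simp add: normal_at_def)
    qed
    then show ?thesis using beta(1)[OF True] not_le by blast
  qed (simp add: beta_def)
  let ?lo = "\<lambda>a m. A a m \<and> m < beta a \<and> (\<forall>y. A a y \<and> y < beta a \<longrightarrow> y \<le> m)"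
  let ?hi = "\<lambda>a m. A a m \<and> beta a < m \<and> (\<forall>y. A a y \<and> beta a < y \<longrightarrow> m \<le> y)"
  \<comment> \<open>The defaults -1 and 2 for a missing neighbour lie outside [0,1], so
    \<open>lo a < beta a < hi a\<close> always holds.\<close>
  define lo where "lo a = (if \<exists>y. A a y \<and> y < beta a then THE m. ?lo a m else -1)" for a
  define hi where "hi a = (if \<exists>y. A a y \<and> beta a < y then THE m. ?hi a m else 2)" for a
  have lo1: "\<exists>!m. ?lo a m" if "\<exists>y. A a y \<and> y < beta a" for a
  proof -
    have "finite {y. A a y \<and> y < beta a}" by (rule finite_subset[OF _ fin[of a]]) auto
    from finite_Greatest[OF this] that show ?thesis by (simp add: conj_assoc) blast
  qed
  have hi1: "\<exists>!m. ?hi a m" if "\<exists>y. A a y \<and> beta a < y" for a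
  proof -
    have "finite {y. A a y \<and> beta a < y}" by (rule finite_subset[OF _ fin[of a]]) auto
    from finite_Least[OF this] that show ?thesis by (simp add: conj_assoc) blast
  qed
  have lo: "lo a < beta a" "\<And>y. A a y \<Longrightarrow> y < beta a \<Longrightarrow> y \<le> lo a" "\<bar>lo a\<bar> \<le> 2" for a
  proof -
    have "lo a < beta a \<and> (\<forall>y. A a y \<and> y < beta a \<longrightarrow> y \<le> lo a) \<and> \<bar>lo a\<bar> \<le> 2"
    proof (cases "\<exists>y. A a y \<and> y < beta a")
      case True
      from theI'[OF lo1[OF this]] have "?lo a (lo a)" using True by (simp add: lo_def)
      then show ?thesis using range[of a "lo a"] by auto
    next
      case False
      then show ?thesis using beta_range[of a] by (auto simp: lo_def)
    qed
    then show "lo a < beta a" "\<And>y. A a y \<Longrightarrow> y < beta a \<Longrightarrow> y \<le> lo a" "\<bar>lo a\<bar> \<le> 2" by auto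
  qed
  have hi: "beta a < hi a" "\<And>y. A a y \<Longrightarrow> beta a < y \<Longrightarrow> hi a \<le> y" "\<bar>hi a\<bar> \<le> 2" for a
  proof -
    have "beta a < hi a \<and> (\<forall>y. A a y \<and> beta a < y \<longrightarrow> hi a \<le> y) \<and> \<bar>hi a\<bar> \<le> 2"
    proof (cases "\<exists>y. A a y \<and> beta a < y")
      case True
      from theI'[OF hi1[OF this]] have "?hi a (hi a)" using True by (simp add: hi_def)
      then show ?thesis using range[of a "hi a"] by auto
    next
      case False
      moreover have "beta a < 2" using beta_range[of a] by (simp add: le_less_trans[of _ 1])
      ultimately show ?thesis by (auto simp: hi_def)
    qed
    then show "beta a < hi a" "\<And>y. A a y \<Longrightarrow> beta a < y \<Longrightarrow> hi a \<le> y" "\<bar>hi a\<bar> \<le> 2" by auto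
  qed
  have dlo: "dfun S (\<lambda>e. lo (e 0))"
  proof (rule dfun_graph)
    show "dpred S (\<lambda>e. ((\<exists>y. A (e (Suc 0)) y \<and> y < beta (e (Suc 0))) \<longrightarrow> ?lo (e (Suc 0)) (e 0)) \<and>
      (\<not> (\<exists>y. A (e (Suc 0)) y \<and> y < beta (e (Suc 0))) \<longrightarrow> e 0 = -1))"
      by (intro dintros A_subst dfun1_comp[OF dbeta])
    show "((\<exists>y. A (e 0) y \<and> y < beta (e 0)) \<longrightarrow> ?lo (e 0) a) \<and>
      (\<not> (\<exists>y. A (e 0) y \<and> y < beta (e 0)) \<longrightarrow> a = -1) \<longleftrightarrow> a = lo (e 0)" for e a
      using lo1[of "e 0"] theI'[OF lo1[of "e 0"]] unfolding lo_def by (auto simp del: not_ex)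
  qed
  have dhi: "dfun S (\<lambda>e. hi (e 0))"
  proof (rule dfun_graph)
    show "dpred S (\<lambda>e. ((\<exists>y. A (e (Suc 0)) y \<and> beta (e (Suc 0)) < y) \<longrightarrow> ?hi (e (Suc 0)) (e 0)) \<and>
      (\<not> (\<exists>y. A (e (Suc 0)) y \<and> beta (e (Suc 0)) < y) \<longrightarrow> e 0 = 2))"
      by (intro dintros A_subst dfun1_comp[OF dbeta])
    show "((\<exists>y. A (e 0) y \<and> beta (e 0) < y) \<longrightarrow> ?hi (e 0) a) \<and>
      (\<not> (\<exists>y. A (e 0) y \<and> beta (e 0) < y) \<longrightarrow> a = 2) \<longleftrightarrow> a = hi (e 0)" for e a
      using hi1[of "e 0"] theI'[OF hi1[of "e 0"]] unfolding hi_def by (auto simp del: not_ex)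
  qed
  have "dpred S (\<lambda>e. A (e 0) (beta (e 0)))" by (intro A_subst dintros dbeta)
  then have "finite {x. frontier_pt (\<lambda>x. A x (beta x)) x}" by (rule finite_frontier[OF om])
  moreover have "finite {x. \<not> cont_at beta x}" "finite {x. \<not> cont_at lo x}" "finite {x. \<not> cont_at hi x}"
    using finite_discontinuities[OF om dbeta, of 1] finite_discontinuities[OF om dlo, of 2]
      finite_discontinuities[OF om dhi, of 2] lo(3) hi(3) beta_range by auto
  ultimately have "finite ({x. frontier_pt (\<lambda>x. A x (beta x)) x} \<union> {x. \<not> cont_at beta x} \<union>
      {x. \<not> cont_at lo x} \<union> {x. \<not> cont_at hi x})" by simp
  with inf have "\<not> {a. bad A a} \<subseteq> {x. frontier_pt (\<lambda>x. A x (beta x)) x} \<union> {x. \<not> cont_at beta x} \<union>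
      {x. \<not> cont_at lo x} \<union> {x. \<not> cont_at hi x}" using finite_subset by blast
  then obtain a where a: "bad A a" "\<not> frontier_pt (\<lambda>x. A x (beta x)) a" "cont_at beta a" "cont_at lo a" "cont_at hi a"
    by blast
  \<comment> \<open>A third of the smaller gap: if the three functions move by less than
    \<open>r\<close>, no point of A other than \<open>beta x\<close> comes within \<open>r\<close>
    of \<open>beta a\<close>.\<close>
  define r where "r = min (beta a - lo a) (hi a - beta a) / 3"
  have r: "r > 0" "3 * r \<le> beta a - lo a" "3 * r \<le> hi a - beta a" using lo(1) hi(1) by (auto simp: r_def)
  obtain d0 where d0: "d0 > 0"
    "(\<forall>z. \<bar>z - a\<bar> < d0 \<longrightarrow> A z (beta z)) \<or> (\<forall>z. \<bar>z - a\<bar> < d0 \<longrightarrow> \<not> A z (beta z))"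
    using a(2) unfolding frontier_pt_def by blast
  obtain d1 where d1: "d1 > 0" "\<And>x. \<bar>x - a\<bar> < d1 \<Longrightarrow> \<bar>beta x - beta a\<bar> < r"
    using a(3) r(1) unfolding cont_at_def by blast
  obtain d2 where d2: "d2 > 0" "\<And>x. \<bar>x - a\<bar> < d2 \<Longrightarrow> \<bar>lo x - lo a\<bar> < r"
    using a(4) r(1) unfolding cont_at_def by blast
  obtain d3 where d3: "d3 > 0" "\<And>x. \<bar>x - a\<bar> < d3 \<Longrightarrow> \<bar>hi x - hi a\<bar> < r"
    using a(5) r(1) unfolding cont_at_def by blast
  note d = d0(1) d1(1) d2(1) d3(1) d0(2) d1(2) d2(2) d3(2)
  define d where "d = min (min d0 d1) (min d2 d3)"
  have "d > 0" using d(1-4) by (simp add: d_def)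
  have only: "y = beta x" if "\<bar>x - a\<bar> < d" "\<bar>y - beta a\<bar> < r" "A x y" for x y
  proof (rule ccontr)
    assume "y \<noteq> beta x"
    then have "y \<le> lo x \<or> hi x \<le> y" using lo(2)[OF that(3)] hi(2)[OF that(3)] by fastforce
    moreover have "\<bar>lo x - lo a\<bar> < r" "\<bar>hi x - hi a\<bar> < r" using that(1) d by (auto simp: d_def)
    ultimately show False using that(2) r by (auto simp: abs_if split: if_splits)
  qed
  have "normal_at A a (beta a)"
  proof (cases "\<forall>z. \<bar>z - a\<bar> < d0 \<longrightarrow> A z (beta z)")
    case True
    have "single_near A a (beta a)"
      unfolding single_near_def
    proof (rule conjI, goal_cases)
      case 1
      show ?case using True d(1) by simp
    next
      case 2
      show ?case
      proof (rule exI[of _ r], rule conjI[OF r(1)], intro allI impI)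
      fix r' assume r': "0 < r' \<and> r' < r"
      then obtain d' where d': "d' > 0" "\<And>x. \<bar>x - a\<bar> < d' \<Longrightarrow> \<bar>beta x - beta a\<bar> < r'"
        using a(3) unfolding cont_at_def by blast
      show "\<exists>d>0. \<forall>x. \<bar>x - a\<bar> < d \<longrightarrow> (\<exists>!y. \<bar>y - beta a\<bar> < r' \<and> A x y)"
      proof (intro exI[of _ "min d d'"] conjI allI impI)
        fix x assume x: "\<bar>x - a\<bar> < min d d'"
        show "\<exists>!y. \<bar>y - beta a\<bar> < r' \<and> A x y"
        proof (rule ex1I[of _ "beta x"])
          show "\<bar>beta x - beta a\<bar> < r' \<and> A x (beta x)" using x d' True by (simp add: d_def)
          show "y = beta x" if "\<bar>y - beta a\<bar> < r' \<and> A x y" for y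
            using only[of x y] that x r' by auto
        qed
      qed (use \<open>d > 0\<close> d' in auto)
      qed
    qed
    then show ?thesis by (simp add: normal_at_def)
  next
    case False
    then have "\<forall>z. \<bar>z - a\<bar> < d0 \<longrightarrow> \<not> A z (beta z)" using d0(2) by blast
    then have no: "\<not> A z (beta z)" if "\<bar>z - a\<bar> < d" for z using that by (simp add: d_def)
    have "empty_near A a (beta a)"
      unfolding empty_near_def
    proof (intro exI[of _ "min d r"] conjI allI impI notI)
      fix x y assume "\<bar>x - a\<bar> < min d r \<and> \<bar>y - beta a\<bar> < min d r" "A x y"
      then have "y = beta x" "\<bar>x - a\<bar> < d" using only[of x y] by simp_all
      then show False using no \<open>A x y\<close> by simp
    qed (use \<open>d > 0\<close> r in simp)
    then show ?thesis by (simp add: normal_at_def)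
  qed
  then show False using beta(1)[OF a(1)] by simp
qed

text \<open>Each point of the fibre over \<open>a\<close> continues to exactly one nearby point over
  every nearby x, which gives an injection of fibres. It is onto because nearby fibres stay close to
  the fibre over \<open>a\<close>.\<close>

lemma card_locally_constant:
  assumes "\<not> bad A a"
  shows "\<exists>d>0. \<forall>x. \<bar>x - a\<bar> < d \<longrightarrow> card {y. A x y} = card {y. A a y}"
proof -
  let ?F = "{y. A a y}"
  have sing: "single_near A a b" if "b \<in> ?F" for b
  proof -
    have "\<not> empty_near A a b"
    proof
      assume "empty_near A a b"
      then obtain d where "d > 0" "\<And>x y. \<bar>x - a\<bar> < d \<and> \<bar>y - b\<bar> < d \<Longrightarrow> \<not> A x y"
        unfolding empty_near_def by blast
      from this(2)[of a b] this(1) that show False by simp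
    qed
    then show ?thesis using assms unfolding bad_def normal_at_def by blast
  qed
  obtain r0 where r0: "r0 > 0" "\<forall>b\<in>?F. \<forall>r. 0 < r \<and> r < r0 \<longrightarrow>
     (\<exists>d>0. \<forall>x. \<bar>x - a\<bar> < d \<longrightarrow> (\<exists>!y. \<bar>y - b\<bar> < r \<and> A x y))"
  proof (atomize_elim, rule finite_common_radius[OF fin, of a "\<lambda>b r0. \<forall>r. 0 < r \<and> r < r0 \<longrightarrow>
     (\<exists>d>0. \<forall>x. \<bar>x - a\<bar> < d \<longrightarrow> (\<exists>!y. \<bar>y - b\<bar> < r \<and> A x y))"], goal_cases)
    case (1 b)
    from sing[OF this] show ?case unfolding single_near_def by (rule conjunct2)
  qed (meson less_le_trans)
  obtain r1 where r1: "r1 > 0" "\<And>b b'. b \<in> ?F \<Longrightarrow> b' \<in> ?F \<Longrightarrow> b \<noteq> b' \<Longrightarrow> 2 * r1 \<le> \<bar>b - b'\<bar>"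
    using finite_gap[OF fin] by blast
  \<comment> \<open>Below \<open>r0\<close>, so that the continuations are unique; at most
    \<open>r1\<close>, so that continuations of distinct points are distinct.\<close>
  define r where "r = min r0 r1 / 2"
  have r: "0 < r" "r < r0" "r \<le> r1" using r0 r1 by (auto simp: r_def min_def)
  obtain d1 where d1: "d1 > 0" "\<And>b x. b \<in> ?F \<Longrightarrow> \<bar>x - a\<bar> < d1 \<Longrightarrow> \<exists>!y. \<bar>y - b\<bar> < r \<and> A x y"
  proof -
    have "\<exists>d>0. \<forall>b\<in>?F. \<forall>x. \<bar>x - a\<bar> < d \<longrightarrow> (\<exists>!y. \<bar>y - b\<bar> < r \<and> A x y)"
    proof (rule finite_common_radius[OF fin], goal_cases)
      case (1 b)
      then show ?case using r0(2) r(1,2) by blast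
    next
      case (2 b d d')
      then have "\<bar>x - a\<bar> < d" if "\<bar>x - a\<bar> < d'" for x using that by simp
      then show ?case using 2(1) by simp
    qed
    then show thesis using that by blast
  qed
  \<comment> \<open>A compactness argument on the vertical segment: the points of A below level
    \<open>c\<close>, over all x near \<open>a\<close>, are close to the fibre over
    \<open>a\<close>. Level 2 lies above all of A.\<close>
  let ?P = "\<lambda>c. \<exists>d>0. \<forall>x y. \<bar>x - a\<bar> < d \<and> y < c \<and> A x y \<longrightarrow> (\<exists>b. A a b \<and> \<bar>y - b\<bar> < r)"
  have "?P 2"
  proof (rule definable_connected[OF om, of ?P 0])
    show "dpred S (\<lambda>e. ?P (e 0))" by (intro dintros A_subst)
    show "?P 0" using range by (intro exI[of _ 1]) fastforce
    fix y0 :: 'a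
    have "\<exists>d>0. \<forall>x y. \<bar>x - a\<bar> < d \<and> \<bar>y - y0\<bar> < d \<and> A x y \<longrightarrow> (\<exists>b. A a b \<and> \<bar>y - b\<bar> < r)"
    proof (cases "A a y0")
      case True
      then show ?thesis using r by blast
    next
      case False
      then have "empty_near A a y0" using assms unfolding bad_def normal_at_def single_near_def by blast
      then show ?thesis unfolding empty_near_def by blast
    qed
    then obtain d where d: "d > 0" "\<And>x y. \<bar>x - a\<bar> < d \<Longrightarrow> \<bar>y - y0\<bar> < d \<Longrightarrow> A x y \<Longrightarrow> \<exists>b. A a b \<and> \<bar>y - b\<bar> < r"
      by blast
    have "?P z'" if "\<bar>z - y0\<bar> < d" "\<bar>z' - y0\<bar> < d" "?P z" for z z'
    proof -
      obtain d' where d': "d' > 0" "\<And>x y. \<bar>x - a\<bar> < d' \<Longrightarrow> y < z \<Longrightarrow> A x y \<Longrightarrow> \<exists>b. A a b \<and> \<bar>y - b\<bar> < r"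
        using \<open>?P z\<close> by blast
      show ?thesis
      proof (rule exI[of _ "min d d'"], rule conjI, goal_cases, use d d' in simp, intro allI impI)
        fix x y assume xy: "\<bar>x - a\<bar> < min d d' \<and> y < z' \<and> A x y"
        show "\<exists>b. A a b \<and> \<bar>y - b\<bar> < r"
        proof (cases "y < z")
          case True
          then show ?thesis using d'(2)[of x y] xy by auto
        next
          case False
          then have "\<bar>y - y0\<bar> < d" using xy that(1,2) by (auto simp: abs_if split: if_splits)
          then show ?thesis using d(2)[of x y] xy by auto
        qed
      qed
    qed
    then show "\<exists>d>0. \<forall>z z'. 0 \<le> z \<and> z \<le> 2 \<and> 0 \<le> z' \<and> z' \<le> 2 \<and> \<bar>z - y0\<bar> < d \<and> \<bar>z' - y0\<bar> < d \<and> ?P z \<longrightarrow> ?P z'"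
      using d(1) by blast
  qed simp
  then obtain d2 where d2: "d2 > 0" "\<And>x y. \<bar>x - a\<bar> < d2 \<Longrightarrow> y < 2 \<Longrightarrow> A x y \<Longrightarrow> \<exists>b. A a b \<and> \<bar>y - b\<bar> < r"
    by blast
  have "card {y. A x y} = card ?F" if x: "\<bar>x - a\<bar> < min d1 d2" for x
  proof -
    define g where "g b = (THE y. \<bar>y - b\<bar> < r \<and> A x y)" for b
    have g: "\<bar>g b - b\<bar> < r \<and> A x (g b)" if "b \<in> ?F" for b
      unfolding g_def by (rule theI') (use d1(2)[OF that] x in simp)
    have "inj_on g ?F"
    proof (rule inj_onI, rule ccontr)
      fix b b' assume b: "b \<in> ?F" "b' \<in> ?F" "g b = g b'" "b \<noteq> b'"
      then have "\<bar>b - b'\<bar> < 2 * r" using g[OF b(1)] g[OF b(2)] by (auto simp: abs_if split: if_splits)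
      then show False using r1(2)[OF b(1,2,4)] r by simp
    qed
    moreover have "g ` ?F = {y. A x y}"
    proof safe
      show "A x (g b)" if "A a b" for b using g that by simp
      fix y assume y: "A x y"
      then have "y < 2" using range[OF y] by (simp add: le_less_trans[of y 1])
      then obtain b where b: "A a b" "\<bar>y - b\<bar> < r" using d2(2)[of x y] y x by auto
      then have "y = g b" using d1(2)[of b x] g[of b] y x by auto
      then show "y \<in> g ` ?F" using b by simp
    qed
    ultimately show ?thesis by (metis card_image)
  qed
  moreover have "min d1 d2 > 0" using d1(1) d2(1) by simp
  ultimately show ?thesis by blast
qed

end

section \<open>Counting, and induction on the number of parameters\<close>

lemma dpred_card_ge:
  "dpred S (\<lambda>e. A (\<lambda>i. e (Suc i)) (e 0)) \<Longrightarrow> (\<And>e. finite {t. A e t}) \<Longrightarrow> dpred S (\<lambda>e. k \<le> card {t. A e t})"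
proof (induction k arbitrary: A)
  case 0
  show ?case by (simp add: dpred_const)
next
  case (Suc k)
  have A: "(\<And>i. dfun S (\<lambda>e. h e i)) \<Longrightarrow> dfun S f \<Longrightarrow> dpred S (\<lambda>e. A (h e) (f e))" for h f
    using dpred_subst1[OF Suc.prems(1)] by blast
  \<comment> \<open>Removing a witness lowers the count by one. The witness becomes an additional
    parameter of the family, which is why the induction is over all \<open>A\<close>.\<close>
  have eq: "(Suc k \<le> card {t. A e t}) = (\<exists>a. A e a \<and> k \<le> card {t. A e t \<and> t \<noteq> a})" for e
  proof -
    have c: "card {t. A e t \<and> t \<noteq> a} = card {t. A e t} - 1" if "A e a" for a
    proof -
      have "{t. A e t \<and> t \<noteq> a} = {t. A e t} - {a}" by auto
      then show ?thesis using that by simp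
    qed
    show ?thesis
    proof
      assume k: "Suc k \<le> card {t. A e t}"
      then have "{t. A e t} \<noteq> {}" by (metis card.empty not_less_eq_eq le0)
      then obtain a where "A e a" by blast
      then show "\<exists>a. A e a \<and> k \<le> card {t. A e t \<and> t \<noteq> a}" using c k by (intro exI[of _ a]) simp
    next
      assume "\<exists>a. A e a \<and> k \<le> card {t. A e t \<and> t \<noteq> a}"
      then obtain a where a: "A e a" "k \<le> card {t. A e t \<and> t \<noteq> a}" by blast
      then have "0 < card {t. A e t}" using Suc.prems(2) by (auto simp: card_gt_0_iff)
      then show "Suc k \<le> card {t. A e t}" using a(2) unfolding c[OF a(1)] by simp
    qed
  qed
  have "dpred S (\<lambda>e. k \<le> card {t. A (\<lambda>i. e (Suc i)) t \<and> t \<noteq> e 0})"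
    by (rule Suc.IH) (intro dintros A, use Suc.prems(2) in simp)
  then show ?case unfolding eq by (intro dintros A)
qed

lemma card_constant_between:
  assumes A: "dpred S (\<lambda>e. A (e (Suc 0)) (e 0))"
    and fin: "\<And>x. finite {y. A x y}"
    and range: "\<And>x y. A x y \<Longrightarrow> 0 \<le> y \<and> y \<le> 1"
    and "x1 \<le> x2" and good: "\<And>x. x1 \<le> x \<Longrightarrow> x \<le> x2 \<Longrightarrow> \<not> bad A x"
  shows "card {y. A x1 y} = card {y. A x2 y}"
proof -
  let ?n = "card {y. A x1 y}"
  have "dpred S (\<lambda>e. k \<le> card {t. A (e 0) t})" for k
    by (rule dpred_card_ge) (use A fin in auto)
  then have d: "dpred S (\<lambda>e. ?n \<le> card {t. A (e 0) t} \<and> \<not> Suc ?n \<le> card {t. A (e 0) t})"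
    by (intro dpred_conj dpred_not)
  have "?n \<le> card {t. A x2 t} \<and> \<not> Suc ?n \<le> card {t. A x2 t}"
  proof (rule definable_connected[OF om d assms(4)])
    fix y assume "x1 \<le> y" "y \<le> x2"
    then have "\<not> bad A y" by (rule good)
    have "\<exists>d>0. \<forall>x. \<bar>x - y\<bar> < d \<longrightarrow> card {t. A x t} = card {t. A y t}"
      by (rule card_locally_constant[OF A fin _ \<open>\<not> bad A y\<close>]) (rule range)
    then obtain d where d: "d > 0" "\<And>x. \<bar>x - y\<bar> < d \<Longrightarrow> card {t. A x t} = card {t. A y t}" by blast
    have "card {t. A z t} = card {t. A z' t}" if "\<bar>z - y\<bar> < d" "\<bar>z' - y\<bar> < d" for z z'
      using d(2)[OF that(1)] d(2)[OF that(2)] by (rule trans[OF _ sym])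
    with d(1) show "\<exists>d>0. \<forall>z z'. x1 \<le> z \<and> z \<le> x2 \<and> x1 \<le> z' \<and> z' \<le> x2 \<and> \<bar>z - y\<bar> < d \<and> \<bar>z' - y\<bar> < d \<and>
      ?n \<le> card {t. A z t} \<and> \<not> Suc ?n \<le> card {t. A z t} \<longrightarrow>
      ?n \<le> card {t. A z' t} \<and> \<not> Suc ?n \<le> card {t. A z' t}" by (intro exI[of _ d]) metis
  qed simp
  then show ?thesis by simp
qed

text \<open>Finitely many sample values of one parameter suffice: off the bad points the cardinality is
  constant, and the bad points, their translates by \<open>\<plusminus>1\<close> and their midpoints meet every component.\<close>

lemma exists_sample:
  assumes B: "finite {x::'a. B x}"
  shows "\<exists>x'. (x' = 0 \<or> (\<exists>a b. B a \<and> B b \<and> (x' = a \<or> x' = (a + b) / 2 \<or> x' = a + 1 \<or> x' = a - 1))) \<and>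
    (x' = x \<or> (\<forall>z. min x x' \<le> z \<and> z \<le> max x x' \<longrightarrow> \<not> B z))"
proof (cases "B x")
  case True
  then show ?thesis by blast
next
  case nB: False
  let ?L = "{z. B z \<and> z < x}" and ?U = "{z. B z \<and> x < z}"
  have fin: "finite ?L" "finite ?U" using B by auto
  have lo: "B (Max ?L) \<and> Max ?L < x" "\<And>z. B z \<Longrightarrow> z < x \<Longrightarrow> z \<le> Max ?L" if "?L \<noteq> {}"
    using Max_in[OF fin(1) that] Max_ge[OF fin(1)] by auto
  have hi: "B (Min ?U) \<and> x < Min ?U" "\<And>z. B z \<Longrightarrow> x < z \<Longrightarrow> Min ?U \<le> z" if "?U \<noteq> {}"
    using Min_in[OF fin(2) that] Min_le[OF fin(2)] by auto
  have noB: "z \<noteq> x" if "B z" for z using nB that by auto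
  consider "?L = {}" "?U = {}" | "?L = {}" "?U \<noteq> {}" | "?L \<noteq> {}" "?U = {}" | "?L \<noteq> {}" "?U \<noteq> {}" by blast
  then show ?thesis
  proof cases
    case 1
    then have "\<not> B z" for z using noB[of z] by (auto simp: neq_iff)
    then show ?thesis by (intro exI[of _ 0]) auto
  next
    case 2
    have "\<not> B z" if "z < Min ?U" for z
      using hi(2)[OF 2(2), of z] 2(1) noB[of z] that by (auto simp: neq_iff)
    moreover have "max x (Min ?U - 1) < Min ?U" using hi(1)[OF 2(2)] by simp
    ultimately have "\<forall>z. min x (Min ?U - 1) \<le> z \<and> z \<le> max x (Min ?U - 1) \<longrightarrow> \<not> B z"
      using le_less_trans by blast
    moreover have "B (Min ?U)" using hi(1)[OF 2(2)] by simp
    ultimately show ?thesis by blast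
  next
    case 3
    have "\<not> B z" if "Max ?L < z" for z
      using lo(2)[OF 3(1), of z] 3(2) noB[of z] that by (auto simp: neq_iff)
    moreover have "Max ?L < min x (Max ?L + 1)" using lo(1)[OF 3(1)] by simp
    ultimately have "\<forall>z. min x (Max ?L + 1) \<le> z \<and> z \<le> max x (Max ?L + 1) \<longrightarrow> \<not> B z"
      using less_le_trans by blast
    moreover have "B (Max ?L)" using lo(1)[OF 3(1)] by simp
    ultimately show ?thesis by blast
  next
    case 4
    have "\<not> B z" if "Max ?L < z" "z < Min ?U" for z
      using lo(2)[OF 4(1), of z] hi(2)[OF 4(2), of z] noB[of z] that by (auto simp: neq_iff)
    moreover have "Max ?L < min x ((Max ?L + Min ?U) / 2)" "max x ((Max ?L + Min ?U) / 2) < Min ?U"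
      using lo(1)[OF 4(1)] hi(1)[OF 4(2)] by (auto simp: field_simps)
    ultimately have "\<forall>z. min x ((Max ?L + Min ?U) / 2) \<le> z \<and> z \<le> max x ((Max ?L + Min ?U) / 2) \<longrightarrow> \<not> B z"
      by (meson less_le_trans le_less_trans)
    moreover have "B (Max ?L)" "B (Min ?U)" using lo(1)[OF 4(1)] hi(1)[OF 4(2)] by simp_all
    ultimately show ?thesis by blast
  qed
qed

text \<open>Induction on the number of parameters. For a fixed rest, every fibre has the cardinality
  of the fibre over one of finitely many values of the first parameter, definable from the rest. The
  union of those sample fibres is again a definable family of finite sets, with one parameter fewer,
  and bounds the original one.\<close>

lemma uniform_finiteness_aux:
  assumes "dpred S (\<lambda>e. A (\<lambda>i. e (Suc i)) (e 0))" "\<And>e. finite {t. A e t}" "\<And>e t. A e t \<Longrightarrow> 0 \<le> t \<and> t \<le> 1"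
    "\<And>e e'. (\<And>i. i < N \<Longrightarrow> e i = e' i) \<Longrightarrow> A e = A e'"
  shows "\<exists>K. \<forall>e. card {t. A e t} \<le> K"
  using assms
proof (induction N arbitrary: A)
  case 0
  then have "A e = A (\<lambda>_. 0)" for e by blast
  then show ?case by (metis order_refl)
next
  case (Suc N)
  define A2 where "A2 e x = A (push x e)" for e x
  have dA2: "dpred S (\<lambda>e. A2 (\<lambda>i. e (Suc (Suc i))) (e (Suc 0)) (e 0))"
  proof -
    have "push (e (Suc 0)) (\<lambda>i. e (Suc (Suc i))) = (\<lambda>i. e (Suc i))" for e :: "nat \<Rightarrow> 'a"
      using push_eta[of "\<lambda>i. e (Suc i)"] by simp
    then show ?thesis using Suc.prems(1) unfolding A2_def by (simp only:)
  qed
  note sub = dpred_subst2[OF dA2]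
  have sec: "dpred S (\<lambda>e. A2 e' (e (Suc 0)) (e 0))" for e'
    by (rule sub) (intro dintros)+
  \<comment> \<open>Phrased through the predicate \<open>bad\<close> and not through an enumeration
    of the bad points, whose number may depend on \<open>e\<close>; so it is definable in
    \<open>e\<close>.\<close>
  define smp where "smp e x \<longleftrightarrow> x = 0 \<or> (\<exists>a b. bad (A2 e) a \<and> bad (A2 e) b \<and>
      (x = a \<or> x = (a + b) / 2 \<or> x = a + 1 \<or> x = a - 1))" for e x
  define B where "B e t \<longleftrightarrow> (\<exists>x. smp e x \<and> A2 e x t)" for e t
  have fin2: "finite {t. A2 e x t}" "A2 e x t \<Longrightarrow> 0 \<le> t \<and> t \<le> 1" for e x t
    using Suc.prems(2,3) by (auto simp: A2_def)
  have finbad: "finite {x. bad (A2 e) x}" for e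
    by (rule finite_bad) (use fin2 sec in auto)
  have "finite {x. smp e x}" for e
  proof -
    let ?B = "{x. bad (A2 e) x}"
    have "{x. smp e x} \<subseteq> insert 0 (?B \<union> (\<lambda>(a, b). (a + b) / 2) ` (?B \<times> ?B) \<union> (\<lambda>a. a + 1) ` ?B \<union> (\<lambda>a. a - 1) ` ?B)"
      unfolding smp_def by force
    then show ?thesis by (rule finite_subset) (use finbad in simp)
  qed
  then have finB: "finite {t. B e t}" for e
  proof -
    have "{t. B e t} = (\<Union>x\<in>{x. smp e x}. {t. A2 e x t})" unfolding B_def by auto
    then show ?thesis using \<open>finite {x. smp e x}\<close> fin2 by simp
  qed
  have "\<exists>K. \<forall>e. card {t. B e t} \<le> K"
  proof (rule Suc.IH)
    have dbad: "(\<And>i. dfun S (\<lambda>e. h e i)) \<Longrightarrow> dfun S f \<Longrightarrow> dpred S (\<lambda>e. bad (A2 (h e)) (f e))" for h f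
      using dpred_subst1[OF dpred_bad[OF dA2]] by blast
    show "dpred S (\<lambda>e. B (\<lambda>i. e (Suc i)) (e 0))"
      unfolding B_def smp_def by (intro dintros sub dbad)
    show "finite {t. B e t}" for e by (rule finB)
    show "0 \<le> t \<and> t \<le> 1" if "B e t" for e t using that fin2 unfolding B_def by blast
    fix e e' :: "nat \<Rightarrow> 'a" assume "\<And>i. i < N \<Longrightarrow> e i = e' i"
    then have "A2 e = A2 e'"
      unfolding A2_def by (intro ext fun_cong[OF Suc.prems(4)]) (auto simp: less_Suc_eq_0_disj)
    then show "B e = B e'" unfolding B_def smp_def by simp
  qed
  then obtain K where K: "\<And>e. card {t. B e t} \<le> K" by blast
  have "card {t. A e t} \<le> K" for e
  proof -
    define e' where "e' = (\<lambda>i. e (Suc i))"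
    have e: "A e = A2 e' (e 0)" by (simp add: A2_def e'_def push_eta)
    obtain x' where x': "smp e' x'" "x' = e 0 \<or> (\<forall>z. min (e 0) x' \<le> z \<and> z \<le> max (e 0) x' \<longrightarrow> \<not> bad (A2 e') z)"
      using exists_sample[OF finbad[of e'], of "e 0"] unfolding smp_def by blast
    have "card {t. A2 e' (e 0) t} = card {t. A2 e' x' t}"
      using x'(2)
    proof
      assume *: "\<forall>z. min (e 0) x' \<le> z \<and> z \<le> max (e 0) x' \<longrightarrow> \<not> bad (A2 e') z"
      show ?thesis
      proof (cases "e 0 \<le> x'")
        case True
        then show ?thesis using * by (intro card_constant_between[OF sec fin2]) (auto simp: min_def max_def)
      next
        case False
        then show ?thesis using *
          by (intro card_constant_between[OF sec fin2, symmetric]) (auto simp: min_def max_def)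
      qed
    qed simp
    also have "\<dots> \<le> card {t. B e' t}" by (rule card_mono[OF finB]) (use x'(1) in \<open>auto simp: B_def\<close>)
    finally show ?thesis using K[of e'] e by simp
  qed
  then show ?case by blast
qed

theorem uniform_finiteness:
  assumes A: "dpred S (\<lambda>e. A (\<lambda>i. e (Suc i)) (e 0))"
    and "\<And>e. finite {t. A e t}" and "\<And>e t. A e t \<Longrightarrow> 0 \<le> t \<and> t \<le> 1"
  shows "\<exists>K. \<forall>e. card {t. A e t} \<le> K"
proof -
  obtain N where N: "\<And>e e'. (\<And>i. i < N \<Longrightarrow> e i = e' i) \<Longrightarrow> A (\<lambda>i. e (Suc i)) (e 0) = A (\<lambda>i. e' (Suc i)) (e' 0)"
    using dpred_support[OF A] by metis
  have "A e = A e'" if "\<And>i. i < N \<Longrightarrow> e i = e' i" for e e'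
  proof
    fix t
    have "\<And>i. i < N \<Longrightarrow> push t e i = push t e' i" using that by (auto split: nat.split)
    from N[of "push t e" "push t e'", OF this] show "A e t = A e' t" by simp
  qed
  then show ?thesis by (intro uniform_finiteness_aux[where N = N] A) (use assms(2,3) in blast)+
qed

end

section \<open>Continuous definable functions on spaces with definable charts\<close>

text \<open>The radii range over R itself, which may be non-archimedean; the proof compares with the
  order topology on the two sides of \<open>f x\<close>.\<close>

lemma continuous_map_eps:
  fixes f :: "'x \<Rightarrow> 'a::real_closed_field"
  shows "continuous_map X euclidean f \<longleftrightarrow>
    (\<forall>x\<in>topspace X. \<forall>r>0. \<exists>W. openin X W \<and> x \<in> W \<and> (\<forall>y\<in>W. \<bar>f y - f x\<bar> < r))"
proof (intro iffI ballI allI impI)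
  fix x and r :: 'a
  assume f: "continuous_map X euclidean f" and x: "x \<in> topspace X" "0 < r"
  let ?W = "{y \<in> topspace X. f y \<in> {f x - r<..<f x + r}}"
  have "openin X ?W" by (rule openin_continuous_map_preimage[OF f]) auto
  moreover have "\<bar>f y - f x\<bar> < r" if "y \<in> ?W" for y using that by (auto simp: abs_if)
  moreover have "x \<in> ?W" using x by auto
  ultimately show "\<exists>W. openin X W \<and> x \<in> W \<and> (\<forall>y\<in>W. \<bar>f y - f x\<bar> < r)" by blast
next
  assume *: "\<forall>x\<in>topspace X. \<forall>r>0. \<exists>W. openin X W \<and> x \<in> W \<and> (\<forall>y\<in>W. \<bar>f y - f x\<bar> < r)"
  have "openin X {x \<in> topspace X. f x \<in> V}" if V: "open V" for V
  proof (subst openin_subopen, safe)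
    fix x assume x: "x \<in> topspace X" "f x \<in> V"
    obtain b where b: "b > f x" "{f x..<b} \<subseteq> V" using open_right[OF V x(2), of "f x + 1"] by auto
    obtain a where a: "a < f x" "{a<..f x} \<subseteq> V" using open_left[OF V x(2), of "f x - 1"] by auto
    have "min (b - f x) (f x - a) > 0" using a b by simp
    then obtain W where W: "openin X W" "x \<in> W" "\<forall>y\<in>W. \<bar>f y - f x\<bar> < min (b - f x) (f x - a)"
      using * x(1) by blast
    have "f y \<in> V" if "y \<in> W" for y
    proof -
      have "\<bar>f y - f x\<bar> < b - f x" "\<bar>f y - f x\<bar> < f x - a" using W(3) that by auto
      then have "a < f y" "f y < b" by (simp_all add: abs_diff_less_iff)
      then show ?thesis using a(2) b(2) by (cases "f y \<le> f x") auto
    qed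
    then show "\<exists>T. openin X T \<and> x \<in> T \<and> T \<subseteq> {x \<in> topspace X. f x \<in> V}"
      using W openin_subset[OF W(1)] by (intro exI[of _ W]) auto
  qed
  then show "continuous_map X euclidean f" by (simp add: continuous_map_def)
qed

text \<open>A chart is a partial map from environments to points; \<open>f\<close> is definable when all its pullbacks,
  extended by \<open>0\<close>, are.\<close>

definition pull :: "((nat \<Rightarrow> 'a) \<Rightarrow> 'x option) \<Rightarrow> ('x \<Rightarrow> 'a::real_closed_field) \<Rightarrow> (nat \<Rightarrow> 'a) \<Rightarrow> 'a" where
  "pull c f e = (case c e of None \<Rightarrow> 0 | Some x \<Rightarrow> f x)"

text \<open>The space and its charts are parameters, so that the same closure lemmas serve for M and
  for the cylinder over it.\<close>

definition dcont :: "('f, 'p, 'a::real_closed_field) expansion \<Rightarrow> 'x topology \<Rightarrow>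
    ((nat \<Rightarrow> 'a) \<Rightarrow> 'x option) set \<Rightarrow> ('x \<Rightarrow> 'a) \<Rightarrow> bool" where
  "dcont S X C f \<longleftrightarrow> continuous_map X euclidean f \<and> (\<forall>c\<in>C. dfun S (pull c f))"

definition definable_charts :: "('f, 'p, 'a::real_closed_field) expansion \<Rightarrow> 'x topology \<Rightarrow>
    ((nat \<Rightarrow> 'a) \<Rightarrow> 'x option) set \<Rightarrow> bool" where
  "definable_charts S X C \<longleftrightarrow> (\<forall>c\<in>C. dpred S (\<lambda>e. c e \<noteq> None) \<and> (\<forall>e x. c e = Some x \<longrightarrow> x \<in> topspace X))"

lemma dcont_cong:
  assumes "definable_charts S X C" "\<And>x. x \<in> topspace X \<Longrightarrow> f x = g x"
  shows "dcont S X C f \<longleftrightarrow> dcont S X C g"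
proof -
  have "pull c f = pull c g" if "c \<in> C" for c
    using assms that by (auto simp: definable_charts_def pull_def fun_eq_iff split: option.split)
  moreover have "continuous_map X euclidean f \<longleftrightarrow> continuous_map X euclidean g"
    using assms(2) continuous_map_eq[of X euclidean f g] continuous_map_eq[of X euclidean g f] by auto
  ultimately show ?thesis by (auto simp: dcont_def)
qed

section \<open>Algebraic operations on continuous definable functions\<close>

definition jcont :: "('a::real_closed_field \<Rightarrow> 'a \<Rightarrow> 'a) \<Rightarrow> bool" where
  "jcont G \<longleftrightarrow> (\<forall>a b. \<forall>r>0. \<exists>d>0. \<forall>a' b'. \<bar>a' - a\<bar> < d \<and> \<bar>b' - b\<bar> < d \<longrightarrow> \<bar>G a' b' - G a b\<bar> < r)"

lemma jcont_plus: "jcont (+)"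
  unfolding jcont_def
proof (intro allI impI)
  fix a b r :: 'a assume "r > 0"
  then show "\<exists>d>0. \<forall>a' b'. \<bar>a' - a\<bar> < d \<and> \<bar>b' - b\<bar> < d \<longrightarrow> \<bar>a' + b' - (a + b)\<bar> < r"
    by (intro exI[of _ "r / 2"]) (auto simp: abs_if split: if_splits)
qed

lemma jcont_max: "jcont max"
  unfolding jcont_def
proof (intro allI impI)
  fix a b r :: 'a assume "r > 0"
  then show "\<exists>d>0. \<forall>a' b'. \<bar>a' - a\<bar> < d \<and> \<bar>b' - b\<bar> < d \<longrightarrow> \<bar>max a' b' - max a b\<bar> < r"
    by (intro exI[of _ r]) (auto simp: max_def abs_if split: if_splits)
qed

lemma jcont_times: "jcont (*)"
  unfolding jcont_def
proof (intro allI impI)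
  fix a b r :: 'a assume r: "r > 0"
  \<comment> \<open>For \<open>d \<le> 1\<close>, changing both factors by less than
    \<open>d\<close> changes the product by less than \<open>d * K\<close>.\<close>
  define K where "K = \<bar>a\<bar> + \<bar>b\<bar> + 1"
  define d where "d = min 1 (r / K)"
  have K: "K > 0" by (simp add: K_def add_nonneg_pos)
  have d: "d > 0" "d \<le> 1" "d * K \<le> r" using r K by (auto simp: d_def min_def field_simps)
  show "\<exists>d>0. \<forall>a' b'. \<bar>a' - a\<bar> < d \<and> \<bar>b' - b\<bar> < d \<longrightarrow> \<bar>a' * b' - a * b\<bar> < r"
  proof (intro exI[of _ d] conjI allI impI)
    fix a' b' assume h: "\<bar>a' - a\<bar> < d \<and> \<bar>b' - b\<bar> < d"
    have "a' * b' - a * b = (a' - a) * (b' - b) + (a' - a) * b + a * (b' - b)" by (simp add: algebra_simps)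
    then have "\<bar>a' * b' - a * b\<bar> \<le> \<bar>(a' - a) * (b' - b) + (a' - a) * b\<bar> + \<bar>a * (b' - b)\<bar>"
      by (simp add: abs_triangle_ineq)
    also have "\<dots> \<le> \<bar>(a' - a) * (b' - b)\<bar> + \<bar>(a' - a) * b\<bar> + \<bar>a * (b' - b)\<bar>"
      using abs_triangle_ineq[of "(a' - a) * (b' - b)" "(a' - a) * b"] by simp
    also have "\<dots> = \<bar>a' - a\<bar> * \<bar>b' - b\<bar> + \<bar>a' - a\<bar> * \<bar>b\<bar> + \<bar>a\<bar> * \<bar>b' - b\<bar>" by (simp add: abs_mult)
    also have "\<dots> < d * 1 + d * \<bar>b\<bar> + \<bar>a\<bar> * d"
    proof -
      have "\<bar>a' - a\<bar> * \<bar>b' - b\<bar> < d * 1" using h d by (intro mult_strict_mono') auto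
      moreover have "\<bar>a' - a\<bar> * \<bar>b\<bar> \<le> d * \<bar>b\<bar>" using h by (intro mult_right_mono) auto
      moreover have "\<bar>a\<bar> * \<bar>b' - b\<bar> \<le> \<bar>a\<bar> * d" using h by (intro mult_left_mono) auto
      ultimately show ?thesis by linarith
    qed
    also have "\<dots> = d * K" by (simp add: K_def algebra_simps)
    finally show "\<bar>a' * b' - a * b\<bar> < r" using d(3) by simp
  qed (rule d(1))
qed

lemma cont_at_uminus: "cont_at uminus x"
  unfolding cont_at_def by (intro allI impI exI conjI, assumption) (simp add: abs_minus_commute)

lemma cont_at_inverse:
  assumes "x \<noteq> 0"
  shows "cont_at inverse (x :: 'a::real_closed_field)"
  unfolding cont_at_def
proof (intro allI impI)
  fix r :: 'a assume r: "r > 0"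
  \<comment> \<open>The first bound keeps \<open>\<bar>y\<bar>\<close> above half of
    \<open>\<bar>x\<bar>\<close>; the second then makes the quotient of
    \<open>\<bar>x - y\<bar>\<close> by \<open>\<bar>x\<bar> * \<bar>y\<bar>\<close> smaller than
    \<open>r\<close>.\<close>
  define d where "d = min (\<bar>x\<bar> / 2) (r * \<bar>x\<bar> * \<bar>x\<bar> / 2)"
  have "r * \<bar>x\<bar> * \<bar>x\<bar> / 2 > 0" using r assms by simp
  moreover have "d \<le> \<bar>x\<bar> / 2" "d \<le> r * \<bar>x\<bar> * \<bar>x\<bar> / 2" by (auto simp: d_def)
  ultimately have d: "d > 0" "2 * d \<le> \<bar>x\<bar>" "2 * d \<le> r * \<bar>x\<bar> * \<bar>x\<bar>"
    using assms by (simp_all add: d_def field_simps del: zero_less_mult_iff)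
  show "\<exists>d>0. \<forall>y. \<bar>y - x\<bar> < d \<longrightarrow> \<bar>inverse y - inverse x\<bar> < r"
  proof (intro exI[of _ d] conjI allI impI)
    fix y assume y: "\<bar>y - x\<bar> < d"
    have yx: "\<bar>x\<bar> < 2 * \<bar>y\<bar>" using y d(2) by (auto simp: abs_if split: if_splits)
    then have "y \<noteq> 0" by auto
    then have eq: "inverse y - inverse x = (x - y) / (x * y)" using assms by (simp add: field_simps)
    have "\<bar>x - y\<bar> * 2 < r * \<bar>x\<bar> * \<bar>x\<bar>" using y d(3) by (simp add: abs_minus_commute)
    also have "\<dots> \<le> r * \<bar>x\<bar> * (2 * \<bar>y\<bar>)" using yx r by (intro mult_left_mono) auto
    finally have "\<bar>x - y\<bar> < r * (\<bar>x\<bar> * \<bar>y\<bar>)" by (simp add: algebra_simps)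
    then show "\<bar>inverse y - inverse x\<bar> < r"
      unfolding eq using assms \<open>y \<noteq> 0\<close> by (simp add: abs_divide abs_mult pos_divide_less_eq)
  qed (rule d(1))
qed

definition rsqrt :: "'a::real_closed_field \<Rightarrow> 'a" where
  "rsqrt a = (THE b. if 0 \<le> a then 0 \<le> b \<and> b * b = a else b = 0)"

lemma rsqrt_ex1: "\<exists>!b. if 0 \<le> a then 0 \<le> b \<and> b * b = a else b = (0::'a::real_closed_field)"
proof (cases "0 \<le> a")
  case True
  then obtain b where "b * b = a" using ex_square_root by blast
  then have b: "\<bar>b\<bar> * \<bar>b\<bar> = a" by simp
  have "c = \<bar>b\<bar>" if "0 \<le> c" "c * c = a" for c
  proof -
    have "c * c = b * b" using that(2) \<open>b * b = a\<close> by simp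
    then have "c = b \<or> c = - b" by (simp add: square_eq_iff)
    then show ?thesis using that(1) by (auto simp: abs_if)
  qed
  then show ?thesis using True b by (intro ex1I[of _ "\<bar>b\<bar>"]) simp_all
qed auto

lemma rsqrt: "0 \<le> a \<Longrightarrow> 0 \<le> rsqrt a \<and> rsqrt a * rsqrt a = a"
  using theI'[OF rsqrt_ex1[of a]] unfolding rsqrt_def[symmetric] by simp

lemma rsqrt_pos: "0 < a \<Longrightarrow> 0 < rsqrt a"
  using rsqrt[of a] by (metis less_le mult_zero_left)

lemma dfun_rsqrt: "dfun S (\<lambda>e. rsqrt (e 0))"
proof (rule dfun_graph)
  show "dpred S (\<lambda>e. (0 \<le> e (Suc 0) \<longrightarrow> 0 \<le> e 0 \<and> e 0 * e 0 = e (Suc 0)) \<and> (\<not> 0 \<le> e (Suc 0) \<longrightarrow> e 0 = 0))"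
    by (intro dintros)
  show "((0 \<le> e 0 \<longrightarrow> 0 \<le> a \<and> a * a = e 0) \<and> (\<not> 0 \<le> e 0 \<longrightarrow> a = 0)) = (a = rsqrt (e 0))" for e a
    using rsqrt_ex1[of "e 0"] theI'[OF rsqrt_ex1[of "e 0"]] unfolding rsqrt_def[symmetric]
    by (auto split: if_splits)
qed

lemma cont_at_rsqrt:
  assumes "x > 0"
  shows "cont_at rsqrt (x :: 'a::real_closed_field)"
  unfolding cont_at_def
proof (intro allI impI)
  fix r :: 'a assume r: "r > 0"
  have s: "rsqrt x > 0" by (rule rsqrt_pos[OF assms])
  show "\<exists>d>0. \<forall>y. \<bar>y - x\<bar> < d \<longrightarrow> \<bar>rsqrt y - rsqrt x\<bar> < r"
  \<comment> \<open>The difference of the roots times their sum is \<open>y - x\<close>, and the sum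
    is at least \<open>rsqrt x\<close>; the bound \<open>x\<close> keeps \<open>y\<close>
    positive.\<close>
  proof (intro exI[of _ "min x (r * rsqrt x)"] conjI allI impI)
    fix y assume y: "\<bar>y - x\<bar> < min x (r * rsqrt x)"
    then have "y > 0" by (auto simp: abs_if split: if_splits)
    have sy: "rsqrt y > 0" "rsqrt y * rsqrt y = y" "rsqrt x * rsqrt x = x"
      using rsqrt_pos[OF \<open>y > 0\<close>] rsqrt[of y] rsqrt[of x] assms \<open>y > 0\<close> by simp_all
    have "(rsqrt y - rsqrt x) * (rsqrt y + rsqrt x) = y - x" using sy by (simp add: algebra_simps)
    then have "\<bar>rsqrt y - rsqrt x\<bar> * \<bar>rsqrt y + rsqrt x\<bar> = \<bar>y - x\<bar>" by (metis abs_mult)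
    moreover have "\<bar>rsqrt y - rsqrt x\<bar> * rsqrt x \<le> \<bar>rsqrt y - rsqrt x\<bar> * \<bar>rsqrt y + rsqrt x\<bar>"
      using s sy by (intro mult_left_mono) auto
    ultimately have "\<bar>rsqrt y - rsqrt x\<bar> * rsqrt x < r * rsqrt x" using y by simp
    then show "\<bar>rsqrt y - rsqrt x\<bar> < r" using s by (simp add: mult_less_cancel_right)
  qed (use r s assms in simp)
qed

context
  fixes S :: "('f, 'p, 'a::real_closed_field) expansion" and X :: "'x topology" and C
  assumes C: "definable_charts S X C"
begin

lemma dcont_comp1:
  assumes "dcont S X C f" "\<And>x. x \<in> topspace X \<Longrightarrow> cont_at g (f x)" "dfun S (\<lambda>e. g (e 0))"
  shows "dcont S X C (\<lambda>x. g (f x))"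
  unfolding dcont_def continuous_map_eps
proof (intro conjI ballI allI impI)
  fix x and r :: 'a assume x: "x \<in> topspace X" "r > 0"
  then obtain d where d: "d > 0" "\<And>y. \<bar>y - f x\<bar> < d \<Longrightarrow> \<bar>g y - g (f x)\<bar> < r"
    using assms(2) unfolding cont_at_def by metis
  then show "\<exists>W. openin X W \<and> x \<in> W \<and> (\<forall>y\<in>W. \<bar>g (f y) - g (f x)\<bar> < r)"
    using assms(1) x(1) unfolding dcont_def continuous_map_eps by meson
next
  fix c assume c: "c \<in> C"
  then have "dpred S (\<lambda>e. c e \<noteq> None)" using C by (simp add: definable_charts_def)
  moreover have "dfun S (\<lambda>e. g (pull c f e))"
    using assms(1) c by (intro dfun1_comp[OF assms(3)]) (simp add: dcont_def)
  \<comment> \<open>Off the chart the pullback of \<open>f\<close> is 0, where \<open>g\<close> may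
    take another value; the case distinction restores 0.\<close>
  ultimately have "dfun S (\<lambda>e. if c e \<noteq> None then g (pull c f e) else 0)"
    by (intro dfun_if dfun_const)
  moreover have "(\<lambda>e. if c e \<noteq> None then g (pull c f e) else 0) = pull c (\<lambda>x. g (f x))"
    by (auto simp: pull_def split: option.split)
  ultimately show "dfun S (pull c (\<lambda>x. g (f x)))" by simp
qed

lemma dcont_comp2:
  assumes "dcont S X C f" "dcont S X C h" "jcont G" "dfun S (\<lambda>e. G (e 0) (e 1))"
  shows "dcont S X C (\<lambda>x. G (f x) (h x))"
  unfolding dcont_def continuous_map_eps
proof (intro conjI ballI allI impI)
  fix x and r :: 'a assume x: "x \<in> topspace X" "r > 0"
  then obtain d where d: "d > 0" "\<And>a b. \<bar>a - f x\<bar> < d \<Longrightarrow> \<bar>b - h x\<bar> < d \<Longrightarrow> \<bar>G a b - G (f x) (h x)\<bar> < r"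
    using assms(3) unfolding jcont_def by metis
  obtain W where W: "openin X W" "x \<in> W" "\<forall>y\<in>W. \<bar>f y - f x\<bar> < d"
    using assms(1) d(1) x(1) unfolding dcont_def continuous_map_eps by blast
  obtain W' where W': "openin X W'" "x \<in> W'" "\<forall>y\<in>W'. \<bar>h y - h x\<bar> < d"
    using assms(2) d(1) x(1) unfolding dcont_def continuous_map_eps by blast
  show "\<exists>W. openin X W \<and> x \<in> W \<and> (\<forall>y\<in>W. \<bar>G (f y) (h y) - G (f x) (h x)\<bar> < r)"
    using W W' d(2) by (intro exI[of _ "W \<inter> W'"]) auto
next
  fix c assume c: "c \<in> C"
  then have "dpred S (\<lambda>e. c e \<noteq> None)" using C by (simp add: definable_charts_def)
  moreover have "dfun S (\<lambda>e. G (pull c f e) (pull c h e))"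
  proof -
    have "dfun S (\<lambda>e. if i = 0 then pull c f e else pull c h e)" for i :: nat
      using assms(1,2) c by (cases "i = 0") (auto simp: dcont_def)
    from dfun_subst[OF assms(4), of "\<lambda>e i. if i = 0 then pull c f e else pull c h e", OF this] show ?thesis by simp
  qed
  ultimately have "dfun S (\<lambda>e. if c e \<noteq> None then G (pull c f e) (pull c h e) else 0)"
    by (intro dfun_if dfun_const)
  moreover have "(\<lambda>e. if c e \<noteq> None then G (pull c f e) (pull c h e) else 0) = pull c (\<lambda>x. G (f x) (h x))"
    by (auto simp: pull_def split: option.split)
  ultimately show "dfun S (pull c (\<lambda>x. G (f x) (h x)))" by simp
qed

lemma dcont_const: "dcont S X C (\<lambda>_. k)"
proof -
  have "dfun S (pull c (\<lambda>_. k))" if "c \<in> C" for c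
  proof -
    have "dpred S (\<lambda>e. c e \<noteq> None)" using C that by (simp add: definable_charts_def)
    then have "dfun S (\<lambda>e. if c e \<noteq> None then k else 0)" by (intro dfun_if dfun_const)
    moreover have "(\<lambda>e. if c e \<noteq> None then k else 0) = pull c (\<lambda>_. k)"
      by (auto simp: pull_def split: option.split)
    ultimately show ?thesis by simp
  qed
  then show ?thesis by (simp add: dcont_def)
qed

lemma dcont_plus: "dcont S X C f \<Longrightarrow> dcont S X C h \<Longrightarrow> dcont S X C (\<lambda>x. f x + h x)"
  by (rule dcont_comp2[OF _ _ jcont_plus]) (auto intro: dintros)

lemma dcont_times: "dcont S X C f \<Longrightarrow> dcont S X C h \<Longrightarrow> dcont S X C (\<lambda>x. f x * h x)"
  by (rule dcont_comp2[OF _ _ jcont_times]) (auto intro: dintros)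

lemma dcont_max: "dcont S X C f \<Longrightarrow> dcont S X C h \<Longrightarrow> dcont S X C (\<lambda>x. max (f x) (h x))"
  by (rule dcont_comp2[OF _ _ jcont_max]) (auto intro: dintros)

lemma dcont_uminus: "dcont S X C f \<Longrightarrow> dcont S X C (\<lambda>x. - f x)"
  by (rule dcont_comp1[OF _ cont_at_uminus]) (auto intro: dintros)

lemma dcont_minus: "dcont S X C f \<Longrightarrow> dcont S X C h \<Longrightarrow> dcont S X C (\<lambda>x. f x - h x)"
  using dcont_plus[OF _ dcont_uminus, of f h] by simp

lemma dcont_min: "dcont S X C f \<Longrightarrow> dcont S X C h \<Longrightarrow> dcont S X C (\<lambda>x. min (f x) (h x))"
  using dcont_uminus[OF dcont_max[OF dcont_uminus dcont_uminus, of f h]] by (simp add: minus_max_eq_min)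

lemma dcont_inverse: "dcont S X C f \<Longrightarrow> (\<And>x. x \<in> topspace X \<Longrightarrow> f x \<noteq> 0) \<Longrightarrow> dcont S X C (\<lambda>x. inverse (f x))"
  by (rule dcont_comp1[OF _ cont_at_inverse]) (auto intro: dintros)

lemma dcont_divide: "dcont S X C h \<Longrightarrow> dcont S X C f \<Longrightarrow> (\<And>x. x \<in> topspace X \<Longrightarrow> f x \<noteq> 0) \<Longrightarrow>
    dcont S X C (\<lambda>x. h x / f x)"
  unfolding divide_inverse by (intro dcont_times dcont_inverse)

lemma dcont_rsqrt: "dcont S X C f \<Longrightarrow> (\<And>x. x \<in> topspace X \<Longrightarrow> f x > 0) \<Longrightarrow> dcont S X C (\<lambda>x. rsqrt (f x))"
  by (rule dcont_comp1[OF _ cont_at_rsqrt]) (auto intro: dfun_rsqrt)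

lemma dcont_sum: "(\<And>i. i \<in> I \<Longrightarrow> dcont S X C (f i)) \<Longrightarrow> dcont S X C (\<lambda>x. \<Sum>i\<in>I. f i x)"
  by (induction I rule: infinite_finite_induct) (simp_all add: dcont_const dcont_plus)

end

section \<open>The topology of \<open>R\<^sup>n\<close> and of definable manifolds\<close>

lemma continuous_map_Rn_component:
  assumes "l < m"
  shows "continuous_map (Rn m) euclidean (\<lambda>v :: 'a::real_closed_field vec. v $ l)"
proof -
  have "continuous_map (Rn m) (product_topology (\<lambda>_. euclidean) {..<m}) (\<lambda>v :: 'a vec. \<lambda>i\<in>{..<m}. v $ i)"
    using continuous_map_pullback[of "product_topology (\<lambda>_. euclidean) {..<m}" _ id "carrier_vec m" "\<lambda>v :: 'a vec. \<lambda>i\<in>{..<m}. v $ i"]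
    unfolding Rn_def by simp
  then have "continuous_map (Rn m) euclidean (\<lambda>v :: 'a vec. (\<lambda>i\<in>{..<m}. v $ i) l)"
    by (rule continuous_map_compose[OF _ continuous_map_product_projection, unfolded comp_def]) (use assms in simp)
  then show ?thesis using assms by simp
qed

lemma Rn_box:
  fixes O' :: "'a::real_closed_field vec set"
  assumes "openin (Rn m) O'" "v \<in> O'"
  shows "\<exists>d>0. \<forall>w\<in>carrier_vec m. (\<forall>i<m. \<bar>w $ i - v $ i\<bar> < d) \<longrightarrow> w \<in> O'"
proof -
  let ?g = "\<lambda>v :: 'a vec. \<lambda>i\<in>{..<m}. v $ i"
  obtain V where V: "openin (product_topology (\<lambda>_. euclidean) {..<m}) V" "O' = ?g -` V \<inter> carrier_vec m"
    using assms(1) unfolding Rn_def openin_pullback_topology by blast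
  then have "?g v \<in> V" using assms(2) by auto
  from bspec[OF V(1)[unfolded openin_product_topology_alt] this]
  obtain U where U0: "\<forall>i\<in>{..<m}. openin euclidean (U i)" "?g v \<in> Pi\<^sub>E {..<m} U" "Pi\<^sub>E {..<m} U \<subseteq> V"
    by (elim exE conjE)
  then have U: "\<And>i. i < m \<Longrightarrow> open (U i)" "?g v \<in> Pi\<^sub>E {..<m} U" "Pi\<^sub>E {..<m} U \<subseteq> V"
    by auto
  have "\<exists>d>0. \<forall>i\<in>{..<m}. \<forall>a. \<bar>a - v $ i\<bar> < d \<longrightarrow> a \<in> U i"
  proof (rule finite_common_radius[of "{..<m}" "\<lambda>i d. \<forall>a. \<bar>a - v $ i\<bar> < d \<longrightarrow> a \<in> U i"])
    fix i assume "i \<in> {..<m}"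
    then have i: "open (U i)" "v $ i \<in> U i" using U(1,2) by (auto simp: PiE_iff)
    obtain b where b: "b > v $ i" "{v $ i..<b} \<subseteq> U i" using open_right[OF i, of "v $ i + 1"] by auto
    obtain a where a: "a < v $ i" "{a<..v $ i} \<subseteq> U i" using open_left[OF i, of "v $ i - 1"] by auto
    have "x \<in> U i" if "\<bar>x - v $ i\<bar> < min (b - v $ i) (v $ i - a)" for x
    proof -
      have "\<bar>x - v $ i\<bar> < b - v $ i" "\<bar>x - v $ i\<bar> < v $ i - a" using that by auto
      then have "a < x" "x < b" by (simp_all add: abs_diff_less_iff)
      then show ?thesis using a(2) b(2) by (cases "x \<le> v $ i") auto
    qed
    then show "\<exists>d>0. \<forall>a. \<bar>a - v $ i\<bar> < d \<longrightarrow> a \<in> U i"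
      using a(1) b(1) by (intro exI[of _ "min (b - v $ i) (v $ i - a)"]) simp
  qed auto
  then obtain d where d: "d > 0" "\<And>i a. i < m \<Longrightarrow> \<bar>a - v $ i\<bar> < d \<Longrightarrow> a \<in> U i" by blast
  have "w \<in> O'" if "w \<in> carrier_vec m" "\<forall>i<m. \<bar>w $ i - v $ i\<bar> < d" for w
  proof -
    have "?g w \<in> Pi\<^sub>E {..<m} U" using d(2) that(2) by auto
    then have "?g w \<in> V" by (rule subsetD[OF U(3)])
    then show ?thesis using V(2) that(1) by simp
  qed
  then show ?thesis using d(1) by blast
qed

section \<open>Charts of a manifold and of its cylinder\<close>

definition mchart :: "('m, 'a) manifold \<Rightarrow> 'm set \<times> ('m \<Rightarrow> 'a vec) \<Rightarrow> (nat \<Rightarrow> 'a) \<Rightarrow> 'm option" where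
  "mchart M = (\<lambda>(U, \<phi>) e. if vec (mdim M) e \<in> \<phi> ` U then Some (inv_into U \<phi> (vec (mdim M) e)) else None)"

definition ichart :: "('m, 'a::real_closed_field) manifold \<Rightarrow> 'm set \<times> ('m \<Rightarrow> 'a vec) \<Rightarrow> (nat \<Rightarrow> 'a) \<Rightarrow> ('m \<times> 'a) option" where
  "ichart M = (\<lambda>(U, \<phi>) e. if vec (mdim M) e \<in> \<phi> ` U \<and> 0 \<le> e (mdim M) \<and> e (mdim M) \<le> 1
     then Some (inv_into U \<phi> (vec (mdim M) e), e (mdim M)) else None)"

abbreviation cylinder_topology :: "('m, 'a::real_closed_field) manifold \<Rightarrow> ('m \<times> 'a) topology" where
  "cylinder_topology M \<equiv> prod_topology (manifold_topology M) (top_of_set {0..1})"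

abbreviation mcont :: "('f, 'p, 'a::real_closed_field) expansion \<Rightarrow> ('m, 'a) manifold \<Rightarrow> ('m \<Rightarrow> 'a) \<Rightarrow> bool" where
  "mcont S M \<equiv> dcont S (manifold_topology M) (mchart M ` charts M)"

abbreviation icont :: "('f, 'p, 'a::real_closed_field) expansion \<Rightarrow> ('m, 'a) manifold \<Rightarrow> ('m \<times> 'a \<Rightarrow> 'a) \<Rightarrow> bool" where
  "icont S M \<equiv> dcont S (cylinder_topology M) (ichart M ` charts M)"

context
  fixes S :: "('f, 'p, 'a::real_closed_field) expansion" and M :: "('m, 'a) manifold" and k :: nat
  assumes man: "definable_Cr_manifold S k M"
begin

lemma chart_facts:
  assumes "(U, \<phi>) \<in> charts M"
  shows "inj_on \<phi> U" "U \<subseteq> points M" "\<phi> ` U \<subseteq> carrier_vec (mdim M)" "dpred S (\<lambda>e. vec (mdim M) e \<in> \<phi> ` U)"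
    "openin (Rn (mdim M)) (\<phi> ` U)"
proof -
  show "inj_on \<phi> U" using man assms unfolding definable_Cr_manifold_def by fast
  show "U \<subseteq> points M" using man assms unfolding definable_Cr_manifold_def by fast
  have "definable_open S (mdim M) (\<phi> ` (U \<inter> U))" using man assms unfolding definable_Cr_manifold_def by fast
  then show "\<phi> ` U \<subseteq> carrier_vec (mdim M)" "dpred S (\<lambda>e. vec (mdim M) e \<in> \<phi> ` U)" "openin (Rn (mdim M)) (\<phi> ` U)"
    by (auto simp: definable_open_def definable_set_iff_dpred)
qed

lemma topspace_cylinder: "topspace (cylinder_topology M) = points M \<times> {0..1}"
  by (simp add: topspace_manifold_topology[OF man])

lemma definable_charts_manifold: "definable_charts S (manifold_topology M) (mchart M ` charts M)"
  unfolding definable_charts_def topspace_manifold_topology[OF man]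
proof clarify
  fix U \<phi> assume c: "(U, \<phi>) \<in> charts M"
  have "dpred S (\<lambda>e. mchart M (U, \<phi>) e \<noteq> None)"
    using chart_facts(4)[OF c] by (simp add: mchart_def)
  moreover have "x \<in> points M" if "mchart M (U, \<phi>) e = Some x" for e x
    using chart_facts(2)[OF c] that by (auto simp: mchart_def inv_into_into split: if_splits)
  ultimately show "dpred S (\<lambda>e. mchart M (U, \<phi>) e \<noteq> None) \<and> (\<forall>e x. mchart M (U, \<phi>) e = Some x \<longrightarrow> x \<in> points M)"
    by blast
qed

lemma definable_charts_cylinder: "definable_charts S (cylinder_topology M) (ichart M ` charts M)"
  unfolding definable_charts_def topspace_cylinder
proof clarify
  fix U \<phi> assume c: "(U, \<phi>) \<in> charts M"
  have "dpred S (\<lambda>e. vec (mdim M) e \<in> \<phi> ` U \<and> 0 \<le> e (mdim M) \<and> e (mdim M) \<le> 1)"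
    by (intro dintros chart_facts(4)[OF c])
  moreover have "(ichart M (U, \<phi>) e \<noteq> None) = (vec (mdim M) e \<in> \<phi> ` U \<and> 0 \<le> e (mdim M) \<and> e (mdim M) \<le> 1)" for e
    by (simp add: ichart_def)
  ultimately have "dpred S (\<lambda>e. ichart M (U, \<phi>) e \<noteq> None)" by (simp only:)
  moreover have "x \<in> points M \<times> {0..1}" if "ichart M (U, \<phi>) e = Some x" for e x
    using chart_facts(2)[OF c] that by (auto simp: ichart_def inv_into_into split: if_splits)
  ultimately show "dpred S (\<lambda>e. ichart M (U, \<phi>) e \<noteq> None) \<and>
    (\<forall>e x. ichart M (U, \<phi>) e = Some x \<longrightarrow> x \<in> points M \<times> {0..1})"
    by blast
qed

lemma open_in_chart:
  assumes c: "(U, \<phi>) \<in> charts M" and "openin (manifold_topology M) W" "p0 \<in> U" "p0 \<in> W"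
  shows "\<exists>r>0. \<forall>p\<in>U. (\<forall>i<mdim M. \<bar>\<phi> p $ i - \<phi> p0 $ i\<bar> < r) \<longrightarrow> p \<in> W"
proof -
  have "openin (Rn (mdim M)) (\<phi> ` (W \<inter> U))" using assms openin_manifold_topology[OF man] by fast
  moreover have "\<phi> p0 \<in> \<phi> ` (W \<inter> U)" using assms by blast
  ultimately obtain r where r: "r > 0" "\<forall>w\<in>carrier_vec (mdim M). (\<forall>i<mdim M. \<bar>w $ i - \<phi> p0 $ i\<bar> < r) \<longrightarrow> w \<in> \<phi> ` (W \<inter> U)"
    using Rn_box by blast
  have "p \<in> W" if "p \<in> U" "\<forall>i<mdim M. \<bar>\<phi> p $ i - \<phi> p0 $ i\<bar> < r" for p
  proof -
    have "\<phi> p \<in> \<phi> ` (W \<inter> U)" using r(2) chart_facts(3)[OF c] that by auto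
    then show ?thesis using chart_facts(1)[OF c] that(1) by (auto dest: inj_onD)
  qed
  then show ?thesis using r(1) by blast
qed

text \<open>Openness has to be checked in every other chart, where it is continuity of the
  coordinate change; \<open>Cr_on\<close> contains continuity for every order of
  differentiability.\<close>

lemma open_chart_box:
  assumes c: "(U, \<phi>) \<in> charts M"
  shows "openin (manifold_topology M) {p \<in> U. \<forall>i<mdim M. \<bar>\<phi> p $ i - v i\<bar> < r}" (is "openin _ ?W")
  unfolding openin_manifold_topology[OF man]
proof (intro conjI ballI, goal_cases)
  case 1
  show ?case using chart_facts(2)[OF c] by auto
next
  case (2 c')
  obtain V \<psi> where c': "c' = (V, \<psi>)" "(V, \<psi>) \<in> charts M" using 2 by (cases c') auto
  let ?T = "\<psi> ` (V \<inter> U)"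
  let ?f = "\<lambda>x. \<phi> (inv_into V \<psi> x)"
  have "\<And>V \<psi>. (V, \<psi>) \<in> charts M \<Longrightarrow> definable_open S (mdim M) (\<psi> ` (V \<inter> U)) \<and> definable_Cr_map S k (mdim M) (mdim M) (\<psi> ` (V \<inter> U)) (\<lambda>x. \<phi> (inv_into V \<psi> x))"
    using man c unfolding definable_Cr_manifold_def by fast
  then have T: "openin (Rn (mdim M)) ?T" and cr: "\<And>j. j < (mdim M) \<Longrightarrow> Cr_on k (mdim M) ?T (\<lambda>x. ?f x $ j)"
    using c'(2) by (auto simp: definable_open_def definable_Cr_map_def)
  have cont: "continuous_map (subtopology (Rn (mdim M)) ?T) euclidean (\<lambda>x. ?f x $ j)" if "j < (mdim M)" for j
    using cr[OF that] by (cases k) auto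
  have op: "openin (Rn (mdim M)) {x \<in> ?T. \<bar>?f x $ j - v j\<bar> < r}" if "j < (mdim M)" for j
  proof -
    have "openin (subtopology (Rn (mdim M)) ?T) {x \<in> topspace (subtopology (Rn (mdim M)) ?T). ?f x $ j \<in> {v j - r<..<v j + r}}"
      by (rule openin_continuous_map_preimage[OF cont[OF that]]) auto
    then have "openin (Rn (mdim M)) {x \<in> topspace (subtopology (Rn (mdim M)) ?T). ?f x $ j \<in> {v j - r<..<v j + r}}"
      using T openin_open_subtopology by blast
    moreover have "topspace (subtopology (Rn (mdim M)) ?T) = ?T" using openin_subset[OF T] by auto
    moreover have "a \<in> {v j - r<..<v j + r} \<longleftrightarrow> \<bar>a - v j\<bar> < r" for a by (auto simp: abs_if)
    ultimately show ?thesis by (simp only:)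
  qed
  have "openin (Rn (mdim M)) {x \<in> ?T. \<forall>j<m. \<bar>?f x $ j - v j\<bar> < r}" if "m \<le> (mdim M)" for m
    using that
  proof (induction m)
    case 0
    show ?case using T by simp
  next
    case (Suc m)
    have "{x \<in> ?T. \<forall>j<Suc m. \<bar>?f x $ j - v j\<bar> < r} =
      {x \<in> ?T. \<forall>j<m. \<bar>?f x $ j - v j\<bar> < r} \<inter> {x \<in> ?T. \<bar>?f x $ m - v m\<bar> < r}" by (auto simp: less_Suc_eq)
    moreover have "openin (Rn (mdim M)) {x \<in> ?T. \<forall>j<m. \<bar>?f x $ j - v j\<bar> < r}" using Suc by simp
    moreover have "openin (Rn (mdim M)) {x \<in> ?T. \<bar>?f x $ m - v m\<bar> < r}" using Suc.prems by (intro op) simp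
    ultimately show ?case by (metis (no_types, lifting) openin_Int)
  qed
  moreover have "\<psi> ` (?W \<inter> V) = {x \<in> ?T. \<forall>j<mdim M. \<bar>?f x $ j - v j\<bar> < r}"
    using chart_facts(1)[OF c'(2)] by (auto simp: image_iff)
  ultimately show ?case unfolding c'(1) by simp
qed

text \<open>Identifies the ring of the statement with the functions for which the closure lemmas
  hold.\<close>

lemma mcont_iff_carrier: "f \<in> carrier (Cdf0 S M) \<longleftrightarrow> f \<in> extensional (points M) \<and> mcont S M f"
proof -
  have "definable_set S ((mdim M) + 1) ((\<lambda>p. \<phi> p @\<^sub>v vec1 (f p)) ` U) \<longleftrightarrow> dfun S (pull (mchart M (U, \<phi>)) f)"
    if c: "(U, \<phi>) \<in> charts M" for U \<phi>
  proof -
    let ?p = "pull (mchart M (U, \<phi>)) f" and ?g = "\<lambda>e. vec (mdim M) e \<in> \<phi> ` U"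
    note cf = chart_facts[OF c]
    have p: "?p e = (if ?g e then f (inv_into U \<phi> (vec (mdim M) e)) else 0)" for e
      by (simp add: pull_def mchart_def)
    have mem: "vec ((mdim M) + 1) e \<in> (\<lambda>p. \<phi> p @\<^sub>v vec1 (f p)) ` U \<longleftrightarrow> ?g e \<and> e (mdim M) = ?p e" for e
    proof -
      have v: "vec ((mdim M) + 1) e = vec (mdim M) e @\<^sub>v vec1 (e (mdim M))" by (rule eq_vecI) (auto simp: vec1_def less_Suc_eq)
      have v1: "vec1 a = vec1 b \<longleftrightarrow> a = b" for a b :: 'a
      proof -
        have "vec1 a $ 0 = a" for a :: 'a by (simp add: vec1_def)
        then show ?thesis by metis
      qed
      have "vec (mdim M) e @\<^sub>v vec1 (e (mdim M)) = \<phi> p @\<^sub>v vec1 (f p) \<longleftrightarrow> vec (mdim M) e = \<phi> p \<and> e (mdim M) = f p" if "p \<in> U" for p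
        using cf(3) that v1 by (subst append_vec_eq[of _ "mdim M"]) auto
      then have "vec ((mdim M) + 1) e \<in> (\<lambda>p. \<phi> p @\<^sub>v vec1 (f p)) ` U \<longleftrightarrow> (\<exists>p\<in>U. vec (mdim M) e = \<phi> p \<and> e (mdim M) = f p)"
        unfolding v by auto
      then show ?thesis using cf(1) unfolding p by (auto simp: inv_into_f_f)
    qed
    have sub: "(\<lambda>p. \<phi> p @\<^sub>v vec1 (f p)) ` U \<subseteq> carrier_vec ((mdim M) + 1)"
      by (intro image_subsetI append_carrier_vec) (use cf(3) in \<open>auto simp: vec1_def\<close>)
    show ?thesis
    proof
      assume "definable_set S ((mdim M) + 1) ((\<lambda>p. \<phi> p @\<^sub>v vec1 (f p)) ` U)"
      then have G: "dpred S (\<lambda>e. ?g e \<and> e (mdim M) = ?p e)" unfolding definable_set_iff_dpred mem by simp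
      \<comment> \<open>In the graph the value is the last coordinate, in \<open>dfun\<close> it is
        at position 0; the renaming moves it. The second disjunct covers the environments off the
        chart, where the pullback is 0.\<close>
      have "dpred S (\<lambda>e. (?g (\<lambda>i. if i = (mdim M) then e 0 else e (Suc i)) \<and>
          e 0 = ?p (\<lambda>i. if i = (mdim M) then e 0 else e (Suc i))) \<or> (\<not> ?g (\<lambda>i. e (Suc i)) \<and> e 0 = 0))"
      proof (rule dpred_disj)
        show "dpred S (\<lambda>e. ?g (\<lambda>i. if i = (mdim M) then e 0 else e (Suc i)) \<and>
          e 0 = ?p (\<lambda>i. if i = (mdim M) then e 0 else e (Suc i)))"
          using dpred_ren[OF G, of "\<lambda>i. if i = (mdim M) then 0 else Suc i"]
          by (simp add: if_distrib[of "\<lambda>i. e i" for e] cong: if_cong)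
        show "dpred S (\<lambda>e. \<not> ?g (\<lambda>i. e (Suc i)) \<and> e 0 = 0)"
          by (intro dintros dpred_ren[OF cf(4)])
      qed
      moreover have "vec (mdim M) (\<lambda>i. if i = (mdim M) then e 0 else e (Suc i)) = vec (mdim M) (\<lambda>i. e (Suc i))" for e :: "nat \<Rightarrow> 'a"
        by auto
      ultimately have "dpred S (\<lambda>e. e 0 = ?p (\<lambda>i. e (Suc i)))"
        unfolding p by (elim back_subst[of "dpred S"]) auto
      then show "dfun S ?p" by (simp add: dfun_def)
    next
      assume "dfun S ?p"
      then have "dpred S (\<lambda>e. ?g e \<and> e (mdim M) = ?p e)" by (intro dintros cf(4))
      then show "definable_set S ((mdim M) + 1) ((\<lambda>p. \<phi> p @\<^sub>v vec1 (f p)) ` U)"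
        unfolding definable_set_iff_dpred mem using sub by simp
    qed
  qed
  then show ?thesis
    unfolding Cdf0_def dcont_def definable_function_def by (auto 0 3)
qed

end

lemma fun1_eps:
  fixes g :: "'m \<times> 'a::real_closed_field \<Rightarrow> 'a"
  assumes g: "continuous_map (prod_topology X (top_of_set {0..1})) euclidean g"
    and p: "p0 \<in> topspace X" and u: "0 \<le> u0" "u0 \<le> 1" and r: "r > 0"
  shows "\<exists>W d. openin X W \<and> p0 \<in> W \<and> d > 0 \<and> (\<forall>p\<in>W. \<forall>u. 0 \<le> u \<and> u \<le> 1 \<and> \<bar>u - u0\<bar> < d \<longrightarrow> \<bar>g (p, u) - g (p0, u0)\<bar> < r)"
proof -
  have "(p0, u0) \<in> topspace (prod_topology X (top_of_set {0..1}))" using p u by simp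
  then obtain Z where Z: "openin (prod_topology X (top_of_set {0..1})) Z" "(p0, u0) \<in> Z"
    "\<forall>y\<in>Z. \<bar>g y - g (p0, u0)\<bar> < r"
    using g r unfolding continuous_map_eps by blast
  from Z(1)[unfolded openin_prod_topology_alt, rule_format, OF Z(2)]
  obtain W J where WJ: "openin X W" "openin (top_of_set {0..1}) J" "p0 \<in> W" "u0 \<in> J" "W \<times> J \<subseteq> Z"
    by (elim exE conjE)
  obtain T where T: "open T" "J = {0..1} \<inter> T" using WJ(2) by (auto simp: openin_open)
  have "u0 \<in> T" using WJ(4) T by blast
  obtain b where b: "b > u0" "{u0..<b} \<subseteq> T" using open_right[OF T(1) \<open>u0 \<in> T\<close>, of "u0 + 1"] by auto
  obtain a where a: "a < u0" "{a<..u0} \<subseteq> T" using open_left[OF T(1) \<open>u0 \<in> T\<close>, of "u0 - 1"] by auto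
  have "u \<in> J" if "0 \<le> u" "u \<le> 1" "\<bar>u - u0\<bar> < min (b - u0) (u0 - a)" for u
  proof -
    have "\<bar>u - u0\<bar> < b - u0" "\<bar>u - u0\<bar> < u0 - a" using that by auto
    then have "a < u" "u < b" by (simp_all add: abs_diff_less_iff)
    then have "u \<in> T" using a(2) b(2) by (cases "u \<le> u0") auto
    then show ?thesis using T that by auto
  qed
  moreover have "min (b - u0) (u0 - a) > 0" using a b by simp
  ultimately show ?thesis using WJ Z(3)
    by (intro exI[of _ W] exI[of _ "min (b - u0) (u0 - a)"]) blast
qed

lemma pull_ichart:
  "pull (ichart M (U, \<phi>)) g e = (if vec (mdim M) e \<in> \<phi> ` U \<and> 0 \<le> e (mdim M) \<and> e (mdim M) \<le> 1
     then g (inv_into U \<phi> (vec (mdim M) e), e (mdim M)) else 0)"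
  unfolding pull_def ichart_def prod.case 
  by (cases "vec (mdim M) e \<in> \<phi> ` U \<and> 0 \<le> e (mdim M) \<and> e (mdim M) \<le> 1")
    (simp_all only: simp_thms if_True if_False option.case)

lemma pull_mchart:
  "pull (mchart M (U, \<phi>)) f e = (if vec (mdim M) e \<in> \<phi> ` U then f (inv_into U \<phi> (vec (mdim M) e)) else 0)"
  unfolding pull_def mchart_def prod.case
  by (cases "vec (mdim M) e \<in> \<phi> ` U") (simp_all only: simp_thms if_True if_False option.case)

lemma pull_ichart_upd:
  assumes "p = inv_into U \<phi> (vec (mdim M) e)" "vec (mdim M) e \<in> \<phi> ` U" "0 \<le> u" "u \<le> 1"
  shows "pull (ichart M (U, \<phi>)) g (e(mdim M := u)) = g (p, u)"
proof -
  have "vec (mdim M) (e(mdim M := u)) = vec (mdim M) e" by auto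
  then show ?thesis using assms by (simp add: pull_def ichart_def)
qed

section \<open>Continuous definable functions on the cylinder over M\<close>

context
  fixes S :: "('f, 'p, 'a::real_closed_field) expansion" and M :: "('m, 'a) manifold" and k :: nat
  assumes om: "o_minimal S" and man: "definable_Cr_manifold S k M"
begin

lemma exists_chart:
  assumes "p \<in> points M"
  shows "\<exists>U \<phi>. (U, \<phi>) \<in> charts M \<and> p \<in> U"
proof -
  have "points M = (\<Union>(U, \<phi>) \<in> charts M. U)"
    using man unfolding definable_Cr_manifold_def by (elim conjE)
  then show ?thesis using assms by auto
qed

lemma mcontI:
  assumes "\<And>U \<phi>. (U, \<phi>) \<in> charts M \<Longrightarrow> dfun S (pull (mchart M (U, \<phi>)) f)"
    and "continuous_map (manifold_topology M) euclidean f"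
  shows "mcont S M f"
  using assms by (auto simp: dcont_def)

text \<open>Nothing is known about \<open>g\<close> at times outside [0,1], so only the guarded
  graph of the slice is claimed to be definable.\<close>

lemma icont_slice:
  assumes g: "icont S M g" and p: "p \<in> points M"
  shows "dpred S (\<lambda>e. 0 \<le> e 0 \<and> e 0 \<le> 1 \<and> e (Suc 0) = g (p, e 0))"
proof -
  obtain U \<phi> where c: "(U, \<phi>) \<in> charts M" "p \<in> U"
    using exists_chart[OF p] by blast
  note cf = chart_facts[OF man c(1)]
  let ?d = "mdim M"
  let ?h = "\<lambda>u i. if i < ?d then \<phi> p $ i else u"
  have \<phi>p: "\<phi> p \<in> carrier_vec ?d" using cf(3) c(2) by blast
  then have v: "vec ?d (?h u) = \<phi> p" for u by auto
  have eq: "0 \<le> u \<and> u \<le> 1 \<and> z = g (p, u) \<longleftrightarrow> 0 \<le> u \<and> u \<le> 1 \<and> z = pull (ichart M (U, \<phi>)) g (?h u)" for u z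
    using c(2) cf(1) by (auto simp: pull_def ichart_def v)
  have "dfun S (pull (ichart M (U, \<phi>)) g)" using g c(1) by (auto simp: dcont_def)
  then have "dfun S (\<lambda>e. pull (ichart M (U, \<phi>)) g (?h (e 0)))"
    by (rule dfun_subst) (intro dfun_if dpred_const dintros)
  then show ?thesis unfolding eq by (intro dintros)
qed

lemma slice_pred:
  assumes g: "icont S M g" and p: "p \<in> points M"
    and Q: "dpred S (\<lambda>e. Q (\<lambda>i. e (Suc i)) (e 0))" and h: "\<And>i. dfun S (\<lambda>e. h e i)" and f: "dfun S f"
  shows "dpred S (\<lambda>e. 0 \<le> f e \<and> f e \<le> 1 \<and> Q (h e) (g (p, f e)))"
proof -
  have "dpred S (\<lambda>e. \<exists>z. (0 \<le> f e \<and> f e \<le> 1 \<and> z = g (p, f e)) \<and> Q (h e) z)"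
  proof (rule dpred_ex, rule dpred_conj)
    show "dpred S (\<lambda>e. 0 \<le> f (\<lambda>i. e (Suc i)) \<and> f (\<lambda>i. e (Suc i)) \<le> 1 \<and> e 0 = g (p, f (\<lambda>i. e (Suc i))))"
      using dpred_subst2[where A = "\<lambda>_ b a. 0 \<le> a \<and> a \<le> 1 \<and> b = g (p, a)" and h = "\<lambda>e. e" and f = "\<lambda>e. e 0"
        and g = "\<lambda>e. f (\<lambda>i. e (Suc i))", OF icont_slice[OF g p] dfun_var dfun_var dfun_ren[OF f]] .
    show "dpred S (\<lambda>e. Q (h (\<lambda>i. e (Suc i))) (e 0))"
      by (rule dpred_subst1[OF Q]) (use dfun_ren[OF h] dfun_var in auto)
  qed
  then show ?thesis by (rule back_subst[of "dpred S"]) auto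
qed

text \<open>Definable compactness of \<open>[0,1]\<close>: continuity at the points \<open>(p0, u)\<close> is uniform in \<open>u\<close>.\<close>

lemma icont_uniform:
  assumes g: "icont S M g" and p0: "p0 \<in> points M" and r: "r > 0"
  shows "\<exists>W. openin (manifold_topology M) W \<and> p0 \<in> W \<and>
    (\<forall>p\<in>W. \<forall>u. 0 \<le> u \<and> u \<le> 1 \<longrightarrow> \<bar>g (p, u) - g (p0, u)\<bar> < r)"
proof -
  obtain U \<phi> where c: "(U, \<phi>) \<in> charts M" "p0 \<in> U"
    using exists_chart[OF p0] by blast
  note cf = chart_facts[OF man c(1)]
  let ?d = "mdim M" and ?c = "ichart M (U, \<phi>)"
  let ?near = "\<lambda>p s. \<forall>i<?d. \<bar>\<phi> p $ i - \<phi> p0 $ i\<bar> < s"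
  have loc: "\<exists>s>0. \<forall>p\<in>U. \<forall>u. ?near p s \<and> 0 \<le> u \<and> u \<le> 1 \<and> \<bar>u - u0\<bar> < s \<longrightarrow> \<bar>g (p, u) - g (p0, u)\<bar> < r"
    if u0: "0 \<le> u0" "u0 \<le> 1" for u0
  proof -
    define q where "q = r / 2"
    have q: "q > 0" "r = q + q" using r by (simp_all add: q_def)
    have "continuous_map (cylinder_topology M) euclidean g" using g by (simp add: dcont_def)
    from fun1_eps[OF this _ u0 q(1), of p0]
    obtain W s where W: "openin (manifold_topology M) W" "p0 \<in> W" "s > 0"
      "\<forall>p\<in>W. \<forall>u. 0 \<le> u \<and> u \<le> 1 \<and> \<bar>u - u0\<bar> < s \<longrightarrow> \<bar>g (p, u) - g (p0, u0)\<bar> < q"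
      using p0 unfolding topspace_manifold_topology[OF man] by (elim meta_impE exE conjE) simp_all
    obtain s' where s': "s' > 0" "\<And>p. p \<in> U \<Longrightarrow> ?near p s' \<Longrightarrow> p \<in> W"
      using open_in_chart[OF man c(1) W(1) c(2) W(2)] by blast
    show ?thesis
    proof (intro exI[of _ "min s s'"] conjI ballI allI impI)
      fix p u assume pu: "p \<in> U" "?near p (min s s') \<and> 0 \<le> u \<and> u \<le> 1 \<and> \<bar>u - u0\<bar> < min s s'"
      then have "p \<in> W" by (intro s'(2)) auto
      then have "\<bar>g (p, u) - g (p0, u0)\<bar> < q" "\<bar>g (p0, u) - g (p0, u0)\<bar> < q"
        using W(2,4) pu(2) by auto
      then show "\<bar>g (p, u) - g (p0, u)\<bar> < r" unfolding q(2) abs_diff_less_iff by linarith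
    qed (use W(3) s'(1) in simp)
  qed
  \<comment> \<open>One radius \<open>s\<close> serves for all times before \<open>b\<close>;
    continuity at a time extends this statement past it.\<close>
  let ?P = "\<lambda>b. \<exists>s>0. \<forall>p\<in>U. \<forall>u. ?near p s \<and> 0 \<le> u \<and> u \<le> 1 \<and> u < b \<longrightarrow> \<bar>g (p, u) - g (p0, u)\<bar> < r"
  have dP: "dpred S (\<lambda>e. ?P (e 0))"
  proof -
    let ?h0 = "\<lambda>u i. if i < ?d then \<phi> p0 $ i else u"
    let ?B = "\<lambda>e. vec ?d e \<in> \<phi> ` U \<and> (\<forall>i\<in>{..<?d}. \<bar>e i - \<phi> p0 $ i\<bar> < e (Suc ?d)) \<and>
      \<not> \<bar>pull ?c g e - pull ?c g (?h0 (e ?d))\<bar> < r"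
    have pg: "dfun S (pull ?c g)" using g c(1) by (auto simp: dcont_def)
    have "dfun S (\<lambda>e. pull ?c g (?h0 (e ?d)))"
      by (rule dfun_subst[OF pg]) (intro dfun_if dpred_const dintros)
    then have dB: "dpred S ?B"
      using pg cf(4) by (intro dpred_conj dpred_not dpred_less dpred_fin_Ball dintros) auto
    \<comment> \<open>The environment of \<open>?B\<close> consists of the \<open>?d\<close>
      coordinates of a point, the time and the radius. As \<open>dpred_exn\<close> binds the
      coordinates existentially, the universal statement over the chart is written as a negated
      existence.\<close>
    define N where "N u s e \<longleftrightarrow> \<not> (\<exists>v. ?B (\<lambda>i. if i < ?d then v i else push u (push s e) (i - ?d)))" for u s e
    have dN: "dpred S (\<lambda>e. \<exists>s>0. \<forall>u. 0 \<le> u \<and> u \<le> 1 \<and> u < e 0 \<longrightarrow> N u s e)"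
      unfolding N_def
    proof (rule dpred_ex, rule dpred_conj, goal_cases)
      case 1
      show ?case by (intro dintros)
    next
      case 2
      have "push (e 0) (push (e (Suc 0)) (\<lambda>i. e (Suc (Suc i)))) = e" for e :: "nat \<Rightarrow> 'a"
        by (auto simp: fun_eq_iff split: nat.split)
      then have "dpred S (\<lambda>e. \<not> (\<exists>v. ?B (\<lambda>i. if i < ?d then v i else
          push (e 0) (push (e (Suc 0)) (\<lambda>i. e (Suc (Suc i)))) (i - ?d))))"
        using dpred_not[OF dpred_exn[OF dB, of ?d]] by (simp only:)
      then show ?case by (intro dpred_all dpred_imp) (intro dintros, assumption)
    qed
    have N: "N u s e \<longleftrightarrow> (\<forall>p\<in>U. ?near p s \<longrightarrow> \<bar>g (p, u) - g (p0, u)\<bar> < r)" if u: "0 \<le> u" "u \<le> 1" for u s e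
    proof -
      let ?E = "\<lambda>v i. if i < ?d then v i else push u (push s e) (i - ?d)"
      have p0': "pull ?c g (?h0 u) = g (p0, u)"
      proof -
        have "\<phi> p0 \<in> carrier_vec ?d" using cf(3) c(2) by blast
        then have "vec ?d (?h0 u) = \<phi> p0" by auto
        then show ?thesis using c(2) cf(1) u by (simp add: pull_def ichart_def)
      qed
      have "?B (?E v) \<longleftrightarrow> vec ?d v \<in> \<phi> ` U \<and> (\<forall>i<?d. \<bar>v i - \<phi> p0 $ i\<bar> < s) \<and>
          \<not> \<bar>g (inv_into U \<phi> (vec ?d v), u) - g (p0, u)\<bar> < r" for v
      proof -
        have 1: "vec ?d (?E v) = vec ?d v" by auto
        have 2: "?E v ?d = u" "?E v (Suc ?d) = s" by auto
        have 3: "(\<forall>i\<in>{..<?d}. \<bar>?E v i - \<phi> p0 $ i\<bar> < s) = (\<forall>i<?d. \<bar>v i - \<phi> p0 $ i\<bar> < s)" by auto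
        have 4: "pull ?c g (?E v) = g (inv_into U \<phi> (vec ?d v), u)" if "vec ?d v \<in> \<phi> ` U"
          unfolding pull_def ichart_def prod.case 1 2 using that u by simp
        show ?thesis unfolding 1 2 3 p0' using 4 by (cases "vec ?d v \<in> \<phi> ` U") (simp_all only: simp_thms)
      qed
      then have "(\<exists>v. ?B (?E v)) \<longleftrightarrow> (\<exists>v. vec ?d v \<in> \<phi> ` U \<and> (\<forall>i<?d. \<bar>v i - \<phi> p0 $ i\<bar> < s) \<and>
          \<not> \<bar>g (inv_into U \<phi> (vec ?d v), u) - g (p0, u)\<bar> < r)" by (simp only:)
      also have "\<dots> \<longleftrightarrow> (\<exists>p\<in>U. ?near p s \<and> \<not> \<bar>g (p, u) - g (p0, u)\<bar> < r)"
      proof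
        assume "\<exists>v. vec ?d v \<in> \<phi> ` U \<and> (\<forall>i<?d. \<bar>v i - \<phi> p0 $ i\<bar> < s) \<and>
          \<not> \<bar>g (inv_into U \<phi> (vec ?d v), u) - g (p0, u)\<bar> < r"
        then obtain v where v: "vec ?d v \<in> \<phi> ` U" "\<forall>i<?d. \<bar>v i - \<phi> p0 $ i\<bar> < s"
          "\<not> \<bar>g (inv_into U \<phi> (vec ?d v), u) - g (p0, u)\<bar> < r" by blast
        obtain p where p: "p \<in> U" "vec ?d v = \<phi> p" using v(1) by blast
        have "?near p s" using v(2) unfolding p(2)[symmetric] by simp
        then show "\<exists>p\<in>U. ?near p s \<and> \<not> \<bar>g (p, u) - g (p0, u)\<bar> < r"
          using v(3) p cf(1) by (intro bexI[of _ p]) auto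
      next
        assume "\<exists>p\<in>U. ?near p s \<and> \<not> \<bar>g (p, u) - g (p0, u)\<bar> < r"
        then obtain p where p: "p \<in> U" "?near p s" "\<not> \<bar>g (p, u) - g (p0, u)\<bar> < r" by blast
        have "\<phi> p \<in> carrier_vec ?d" using cf(3) p(1) by blast
        then have "vec ?d (\<lambda>i. \<phi> p $ i) = \<phi> p" by auto
        then show "\<exists>v. vec ?d v \<in> \<phi> ` U \<and> (\<forall>i<?d. \<bar>v i - \<phi> p0 $ i\<bar> < s) \<and>
          \<not> \<bar>g (inv_into U \<phi> (vec ?d v), u) - g (p0, u)\<bar> < r"
          using p cf(1) by (intro exI[of _ "\<lambda>i. \<phi> p $ i"]) simp
      qed
      finally have "N u s e \<longleftrightarrow> \<not> (\<exists>p\<in>U. ?near p s \<and> \<not> \<bar>g (p, u) - g (p0, u)\<bar> < r)"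
        unfolding N_def by (rule arg_cong[where f = Not])
      also have "\<dots> \<longleftrightarrow> (\<forall>p\<in>U. ?near p s \<longrightarrow> \<bar>g (p, u) - g (p0, u)\<bar> < r)"
        by (simp only: bex_simps ball_simps de_Morgan_conj not_not imp_conv_disj)
      finally show ?thesis .
    qed
    have "(\<forall>u. 0 \<le> u \<and> u \<le> 1 \<and> u < b \<longrightarrow> N u s e) \<longleftrightarrow>
        (\<forall>p\<in>U. \<forall>u. ?near p s \<and> 0 \<le> u \<and> u \<le> 1 \<and> u < b \<longrightarrow> \<bar>g (p, u) - g (p0, u)\<bar> < r)" for s e b
    proof (intro iffI ballI allI impI)
      fix p u assume "\<forall>u. 0 \<le> u \<and> u \<le> 1 \<and> u < b \<longrightarrow> N u s e" "p \<in> U"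
        and u: "?near p s \<and> 0 \<le> u \<and> u \<le> 1 \<and> u < b"
      then have "N u s e" by (elim allE impE) simp_all
      then show "\<bar>g (p, u) - g (p0, u)\<bar> < r" using u \<open>p \<in> U\<close> unfolding N[OF conjunct1[OF conjunct2[OF u]] conjunct1[OF conjunct2[OF conjunct2[OF u]]]] by simp
    next
      fix u assume *: "\<forall>p\<in>U. \<forall>u. ?near p s \<and> 0 \<le> u \<and> u \<le> 1 \<and> u < b \<longrightarrow> \<bar>g (p, u) - g (p0, u)\<bar> < r"
        and u: "0 \<le> u \<and> u \<le> 1 \<and> u < b"
      from * u have "\<forall>p\<in>U. ?near p s \<longrightarrow> \<bar>g (p, u) - g (p0, u)\<bar> < r" by blast
      then show "N u s e" unfolding N[OF conjunct1[OF u] conjunct1[OF conjunct2[OF u]]] .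
    qed
    then show ?thesis using dN by (simp only:)
  qed
  have "?P 1"
  proof (rule definable_connected[OF om dP, of 0])
    show "?P 0" by (intro exI[of _ 1]) auto
    fix y :: 'a assume y: "0 \<le> y" "y \<le> 1"
    from loc[OF y] obtain s where s: "s > 0"
      "\<forall>p\<in>U. \<forall>u. ?near p s \<and> 0 \<le> u \<and> u \<le> 1 \<and> \<bar>u - y\<bar> < s \<longrightarrow> \<bar>g (p, u) - g (p0, u)\<bar> < r"
      by (elim exE conjE)
    have "?P z'" if z: "\<bar>z - y\<bar> < s" "\<bar>z' - y\<bar> < s" "?P z" for z z'
    proof -
      from z(3) obtain s' where s': "s' > 0"
        "\<forall>p\<in>U. \<forall>u. ?near p s' \<and> 0 \<le> u \<and> u \<le> 1 \<and> u < z \<longrightarrow> \<bar>g (p, u) - g (p0, u)\<bar> < r"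
        by (elim exE conjE)
      show ?thesis
      proof (intro exI[of _ "min s s'"] conjI ballI allI impI)
        fix p u assume pu: "p \<in> U" "?near p (min s s') \<and> 0 \<le> u \<and> u \<le> 1 \<and> u < z'"
        show "\<bar>g (p, u) - g (p0, u)\<bar> < r"
        proof (cases "u < z")
          case True
          then have "?near p s' \<and> 0 \<le> u \<and> u \<le> 1 \<and> u < z" using pu(2) by simp
          then show ?thesis using s'(2) pu(1) by blast
        next
          case False
          then have "\<bar>u - y\<bar> < s" using z pu(2) unfolding abs_diff_less_iff by linarith
          then have "?near p s \<and> 0 \<le> u \<and> u \<le> 1 \<and> \<bar>u - y\<bar> < s" using pu(2) by simp
          then show ?thesis using s(2) pu(1) by blast
        qed
      qed (use s s' in simp)
    qed
    then show "\<exists>d>0. \<forall>z z'. 0 \<le> z \<and> z \<le> 1 \<and> 0 \<le> z' \<and> z' \<le> 1 \<and> \<bar>z - y\<bar> < d \<and> \<bar>z' - y\<bar> < d \<and> ?P z \<longrightarrow> ?P z'"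
      by (rule_tac exI[of _ s], rule_tac conjI[OF s(1)], intro allI impI, elim conjE)
  qed simp
  then obtain s where s: "s > 0"
    "\<forall>p\<in>U. \<forall>u. ?near p s \<and> 0 \<le> u \<and> u \<le> 1 \<and> u < 1 \<longrightarrow> \<bar>g (p, u) - g (p0, u)\<bar> < r"
    by (elim exE conjE)
  \<comment> \<open>The uniform estimate so far concerns the times before 1; time 1 itself is taken
    from the local estimate.\<close>
  from loc[OF zero_le_one order_refl] obtain s1 where s1: "s1 > 0"
    "\<forall>p\<in>U. \<forall>u. ?near p s1 \<and> 0 \<le> u \<and> u \<le> 1 \<and> \<bar>u - 1\<bar> < s1 \<longrightarrow> \<bar>g (p, u) - g (p0, u)\<bar> < r"
    by (elim exE conjE)
  let ?W = "{p \<in> U. \<forall>i<?d. \<bar>\<phi> p $ i - \<phi> p0 $ i\<bar> < min s s1}"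
  have "\<bar>g (p, u) - g (p0, u)\<bar> < r" if "p \<in> ?W" "0 \<le> u \<and> u \<le> 1" for p u
  proof (cases "u = 1")
    case True
    then have "?near p s1 \<and> 0 \<le> u \<and> u \<le> 1 \<and> \<bar>u - 1\<bar> < s1" using that s1(1) by simp
    then show ?thesis using s1(2) that(1) by blast
  next
    case False
    then have "?near p s \<and> 0 \<le> u \<and> u \<le> 1 \<and> u < 1" using that by simp
    then show ?thesis using s(2) that(1) by blast
  qed
  moreover have "openin (manifold_topology M) ?W" by (rule open_chart_box[OF man c(1)])
  moreover have "p0 \<in> ?W" using s(1) s1(1) c(2) by simp
  ultimately show ?thesis by blast
qed

text \<open>Local lower bounds propagate along [0,1], so the slice is bounded below and has a
  definable greatest lower bound m. If m were not attained, the slice would locally exceed m by a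
  positive amount; this propagates as well and yields a larger lower bound.\<close>

lemma icont_attains_min:
  assumes g: "icont S M g" and p: "p \<in> points M"
  shows "\<exists>u. 0 \<le> u \<and> u \<le> 1 \<and> (\<forall>u'. 0 \<le> u' \<and> u' \<le> 1 \<longrightarrow> g (p, u) \<le> g (p, u'))"
proof (rule ccontr)
  assume no: "\<not> ?thesis"
  have cont: "\<exists>s>0. \<forall>u. 0 \<le> u \<and> u \<le> 1 \<and> \<bar>u - u0\<bar> < s \<longrightarrow> \<bar>g (p, u) - g (p, u0)\<bar> < r"
    if u0: "0 \<le> u0" "u0 \<le> 1" and r: "r > 0" for u0 r
  proof -
    have "continuous_map (cylinder_topology M) euclidean g" using g by (simp add: dcont_def)
    from fun1_eps[OF this _ u0 r, of p]
    obtain W s where W: "p \<in> W" "s > 0"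
      "\<forall>p'\<in>W. \<forall>u. 0 \<le> u \<and> u \<le> 1 \<and> \<bar>u - u0\<bar> < s \<longrightarrow> \<bar>g (p', u) - g (p, u0)\<bar> < r"
      using p unfolding topspace_manifold_topology[OF man] by (elim meta_impE exE conjE) simp_all
    then show ?thesis by blast
  qed
  note sl = slice_pred[OF g p]
  \<comment> \<open>Times are bounded strictly by \<open>b\<close>, so that the statement for b = 0
    is void and \<open>b = 2\<close> covers all of [0,1].\<close>
  let ?lb = "\<lambda>m b. \<forall>u. 0 \<le> u \<and> u \<le> 1 \<and> u < b \<longrightarrow> m \<le> g (p, u)"
  have dlb: "dpred S (\<lambda>e. ?lb (f e) (h e))" if f: "dfun S f" and h: "dfun S h" for f h
  proof -
    have "dpred S (\<lambda>e. \<forall>u. \<not> (u < h e \<and> (0 \<le> u \<and> u \<le> 1 \<and> g (p, u) < f e)))"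
    proof (rule dpred_all, rule dpred_not, rule dpred_conj)
      show "dpred S (\<lambda>e. e 0 < h (\<lambda>i. e (Suc i)))" by (intro dintros dfun_ren[OF h])
      show "dpred S (\<lambda>e. 0 \<le> e 0 \<and> e 0 \<le> 1 \<and> g (p, e 0) < f (\<lambda>i. e (Suc i)))"
        by (rule sl[where Q = "\<lambda>e z. z < f (\<lambda>i. e (Suc i))" and h = "\<lambda>e. e"])
          (intro dintros dfun_ren[OF f, of "\<lambda>i. Suc (Suc i)"])+
    qed
    then show ?thesis by (rule back_subst[of "dpred S"]) (rule ext, auto simp: not_less)
  qed
  have dpos: "dpred S (\<lambda>e. ?lb (e 0) 2)" by (intro dlb dintros)
  have lower: "\<exists>m. ?lb m 1"
  proof -
    have "\<exists>m. ?lb m b" if "b = 1" for b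
      unfolding that
    proof (rule definable_connected[OF om, of "\<lambda>b. \<exists>m. ?lb m b" 0])
      show "dpred S (\<lambda>e. \<exists>m. ?lb m (e 0))" by (rule dpred_ex) (intro dlb dintros)
      show "\<exists>m. ?lb m 0" by auto
      fix y :: 'a assume y: "0 \<le> y" "y \<le> 1"
      obtain s where s: "s > 0" "\<And>u. 0 \<le> u \<Longrightarrow> u \<le> 1 \<Longrightarrow> \<bar>u - y\<bar> < s \<Longrightarrow> \<bar>g (p, u) - g (p, y)\<bar> < 1"
        using cont[OF y, of 1] by auto
      have "\<exists>m. ?lb m z'" if z: "\<bar>z - y\<bar> < s" "\<bar>z' - y\<bar> < s" "\<exists>m. ?lb m z" for z z'
      proof -
        obtain m where m: "?lb m z" using z(3) by blast
        have "min m (g (p, y) - 1) \<le> g (p, u)" if u: "0 \<le> u \<and> u \<le> 1 \<and> u < z'" for u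
        proof (cases "u < z")
          case True
          then show ?thesis using m u by (simp add: min.coboundedI1)
        next
          case False
          then have "\<bar>u - y\<bar> < s" using z u unfolding abs_diff_less_iff by linarith
          then have "\<bar>g (p, u) - g (p, y)\<bar> < 1" using s(2) u by blast
          then show ?thesis by (simp add: abs_diff_less_iff min.coboundedI2)
        qed
        then show ?thesis by blast
      qed
      then show "\<exists>d>0. \<forall>z z'. 0 \<le> z \<and> z \<le> 1 \<and> 0 \<le> z' \<and> z' \<le> 1 \<and> \<bar>z - y\<bar> < d \<and> \<bar>z' - y\<bar> < d \<and> (\<exists>m. ?lb m z) \<longrightarrow> (\<exists>m. ?lb m z')"
        using s(1) by blast
    qed simp
    then show ?thesis by blast
  qed
  have lb2: "?lb (min m (g (p, 1))) 2" if "?lb m 1" for m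
  proof (intro allI impI)
    fix u assume "0 \<le> u \<and> u \<le> 1 \<and> u < (2::'a)"
    then show "min m (g (p, 1)) \<le> g (p, u)"
      using that by (cases "u = 1") (auto simp: min.coboundedI1)
  qed
  obtain m0 where "?lb m0 2" using lower lb2 by blast
  moreover have "a \<le> g (p, 0)" if "?lb a 2" for a
    using spec[OF that, of 0] by simp
  ultimately obtain m where s: "\<And>a. ?lb a 2 \<Longrightarrow> a \<le> m" "\<And>c. c < m \<Longrightarrow> \<exists>a>c. ?lb a 2"
    using definable_sup[OF om dpos, of m0 "g (p, 0)"] by blast
  have m: "m \<le> g (p, u)" if "0 \<le> u" "u \<le> 1" for u
  proof (rule ccontr)
    assume "\<not> m \<le> g (p, u)"
    then obtain a where "a > g (p, u)" "?lb a 2" using s(2)[of "g (p, u)"] by auto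
    moreover have "u < 2" using that(2) by (simp add: le_less_trans)
    ultimately show False using that by (meson leD)
  qed
  have strict: "m < g (p, u)" if "0 \<le> u" "u \<le> 1" for u
    using no m that by (metis le_less)
  let ?P = "\<lambda>b. \<exists>s>0. ?lb (m + s) b"
  have "?P 1"
  proof (rule definable_connected[OF om, of ?P 0])
    show "dpred S (\<lambda>e. ?P (e 0))" by (rule dpred_ex, rule dpred_conj) (intro dlb dintros)+
    show "?P 0" by (intro exI[of _ 1]) auto
    fix y :: 'a assume y: "0 \<le> y" "y \<le> 1"
    have pos: "(g (p, y) - m) / 2 > 0" using strict[OF y] by simp
    then obtain s where s: "s > 0" "\<And>u. 0 \<le> u \<Longrightarrow> u \<le> 1 \<Longrightarrow> \<bar>u - y\<bar> < s \<Longrightarrow> \<bar>g (p, u) - g (p, y)\<bar> < (g (p, y) - m) / 2"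
      using cont[OF y pos] by blast
    have "?P z'" if z: "\<bar>z - y\<bar> < s" "\<bar>z' - y\<bar> < s" "?P z" for z z'
    proof -
      obtain t where t: "t > 0" "?lb (m + t) z" using z(3) by blast
      have "m + min t ((g (p, y) - m) / 2) \<le> g (p, u)" if u: "0 \<le> u \<and> u \<le> 1 \<and> u < z'" for u
      proof (cases "u < z")
        case True
        then have "m + t \<le> g (p, u)" using t u by blast
        moreover have "min t ((g (p, y) - m) / 2) \<le> t" by simp
        ultimately show ?thesis by linarith
      next
        case False
        then have "\<bar>u - y\<bar> < s" using z u unfolding abs_diff_less_iff by linarith
        then have "\<bar>g (p, u) - g (p, y)\<bar> < (g (p, y) - m) / 2" using s(2) u by blast
        then have "g (p, y) - (g (p, y) - m) / 2 < g (p, u)" unfolding abs_diff_less_iff by (rule conjunct1)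
        moreover have "g (p, y) - (g (p, y) - m) / 2 = m + (g (p, y) - m) / 2" by (simp add: field_simps)
        ultimately have "m + (g (p, y) - m) / 2 < g (p, u)" by simp
        moreover have "min t ((g (p, y) - m) / 2) \<le> (g (p, y) - m) / 2" by (rule min.cobounded2)
        ultimately show ?thesis by linarith
      qed
      then show ?thesis using t(1) pos by (intro exI[of _ "min t ((g (p, y) - m) / 2)"]) simp
    qed
    then show "\<exists>d>0. \<forall>z z'. 0 \<le> z \<and> z \<le> 1 \<and> 0 \<le> z' \<and> z' \<le> 1 \<and> \<bar>z - y\<bar> < d \<and> \<bar>z' - y\<bar> < d \<and> ?P z \<longrightarrow> ?P z'"
      using s(1) by blast
  qed simp
  then obtain t where t: "t > 0" "?lb (m + t) 1" by blast
  \<comment> \<open>Also accounts for time 1, which \<open>?lb (m + t) 1\<close> leaves out.\<close>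
  define t' where "t' = min t (g (p, 1) - m)"
  have t': "t' > 0" "m + t' \<le> m + t" "m + t' \<le> g (p, 1)" using t(1) strict[of 1] by (auto simp: t'_def min_def)
  have "?lb (m + t') 2"
  proof (intro allI impI)
    fix u assume u: "0 \<le> u \<and> u \<le> 1 \<and> u < (2::'a)"
    show "m + t' \<le> g (p, u)"
    proof (cases "u = 1")
      case True
      then show ?thesis using t'(3) by simp
    next
      case False
      then have "m + t \<le> g (p, u)" using t(2) u by simp
      then show ?thesis using t'(2) by linarith
    qed
  qed
  then have "m + t' \<le> m" by (rule s(1))
  then show False using t'(1) by simp
qed

text \<open>The minimal value is recorded and not a time at which it is attained: minimisers need be
  neither unique nor continuous in p.\<close>

definition imin :: "('m \<times> 'a \<Rightarrow> 'a) \<Rightarrow> 'm \<Rightarrow> 'a" where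
  "imin g p = (THE m. \<exists>u. 0 \<le> u \<and> u \<le> 1 \<and> m = g (p, u) \<and> (\<forall>u'. 0 \<le> u' \<and> u' \<le> 1 \<longrightarrow> m \<le> g (p, u')))"

lemma imin_unique:
  assumes g: "icont S M g" and p: "p \<in> points M"
  shows "(\<exists>u. 0 \<le> u \<and> u \<le> 1 \<and> m = g (p, u) \<and> (\<forall>u'. 0 \<le> u' \<and> u' \<le> 1 \<longrightarrow> m \<le> g (p, u'))) \<longleftrightarrow> m = imin g p"
proof -
  have ex1: "\<exists>!m. \<exists>u. 0 \<le> u \<and> u \<le> 1 \<and> m = g (p, u) \<and> (\<forall>u'. 0 \<le> u' \<and> u' \<le> 1 \<longrightarrow> m \<le> g (p, u'))"
  proof -
    obtain u where "0 \<le> u \<and> u \<le> 1 \<and> (\<forall>u'. 0 \<le> u' \<and> u' \<le> 1 \<longrightarrow> g (p, u) \<le> g (p, u'))"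
      using icont_attains_min[OF g p] by blast
    then show ?thesis by (intro ex1I[of _ "g (p, u)"]) (blast, force intro: antisym)
  qed
  show ?thesis using theI'[OF ex1] ex1 unfolding imin_def[symmetric] by blast
qed

lemma imin:
  assumes g: "icont S M g" and p: "p \<in> points M"
  shows "\<exists>u. 0 \<le> u \<and> u \<le> 1 \<and> imin g p = g (p, u)" "\<And>u. 0 \<le> u \<Longrightarrow> u \<le> 1 \<Longrightarrow> imin g p \<le> g (p, u)"
  using imin_unique[OF assms, of "imin g p"] by blast+

text \<open>Over nearby points the slices differ by less than r uniformly in time, so their minima
  differ by less than r.\<close>

lemma mcont_imin:
  assumes g: "icont S M g"
  shows "mcont S M (imin g)"
proof (rule mcontI)
  show "continuous_map (manifold_topology M) euclidean (imin g)"
    unfolding continuous_map_eps topspace_manifold_topology[OF man]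
  proof (intro ballI allI impI)
    fix p0 and r :: 'a assume p0: "p0 \<in> points M" and r: "r > 0"
    from icont_uniform[OF g p0 r] obtain W where W: "openin (manifold_topology M) W" "p0 \<in> W"
      "\<forall>p\<in>W. \<forall>u. 0 \<le> u \<and> u \<le> 1 \<longrightarrow> \<bar>g (p, u) - g (p0, u)\<bar> < r"
      by (elim exE conjE)
    have "\<bar>imin g p - imin g p0\<bar> < r" if "p \<in> W" for p
    proof -
      have p: "p \<in> points M"
        using openin_subset[OF W(1)] that topspace_manifold_topology[OF man] by auto
      obtain u where u: "0 \<le> u" "u \<le> 1" "imin g p = g (p, u)" using imin(1)[OF g p] by blast
      obtain u0 where u0: "0 \<le> u0" "u0 \<le> 1" "imin g p0 = g (p0, u0)" using imin(1)[OF g p0] by blast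
      have "imin g p \<le> g (p, u0)" "imin g p0 \<le> g (p0, u)"
        using imin(2)[OF g p] imin(2)[OF g p0] u u0 by auto
      moreover have "\<bar>g (p, u) - g (p0, u)\<bar> < r" "\<bar>g (p, u0) - g (p0, u0)\<bar> < r" using W(3) that u u0 by blast+
      ultimately show ?thesis using u(3) u0(3) unfolding abs_diff_less_iff by linarith
    qed
    then show "\<exists>W. openin (manifold_topology M) W \<and> p0 \<in> W \<and> (\<forall>y\<in>W. \<bar>imin g y - imin g p0\<bar> < r)"
      using W by blast
  qed
  fix U \<phi> assume c: "(U, \<phi>) \<in> charts M"
  note cf = chart_facts[OF man c]
  let ?d = "mdim M" and ?c = "ichart M (U, \<phi>)"
  have pg: "dfun S (pull ?c g)" using g c by (auto simp: dcont_def)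
  have up: "dfun S (\<lambda>e. pull ?c g ((h e)(?d := f e)))" if "\<And>i. dfun S (\<lambda>e. h e i)" "dfun S f" for h f
  proof (rule dfun_subst[OF pg])
    show "dfun S (\<lambda>e. ((h e)(?d := f e)) i)" for i using that by (cases "i = ?d") auto
  qed
  show "dfun S (pull (mchart M (U, \<phi>)) (imin g))"
  proof (rule dfun_graph)
    let ?T = "\<lambda>e :: nat \<Rightarrow> 'a. \<lambda>i. e (Suc i)"
    show "dpred S (\<lambda>e. (vec ?d (?T e) \<in> \<phi> ` U \<longrightarrow> (\<exists>u. 0 \<le> u \<and> u \<le> 1 \<and> e 0 = pull ?c g ((?T e)(?d := u)) \<and>
        (\<forall>u'. 0 \<le> u' \<and> u' \<le> 1 \<longrightarrow> e 0 \<le> pull ?c g ((?T e)(?d := u'))))) \<and>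
        (\<not> vec ?d (?T e) \<in> \<phi> ` U \<longrightarrow> e 0 = 0))"
      by (intro dintros up dpred_ren[OF cf(4)])
    show "((vec ?d e \<in> \<phi> ` U \<longrightarrow> (\<exists>u. 0 \<le> u \<and> u \<le> 1 \<and> a = pull ?c g (e(?d := u)) \<and>
        (\<forall>u'. 0 \<le> u' \<and> u' \<le> 1 \<longrightarrow> a \<le> pull ?c g (e(?d := u'))))) \<and>
        (\<not> vec ?d e \<in> \<phi> ` U \<longrightarrow> a = 0)) \<longleftrightarrow> a = pull (mchart M (U, \<phi>)) (imin g) e" for e a
    proof (cases "vec ?d e \<in> \<phi> ` U")
      case True
      let ?p = "inv_into U \<phi> (vec ?d e)"
      have p: "?p \<in> points M" by (rule subsetD[OF cf(2) inv_into_into[OF True]])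
      have "pull ?c g (e(?d := u)) = g (?p, u)" if "0 \<le> u" "u \<le> 1" for u
        by (rule pull_ichart_upd[OF refl True that])
      then have "(\<exists>u. 0 \<le> u \<and> u \<le> 1 \<and> a = pull ?c g (e(?d := u)) \<and>
          (\<forall>u'. 0 \<le> u' \<and> u' \<le> 1 \<longrightarrow> a \<le> pull ?c g (e(?d := u')))) \<longleftrightarrow>
        (\<exists>u. 0 \<le> u \<and> u \<le> 1 \<and> a = g (?p, u) \<and> (\<forall>u'. 0 \<le> u' \<and> u' \<le> 1 \<longrightarrow> a \<le> g (?p, u')))" by metis
      also have "\<dots> \<longleftrightarrow> a = imin g ?p" by (rule imin_unique[OF g p])
      finally show ?thesis unfolding pull_mchart by (simp only: True simp_thms if_True)
    next
      case False
      then show ?thesis unfolding pull_mchart by (simp only: simp_thms if_False)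
    qed
  qed
qed

lemma icont_fst: "mcont S M f \<Longrightarrow> icont S M (\<lambda>z. f (fst z))"
  unfolding dcont_def
proof (intro conjI ballI, goal_cases)
  case 1
  show ?case
    using continuous_map_compose[OF continuous_map_fst conjunct1[OF 1], of "top_of_set {0..1}"] by (simp add: comp_def)
next
  case (2 c)
  then obtain U \<phi> where c: "c = ichart M (U, \<phi>)" "(U, \<phi>) \<in> charts M" by auto
  have "pull c (\<lambda>z. f (fst z)) = (\<lambda>e. if 0 \<le> e (mdim M) \<and> e (mdim M) \<le> 1 then pull (mchart M (U, \<phi>)) f e else 0)"
    by (auto simp: c pull_def ichart_def mchart_def fun_eq_iff)
  moreover have "dfun S (\<lambda>e. if 0 \<le> e (mdim M) \<and> e (mdim M) \<le> 1 then pull (mchart M (U, \<phi>)) f e else 0)"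
    using 2 c(2) by (intro dintros) auto
  ultimately show ?case by simp
qed

lemma icont_snd: "icont S M snd"
  unfolding dcont_def
proof (intro conjI ballI, goal_cases)
  case 1
  have "continuous_map (cylinder_topology M) (top_of_set {0..1}) snd" by (rule continuous_map_snd)
  then show ?case using continuous_map_into_fulltopology by blast
next
  case (2 c)
  then obtain U \<phi> where c: "c = ichart M (U, \<phi>)" "(U, \<phi>) \<in> charts M" by auto
  have "pull c snd = (\<lambda>e. if vec (mdim M) e \<in> \<phi> ` U \<and> 0 \<le> e (mdim M) \<and> e (mdim M) \<le> 1 then e (mdim M) else 0)"
    by (auto simp: c pull_def ichart_def fun_eq_iff)
  moreover have "dfun S (\<lambda>e. if vec (mdim M) e \<in> \<phi> ` U \<and> 0 \<le> e (mdim M) \<and> e (mdim M) \<le> 1 then e (mdim M) else 0)"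
    by (intro dintros chart_facts(4)[OF man c(2)])
  ultimately show ?case by simp
qed

lemma icont_comp:
  assumes g: "icont S M g" and h: "icont S M h"
    and range: "\<And>p u. p \<in> points M \<Longrightarrow> 0 \<le> u \<Longrightarrow> u \<le> 1 \<Longrightarrow> 0 \<le> h (p, u) \<and> h (p, u) \<le> 1"
  shows "icont S M (\<lambda>z. g (fst z, h z))"
  unfolding dcont_def
proof (intro conjI ballI, goal_cases)
  case 1
  have "continuous_map (cylinder_topology M) (top_of_set {0..1}) h"
    using h range unfolding dcont_def continuous_map_in_subtopology topspace_cylinder[OF man] by auto
  then have "continuous_map (cylinder_topology M) (cylinder_topology M) (\<lambda>z. (fst z, h z))"
    by (intro continuous_map_pairedI continuous_map_fst)
  from continuous_map_compose[OF this, where g = g] show ?case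
    using g by (simp add: dcont_def comp_def)
next
  case (2 c)
  then obtain U \<phi> where c: "c = ichart M (U, \<phi>)" "(U, \<phi>) \<in> charts M" by auto
  let ?d = "mdim M"
  let ?G = "\<lambda>e. vec ?d e \<in> \<phi> ` U \<and> 0 \<le> e ?d \<and> e ?d \<le> 1"
  have pg: "dfun S (pull c g)" "dfun S (pull c h)" using g h 2 by (auto simp: dcont_def)
  have "dfun S (\<lambda>e. pull c g (e(?d := pull c h e)))"
  proof (rule dfun_subst[OF pg(1)])
    show "dfun S (\<lambda>e. (e(?d := pull c h e)) i)" for i using pg(2) by (cases "i = ?d") (auto intro: dfun_var)
  qed
  then have "dfun S (\<lambda>e. if ?G e then pull c g (e(?d := pull c h e)) else 0)"
    by (intro dintros chart_facts(4)[OF man c(2)])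
  moreover have "(\<lambda>e. if ?G e then pull c g (e(?d := pull c h e)) else 0) = pull c (\<lambda>z. g (fst z, h z))"
  proof
    fix e
    show "(if ?G e then pull c g (e(?d := pull c h e)) else 0) = pull c (\<lambda>z. g (fst z, h z)) e"
    proof (cases "?G e")
      case True
      let ?p = "inv_into U \<phi> (vec ?d e)"
      have p: "?p \<in> points M"
        by (rule subsetD[OF chart_facts(2)[OF man c(2)] inv_into_into[OF conjunct1[OF True]]])
      have h: "pull c h e = h (?p, e ?d)" unfolding c(1) pull_ichart by (simp only: True simp_thms if_True)
      then have "pull c g (e(?d := pull c h e)) = g (?p, h (?p, e ?d))"
        unfolding c(1) h[unfolded c(1)]
      proof (intro pull_ichart_upd)
        show "vec ?d e \<in> \<phi> ` U" using True by (rule conjunct1)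
        show "0 \<le> h (?p, e ?d)" "h (?p, e ?d) \<le> 1" using range[OF p, of "e ?d"] True by blast+
      qed (rule refl)
      then show ?thesis unfolding c(1) pull_ichart by (simp only: True simp_thms if_True fst_conv)
    next
      case False
      then show ?thesis unfolding c(1) pull_ichart by (simp only: if_False)
    qed
  qed
  ultimately show ?case by simp
qed

text \<open>As a function on the cylinder, \<open>g (p, s p)\<close> is constant in time, so it
  coincides with its minimum over time, which is continuous and definable on M.\<close>

lemma mcont_comp:
  assumes g: "icont S M g" and s: "mcont S M s"
    and range: "\<And>p. p \<in> points M \<Longrightarrow> 0 \<le> s p \<and> s p \<le> 1"
  shows "mcont S M (\<lambda>p. g (p, s p))"
proof -
  have "icont S M (\<lambda>z. g (fst z, s (fst z)))"
    by (rule icont_comp[OF g icont_fst[OF s]]) (simp add: range)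
  from mcont_imin[OF this] have "mcont S M (imin (\<lambda>z. g (fst z, s (fst z))))" .
  moreover have "mcont S M (imin (\<lambda>z. g (fst z, s (fst z)))) \<longleftrightarrow> mcont S M (\<lambda>p. g (p, s p))"
  proof (rule dcont_cong[OF definable_charts_manifold[OF man]])
    fix p assume "p \<in> topspace (manifold_topology M)"
    then have "p \<in> points M" using topspace_manifold_topology[OF man] by simp
    from imin(1)[OF \<open>icont S M (\<lambda>z. g (fst z, s (fst z)))\<close> this]
    show "imin (\<lambda>z. g (fst z, s (fst z))) p = g (p, s p)" unfolding fst_conv by (elim exE conjE)
  qed
  ultimately show ?thesis by (rule iffD1[rotated])
qed

end

section \<open>Continuous subdivisions of the interval\<close>

context
  fixes S :: "('f, 'p, 'a::real_closed_field) expansion" and M :: "('m, 'a) manifold" and k :: nat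
  assumes om: "o_minimal S" and man: "definable_Cr_manifold S k M"
begin

text \<open>The least level above \<open>x\<close> exceeds \<open>x\<close> by at most one mesh 1/m,
  hence is at most \<open>y\<close>; it exists because the last level, 1, is already above
  \<open>x\<close>.\<close>

lemma crossed_level:
  fixes x y :: "'a::real_closed_field"
  assumes "\<bar>x\<bar> \<le> 1" "\<bar>y\<bar> \<le> 1" "x + 1 / of_nat m \<le> y" "0 < m"
  shows "\<exists>l\<le>2 * m. x < -1 + of_nat l / of_nat m \<and> -1 + of_nat l / of_nat m \<le> y"
proof -
  let ?v = "\<lambda>l. -1 + of_nat l / (of_nat m :: 'a)"
  define l where "l = (LEAST l. x < ?v l)"
  have m: "(of_nat m :: 'a) > 0" using assms(4) by simp
  have two: "?v (2 * m) = 1" using m by simp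
  have "0 < 1 / (of_nat m :: 'a)" "y \<le> 1" using m assms(2) by (simp_all add: abs_le_iff)
  then have "x < ?v (2 * m)" unfolding two using assms(3) by linarith
  then have l: "x < ?v l" "l \<le> 2 * m"
    unfolding l_def by (rule LeastI, rule Least_le)
  have "?v 0 \<le> x" using assms(1) by (simp add: abs_le_iff minus_le_iff)
  then have "l \<noteq> 0" using l(1) by (metis leD)
  then obtain l' where l': "l = Suc l'" using not0_implies_Suc by blast
  then have "\<not> x < ?v l'" using not_less_Least[of l' "\<lambda>l. x < ?v l"] unfolding l_def[symmetric] by simp
  then have "?v l' \<le> x" by simp
  moreover have "?v l = ?v l' + 1 / of_nat m" by (simp add: l' add_divide_distrib)
  ultimately have "?v l \<le> y" using assms(3) by linarith
  then show ?thesis using l by blast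
qed

text \<open>The points where some \<open>f l (p, \<sqdot>)\<close> crosses one of finitely many levels; uniform finiteness bounds
  their number independently of \<open>p\<close>.\<close>

lemma bounded_crossings:
  fixes f :: "'l \<Rightarrow> 'm \<times> 'a \<Rightarrow> 'a"
  assumes L: "finite L" and f: "\<And>l. l \<in> L \<Longrightarrow> icont S M (f l)"
    and bd: "\<And>l p u. l \<in> L \<Longrightarrow> p \<in> points M \<Longrightarrow> 0 \<le> u \<Longrightarrow> u \<le> 1 \<Longrightarrow> \<bar>f l (p, u)\<bar> \<le> 1"
    and m: "0 < (m::nat)"
  shows "\<exists>K. \<forall>p\<in>points M. \<exists>Z. finite Z \<and> card Z \<le> K \<and>
    (\<forall>l\<in>L. \<forall>s u. 0 \<le> s \<and> s \<le> u \<and> u \<le> 1 \<and> 1 / of_nat m \<le> \<bar>f l (p, u) - f l (p, s)\<bar> \<longrightarrow> (\<exists>z\<in>Z. s \<le> z \<and> z \<le> u))"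
proof -
  let ?d = "mdim M"
  have fin_charts: "finite (charts M)" using man unfolding definable_Cr_manifold_def by (elim conjE)
  define P where "P c l i e t \<longleftrightarrow> 0 \<le> t \<and> t \<le> 1 \<and> pull (ichart M c) (f l) (e(?d := t)) < -1 + of_nat i / of_nat m" for c l i e t
  \<comment> \<open>The time is the fibre variable and the coordinates of the point are the
    parameters, the shape required by uniform finiteness.\<close>
  define A where "A c e t \<longleftrightarrow> (\<exists>l\<in>L. \<exists>i\<in>{..2 * m}. 0 \<le> t \<and> t \<le> 1 \<and> frontier_pt (P c l i e) t)" for c e t
  have dP: "dpred S (\<lambda>e. P c l i (h e) (g e))" if "c \<in> charts M" "l \<in> L" "\<And>i. dfun S (\<lambda>e. h e i)" "dfun S g" for c l i h g
  proof -
    have "dfun S (pull (ichart M c) (f l))" using f[OF that(2)] that(1) by (auto simp: dcont_def)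
    moreover have "dfun S (\<lambda>e. ((h e)(?d := g e)) i)" for i using that(3,4) by (cases "i = ?d") auto
    ultimately have "dfun S (\<lambda>e. pull (ichart M c) (f l) ((h e)(?d := g e)))" by (rule dfun_subst)
    then show ?thesis unfolding P_def using that(4) by (intro dintros)
  qed
  have "\<exists>K. \<forall>e. card {t. A c e t} \<le> K" if c: "c \<in> charts M" for c
  proof (rule uniform_finiteness[OF om])
    show "dpred S (\<lambda>e. A c (\<lambda>i. e (Suc i)) (e 0))"
      unfolding A_def frontier_pt_def using L
      by (intro dpred_fin_Bex dpred_conj) (intro finite_atMost dintros dP c | assumption)+
    have "finite {t. frontier_pt (P c l i e) t}" if "l \<in> L" for l i e
      by (rule finite_frontier[OF om]) (intro dP c that dintros)
    then have "finite (\<Union>l\<in>L. \<Union>i\<in>{..2 * m}. {t. frontier_pt (P c l i e) t})" for e using L by blast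
    moreover have "{t. A c e t} \<subseteq> (\<Union>l\<in>L. \<Union>i\<in>{..2 * m}. {t. frontier_pt (P c l i e) t})" for e
      unfolding A_def by blast
    ultimately show "finite {t. A c e t}" for e by (meson finite_subset)
    show "0 \<le> t \<and> t \<le> 1" if "A c e t" for e t using that unfolding A_def by blast
  qed
  then obtain K where K: "\<And>c e. c \<in> charts M \<Longrightarrow> card {t. A c e t} \<le> K c" by metis
  have finA: "finite {t. A c e t}" if c: "c \<in> charts M" for c e
  proof -
    have "finite {t. frontier_pt (P c l i e) t}" if "l \<in> L" for l i
      by (rule finite_frontier[OF om]) (intro dP c that dintros)
    then have "finite (\<Union>l\<in>L. \<Union>i\<in>{..2 * m}. {t. frontier_pt (P c l i e) t})" using L by blast
    moreover have "{t. A c e t} \<subseteq> (\<Union>l\<in>L. \<Union>i\<in>{..2 * m}. {t. frontier_pt (P c l i e) t})"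
      unfolding A_def by blast
    ultimately show ?thesis by (meson finite_subset)
  qed
  show ?thesis
  \<comment> \<open>Each chart has its own bound; the sum is valid whichever chart contains the
    point.\<close>
  proof (intro exI[of _ "\<Sum>c\<in>charts M. K c"] ballI)
    fix p assume p: "p \<in> points M"
    obtain U \<phi> where c: "(U, \<phi>) \<in> charts M" "p \<in> U" using exists_chart[OF om man p] by blast
    note cf = chart_facts[OF man c(1)]
    define e where "e i = \<phi> p $ i" for i
    have "\<phi> p \<in> carrier_vec ?d" using cf(3) c(2) by blast
    then have ve: "vec ?d e = \<phi> p" by (auto simp: e_def)
    have pull: "pull (ichart M (U, \<phi>)) g (e(?d := t)) = g (p, t)" if "0 \<le> t" "t \<le> 1" for t and g :: "'m \<times> 'a \<Rightarrow> 'a"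
      by (rule pull_ichart_upd[OF _ _ that]) (use ve c(2) cf(1) in auto)
    have P: "P (U, \<phi>) l i e t \<longleftrightarrow> f l (p, t) < -1 + of_nat i / of_nat m" if "0 \<le> t" "t \<le> 1" for l i t
      using pull[OF that] that unfolding P_def by simp
    let ?Z = "{t. A (U, \<phi>) e t}"
    show "\<exists>Z. finite Z \<and> card Z \<le> (\<Sum>c\<in>charts M. K c) \<and>
      (\<forall>l\<in>L. \<forall>s u. 0 \<le> s \<and> s \<le> u \<and> u \<le> 1 \<and> 1 / of_nat m \<le> \<bar>f l (p, u) - f l (p, s)\<bar> \<longrightarrow> (\<exists>z\<in>Z. s \<le> z \<and> z \<le> u))"
    proof (rule exI[of _ ?Z], intro conjI ballI allI impI)
      show "finite ?Z" by (rule finA[OF c(1)])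
      have "card ?Z \<le> K (U, \<phi>)" by (rule K[OF c(1)])
      also have "\<dots> \<le> (\<Sum>c\<in>charts M. K c)" using c(1) fin_charts by (intro member_le_sum) auto
      finally show "card ?Z \<le> (\<Sum>c\<in>charts M. K c)" .
      fix l s u assume l: "l \<in> L" and su: "0 \<le> s \<and> s \<le> u \<and> u \<le> 1 \<and> 1 / of_nat m \<le> \<bar>f l (p, u) - f l (p, s)\<bar>"
      have su1: "0 \<le> s" "s \<le> 1" "0 \<le> u" "u \<le> 1" using su by auto
      have b: "\<bar>f l (p, s)\<bar> \<le> 1" "\<bar>f l (p, u)\<bar> \<le> 1" using bd[OF l p] su1 by auto
      have "f l (p, s) + 1 / of_nat m \<le> f l (p, u) \<or> f l (p, u) + 1 / of_nat m \<le> f l (p, s)"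
        using su by (auto simp: abs_if split: if_splits)
      then obtain i where i: "i \<le> 2 * m" "P (U, \<phi>) l i e s \<noteq> P (U, \<phi>) l i e u"
        using crossed_level[OF b _ m] crossed_level[OF b(2,1) _ m] P[OF su1(1,2)] P[OF su1(3,4)] by (metis leD)
      have "dpred S (\<lambda>e'. P (U, \<phi>) l i e (e' 0))" by (intro dP c l dintros)
      then obtain z where z: "s \<le> z" "z \<le> u" "frontier_pt (P (U, \<phi>) l i e) z"
        using frontier_between[OF om _ _ i(2)] su by blast
      have "0 \<le> z" "z \<le> 1" using z su by auto
      then have "A (U, \<phi>) e z" unfolding A_def using z(3) l i(1) by blast
      then show "\<exists>z\<in>?Z. s \<le> z \<and> z \<le> u" using z by blast
    qed
  qed
qed

text \<open>Sums of squares, because for the entries of a matrix this is the squared Frobenius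
  distance, which the polarisation argument bounds by 2.\<close>

definition deviation :: "'l set \<Rightarrow> ('l \<Rightarrow> 'm \<times> 'a \<Rightarrow> 'a) \<Rightarrow> 'm \<Rightarrow> 'a \<Rightarrow> 'a \<Rightarrow> 'a" where
  "deviation L f p s u = (\<Sum>l\<in>L. (f l (p, u) - f l (p, s)) * (f l (p, u) - f l (p, s)))"

text \<open>The first time \<open>u \<ge> s p\<close> at which \<open>u - s p\<close> plus the deviation from \<open>s p\<close> reaches \<open>1\<close> (or \<open>1\<close> itself),
  written as a minimum over \<open>[0,1]\<close>; the term \<open>u - s p\<close> makes it depend continuously on \<open>p\<close>.\<close>

definition next_time :: "'l set \<Rightarrow> ('l \<Rightarrow> 'm \<times> 'a \<Rightarrow> 'a) \<Rightarrow> ('m \<Rightarrow> 'a) \<Rightarrow> 'm \<Rightarrow> 'a" where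
  "next_time L f s = imin (\<lambda>z. min 1 (max (max (snd z) (s (fst z)))
     (s (fst z) + 1 - deviation L f (fst z) (s (fst z)) (max (snd z) (s (fst z))))))"

context
  fixes L :: "'l set" and f :: "'l \<Rightarrow> 'm \<times> 'a \<Rightarrow> 'a" and s :: "'m \<Rightarrow> 'a"
  assumes f: "\<And>l. l \<in> L \<Longrightarrow> icont S M (f l)" and s: "mcont S M s"
    and range: "\<And>p. p \<in> points M \<Longrightarrow> 0 \<le> s p \<and> s p \<le> 1"
begin

lemma icont_next_time:
  "icont S M (\<lambda>z. min 1 (max (max (snd z) (s (fst z)))
     (s (fst z) + 1 - deviation L f (fst z) (s (fst z)) (max (snd z) (s (fst z))))))"
proof -
  note C = definable_charts_cylinder[OF man]
  have s': "icont S M (\<lambda>z. s (fst z))" by (rule icont_fst[OF om man s])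
  have mx: "icont S M (\<lambda>z. max (snd z) (s (fst z)))"
    by (intro dcont_max[OF C] icont_snd[OF om man] s')
  have 1: "icont S M (\<lambda>z. f l (fst z, s (fst z)))" if "l \<in> L" for l
    by (rule icont_comp[OF om man f[OF that] s']) (use range in auto)
  have 2: "icont S M (\<lambda>z. f l (fst z, max (snd z) (s (fst z))))" if "l \<in> L" for l
    by (rule icont_comp[OF om man f[OF that] mx]) (use range in \<open>auto simp: le_max_iff_disj\<close>)
  show ?thesis
    unfolding deviation_def
    by (intro dcont_min[OF C] dcont_max[OF C] dcont_minus[OF C] dcont_plus[OF C] dcont_times[OF C] dcont_sum[OF C]
        dcont_const[OF C] mx s' 1 2)
qed

lemma mcont_next_time: "mcont S M (next_time L f s)"
  unfolding next_time_def by (rule mcont_imin[OF om man icont_next_time])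

text \<open>Write t for the minimum and D for the deviation from \<open>s p\<close>. A time v with
  \<open>s p \<le> v < t\<close> satisfies \<open>t \<le> max v (s p + 1 - D v)\<close>, which
  forces D v \<le> 1; by continuity D t < 2. If t < 1, the time v \<ge> s p realising the minimum
  has v \<le> t and (t - s p) + D v \<ge> 1, so one of the two summands is at least 1/2.\<close>

lemma next_time:
  assumes p: "p \<in> points M"
  shows "s p \<le> next_time L f s p" "next_time L f s p \<le> 1"
    "deviation L f p (s p) (next_time L f s p) < 2"
    "next_time L f s p < 1 \<Longrightarrow> \<exists>u. s p \<le> u \<and> u \<le> next_time L f s p \<and>
       (1 / 2 \<le> u - s p \<or> 1 / 2 \<le> deviation L f p (s p) u)"
proof -
  let ?t = "next_time L f s p" and ?D = "deviation L f p (s p)"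
  note m = imin[OF om man icont_next_time p, folded next_time_def]
  have sp: "0 \<le> s p" "s p \<le> 1" using range[OF p] by auto
  obtain u where u: "0 \<le> u" "u \<le> 1" "?t = min 1 (max (max u (s p)) (s p + 1 - ?D (max u (s p))))"
    using m(1) by auto
  have low: "?t \<le> min 1 (max (max u (s p)) (s p + 1 - ?D (max u (s p))))" if "0 \<le> u" "u \<le> 1" for u
    using m(2)[OF that] by simp
  show st: "s p \<le> ?t" unfolding u(3) using sp by (simp add: le_max_iff_disj)
  show t1: "?t \<le> 1" unfolding u(3) by simp
  have D0: "?D (s p) = 0" by (simp add: deviation_def)
  have before: "?D v \<le> 1" if "s p \<le> v" "v < ?t" for v
  proof -
    have "?t \<le> max v (s p + 1 - ?D v)" using low[of v] that sp t1 by (simp add: max_absorb1)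
    then have "?t \<le> s p + 1 - ?D v" using that(2) by (simp add: le_max_iff_disj)
    then show ?thesis using st by linarith
  qed
  show "?D ?t < 2"
  proof (cases "?t = s p")
    case True
    then show ?thesis using D0 by simp
  next
    case False
    then have lt: "s p < ?t" using st by simp
    note C = definable_charts_cylinder[OF man]
    have s': "icont S M (\<lambda>z. s (fst z))" by (rule icont_fst[OF om man s])
    have 1: "icont S M (\<lambda>z. f l (fst z, s (fst z)))" if "l \<in> L" for l
      by (rule icont_comp[OF om man f[OF that] s']) (use range in auto)
    have "icont S M (\<lambda>z. f l (fst z, snd z))" if "l \<in> L" for l using f[OF that] by simp
    then have "icont S M (\<lambda>z. deviation L f (fst z) (s (fst z)) (snd z))"
      unfolding deviation_def
      by (intro dcont_sum[OF C] dcont_times[OF C] dcont_minus[OF C] 1)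
    then have "continuous_map (cylinder_topology M) euclidean (\<lambda>z. deviation L f (fst z) (s (fst z)) (snd z))"
      by (simp add: dcont_def)
    \<comment> \<open>Tolerance 1 is enough: slightly before \<open>?t\<close> the deviation is at
      most 1, so at \<open>?t\<close> it is below 2.\<close>
    from fun1_eps[OF this, of p ?t 1] obtain W d where W: "p \<in> W" "d > 0"
      "\<forall>p'\<in>W. \<forall>u. 0 \<le> u \<and> u \<le> 1 \<and> \<bar>u - ?t\<bar> < d \<longrightarrow> \<bar>deviation L f p' (s p') u - ?D ?t\<bar> < 1"
      using p sp st t1 topspace_manifold_topology[OF man] by auto
    define v where "v = max (s p) (?t - d / 2)"
    have v: "s p \<le> v" "v < ?t" "\<bar>v - ?t\<bar> < d" using lt W(2) by (auto simp: v_def max_def)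
    then have "\<bar>?D v - ?D ?t\<bar> < 1" using W(1,3) sp t1 by auto
    then show ?thesis using before[OF v(1,2)] unfolding abs_diff_less_iff by linarith
  qed
  assume t: "?t < 1"
  define v where "v = max u (s p)"
  have eq: "?t = max v (s p + 1 - ?D v)" using u(3) t by (simp add: v_def[symmetric] min_def split: if_splits)
  have v: "s p \<le> v" "v \<le> ?t" "s p + 1 - ?D v \<le> ?t" by (auto simp: v_def eq)
  show "\<exists>u. s p \<le> u \<and> u \<le> ?t \<and> (1 / 2 \<le> u - s p \<or> 1 / 2 \<le> ?D u)"
  proof (cases "1 / 2 \<le> ?D v")
    case True
    then show ?thesis using v by blast
  next
    case False
    have "(1::'a) = 1 / 2 + 1 / 2" by simp
    then have "1 / 2 \<le> ?t - s p" using False v(3) by linarith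
    then show ?thesis using st by blast
  qed
qed

end

text \<open>Any \<open>l0\<close> with \<open>f l0 = snd\<close> makes steps of length \<open>\<ge> 1/2\<close> visible as oscillations as well.\<close>

lemma continuous_subdivision:
  fixes f :: "'l \<Rightarrow> 'm \<times> 'a \<Rightarrow> 'a"
  assumes L: "finite L" and f: "\<And>l. l \<in> L \<Longrightarrow> icont S M (f l)"
    and bd: "\<And>l p u. l \<in> L \<Longrightarrow> p \<in> points M \<Longrightarrow> 0 \<le> u \<Longrightarrow> u \<le> 1 \<Longrightarrow> \<bar>f l (p, u)\<bar> \<le> 1"
    and l0: "l0 \<in> L" "f l0 = snd"
  shows "\<exists>K t. (\<forall>j. mcont S M (t j)) \<and> (\<forall>p\<in>points M. t 0 p = 0 \<and> t K p = 1 \<and>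
    (\<forall>j. 0 \<le> t j p \<and> t j p \<le> 1 \<and> deviation L f p (t j p) (t (Suc j) p) < 2))"
proof -
  define t where "t j = (next_time L f ^^ j) (\<lambda>_. 0)" for j
  have t0: "t 0 = (\<lambda>_. 0)" and tS: "t (Suc j) = next_time L f (t j)" for j by (auto simp: t_def)
  have mn: "mcont S M (next_time L f s)"
    and nt0: "\<And>p. p \<in> points M \<Longrightarrow> s p \<le> next_time L f s p \<and> next_time L f s p \<le> 1 \<and>
      deviation L f p (s p) (next_time L f s p) < 2 \<and> (next_time L f s p < 1 \<longrightarrow>
      (\<exists>u. s p \<le> u \<and> u \<le> next_time L f s p \<and> (1 / 2 \<le> u - s p \<or> 1 / 2 \<le> deviation L f p (s p) u)))"
    if s: "mcont S M s \<and> (\<forall>p\<in>points M. 0 \<le> s p \<and> s p \<le> 1)" for s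
  proof -
    have r: "0 \<le> s p \<and> s p \<le> 1" if "p \<in> points M" for p using s that by blast
    show "mcont S M (next_time L f s)"
      by (rule mcont_next_time[of L f s, OF f conjunct1[OF s] r])
    fix p assume p: "p \<in> points M"
    show "s p \<le> next_time L f s p \<and> next_time L f s p \<le> 1 \<and>
      deviation L f p (s p) (next_time L f s p) < 2 \<and> (next_time L f s p < 1 \<longrightarrow>
      (\<exists>u. s p \<le> u \<and> u \<le> next_time L f s p \<and> (1 / 2 \<le> u - s p \<or> 1 / 2 \<le> deviation L f p (s p) u)))"
      by (intro conjI impI next_time[of L f s p, OF f conjunct1[OF s] r p])
  qed
  have t: "mcont S M (t j) \<and> (\<forall>p\<in>points M. 0 \<le> t j p \<and> t j p \<le> 1)" for j
  proof (induction j)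
    case 0
    show ?case by (simp add: t0 dcont_const[OF definable_charts_manifold[OF man]])
  next
    case (Suc j)
    have "0 \<le> next_time L f (t j) p \<and> next_time L f (t j) p \<le> 1" if p: "p \<in> points M" for p
    proof -
      have "0 \<le> t j p" using Suc p by blast
      also have "\<dots> \<le> next_time L f (t j) p" using nt0[OF Suc p] by (rule conjunct1)
      finally show ?thesis using nt0[OF Suc p] by blast
    qed
    then show ?case unfolding tS using mn[OF Suc] by blast
  qed
  then have r: "mcont S M (t j)" "\<And>p. p \<in> points M \<Longrightarrow> 0 \<le> t j p \<and> t j p \<le> 1" for j by auto
  have nt: "t j p \<le> t (Suc j) p" "deviation L f p (t j p) (t (Suc j) p) < 2"
    "t (Suc j) p < 1 \<Longrightarrow> \<exists>u. t j p \<le> u \<and> u \<le> t (Suc j) p \<and> (1 / 2 \<le> u - t j p \<or> 1 / 2 \<le> deviation L f p (t j p) u)"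
    if "p \<in> points M" for p j
    using nt0[OF t that] unfolding tS by blast+
  \<comment> \<open>If every component moved by less than 1/m, the sum of the squares would be below
    \<open>card L / m\<close>, that is 1/2.\<close>
  define m where "m = 2 * card L"
  have cL: "card L \<ge> 1" using L l0(1) by (metis One_nat_def Suc_leI card_gt_0_iff empty_iff)
  have m: "0 < m" using cL by (simp add: m_def)
  have "\<exists>K. \<forall>p\<in>points M. \<exists>Z. finite Z \<and> card Z \<le> K \<and>
    (\<forall>l\<in>L. \<forall>s u. 0 \<le> s \<and> s \<le> u \<and> u \<le> 1 \<and> 1 / of_nat m \<le> \<bar>f l (p, u) - f l (p, s)\<bar> \<longrightarrow> (\<exists>z\<in>Z. s \<le> z \<and> z \<le> u))"
    by (rule bounded_crossings[OF L f bd m])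
  then obtain K where K: "\<forall>p\<in>points M. \<exists>Z. finite Z \<and> card Z \<le> K \<and>
    (\<forall>l\<in>L. \<forall>s u. 0 \<le> s \<and> s \<le> u \<and> u \<le> 1 \<and> 1 / of_nat m \<le> \<bar>f l (p, u) - f l (p, s)\<bar> \<longrightarrow> (\<exists>z\<in>Z. s \<le> z \<and> z \<le> u))"
    by (elim exE)
  have m2: "1 / of_nat m \<le> (1 / 2 :: 'a)" using cL by (simp add: m_def field_simps)
  have osc: "\<exists>l\<in>L. 1 / of_nat m \<le> \<bar>f l (p, u) - f l (p, v)\<bar>"
    if "1 / 2 \<le> u - v \<or> 1 / 2 \<le> deviation L f p v u" for p u v
    using that
  proof
    assume "1 / 2 \<le> u - v"
    then have "1 / of_nat m \<le> \<bar>f l0 (p, u) - f l0 (p, v)\<bar>" unfolding l0(2) using m2 by (simp add: abs_if)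
    then show ?thesis using l0(1) by blast
  next
    assume D: "1 / 2 \<le> deviation L f p v u"
    show ?thesis
    proof (rule ccontr)
      assume "\<not> ?thesis"
      then have small: "\<bar>f l (p, u) - f l (p, v)\<bar> < 1 / of_nat m" if "l \<in> L" for l using that by (auto simp: not_le)
      have "(f l (p, u) - f l (p, v)) * (f l (p, u) - f l (p, v)) < 1 / of_nat m" if "l \<in> L" for l
      proof -
        have "1 / (of_nat m :: 'a) \<le> 1" using m by (simp add: field_simps)
        have "\<bar>f l (p, u) - f l (p, v)\<bar> * \<bar>f l (p, u) - f l (p, v)\<bar> < 1 / of_nat m * 1"
          using small[OF that] \<open>1 / (of_nat m :: 'a) \<le> 1\<close> by (intro mult_strict_mono') auto
        then show ?thesis by simp
      qed
      then have "deviation L f p v u < (\<Sum>l\<in>L. 1 / of_nat m)"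
        unfolding deviation_def using L l0(1) by (intro sum_strict_mono) auto
      also have "\<dots> = 1 / 2" using cL by (simp add: m_def)
      finally show False using D by simp
    qed
  qed
  \<comment> \<open>Before 1 is reached, every step interval contains a point of \<open>Z\<close>.
    Adjacent intervals may share such a point at a common end, so only the intervals with even index
    0, 2, ..., 2K are used: they would give K + 1 distinct points, against
    \<open>card Z \<le> K\<close>.\<close>
  have end1: "t (2 * K + 2) p = 1" if p: "p \<in> points M" for p
  proof (rule ccontr)
    assume ne: "t (2 * K + 2) p \<noteq> 1"
    have mono: "t i p \<le> t j p" if "i \<le> j" for i j
      by (rule lift_Suc_mono_le[OF _ that]) (rule nt(1)[OF p])
    have lt1: "t j p < 1" if "j \<le> 2 * K + 2" for j
      using mono[OF that] r(2)[OF p, of "2 * K + 2"] ne by (auto simp: less_le)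
    from bspec[OF K p] obtain Z where Z: "finite Z" "card Z \<le> K"
      "\<forall>l\<in>L. \<forall>s u. 0 \<le> s \<and> s \<le> u \<and> u \<le> 1 \<and> 1 / of_nat m \<le> \<bar>f l (p, u) - f l (p, s)\<bar> \<longrightarrow> (\<exists>z\<in>Z. s \<le> z \<and> z \<le> u)"
      by (elim exE conjE)
    have step: "t j p < t (Suc j) p \<and> (\<exists>z\<in>Z. t j p \<le> z \<and> z \<le> t (Suc j) p)" if j: "Suc j \<le> 2 * K + 2" for j
    proof -
      obtain u where u: "t j p \<le> u" "u \<le> t (Suc j) p" "1 / 2 \<le> u - t j p \<or> 1 / 2 \<le> deviation L f p (t j p) u"
        using nt(3)[OF p lt1[OF j]] by blast
      obtain l where l: "l \<in> L" "1 / of_nat m \<le> \<bar>f l (p, u) - f l (p, t j p)\<bar>" using osc[OF u(3)] by blast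
      have "u \<le> 1" using u(2) lt1[OF j] by simp
      then have "0 \<le> t j p \<and> t j p \<le> u \<and> u \<le> 1 \<and> 1 / of_nat m \<le> \<bar>f l (p, u) - f l (p, t j p)\<bar>"
        using u(1) l(2) r(2)[OF p] by simp
      then obtain z where "z \<in> Z" "t j p \<le> z" "z \<le> u" using Z(3) l(1) by blast
      moreover have "u \<noteq> t j p" using u(3) by (auto simp: deviation_def)
      then have "t j p < t (Suc j) p" using u(1,2) by simp
      ultimately show ?thesis using u(2) by (meson order_trans)
    qed
    then obtain z where z: "\<And>j. Suc j \<le> 2 * K + 2 \<Longrightarrow> z j \<in> Z \<and> t j p \<le> z j \<and> z j \<le> t (Suc j) p" by metis
    have "z (2 * i) < z (2 * i')" if "i < i'" "i' \<le> K" for i i'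
    proof -
      have "z (2 * i) \<le> t (Suc (2 * i)) p" using z[of "2 * i"] that by simp
      also have "\<dots> < t (Suc (Suc (2 * i))) p" using step[of "Suc (2 * i)"] that by simp
      also have "\<dots> \<le> t (2 * i') p" by (rule mono) (use that in simp)
      also have "\<dots> \<le> z (2 * i')" using z[of "2 * i'"] that by simp
      finally show ?thesis .
    qed
    then have "inj_on (\<lambda>i. z (2 * i)) {..K}"
      by (intro inj_onI) (metis atMost_iff linorder_neqE_nat less_irrefl)
    moreover have "(\<lambda>i. z (2 * i)) ` {..K} \<subseteq> Z" using z by auto
    ultimately have "card {..K} \<le> card Z" by (rule card_inj_on_le[OF _ _ Z(1)])
    then show False using Z(2) by simp
  qed
  show ?thesis
    by (intro exI[of _ "2 * K + 2"] exI[of _ t]) (use r end1 nt(2) t0 in auto)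
qed

end

section \<open>Homotopies and Gram-Schmidt orthonormalisation\<close>

text \<open>Definability is given for the graph of the whole matrix; one entry is obtained by
  projecting away the others.\<close>

lemma icont_homotopy_entry:
  fixes S :: "('f, 'p, 'a::real_closed_field) expansion"
  assumes man: "definable_Cr_manifold S k M" and H: "definable_homotopy S M n H" and ij: "i < n" "j < n"
  shows "icont S M (\<lambda>z. H z $$ (i, j))"
  unfolding dcont_def
proof (intro conjI ballI)
  have l: "i * n + j < n * n"
  proof -
    have "i * n + j < Suc i * n" using ij by simp
    also have "\<dots> \<le> n * n" using ij by (intro mult_right_mono) auto
    finally show ?thesis .
  qed
  have fl: "flatten_mat n g $ (i * n + j) = g $$ (i, j)" for g :: "'a mat"
    using l ij by (simp add: flatten_mat_def)
  have "continuous_map (cylinder_topology M) (Rn (n * n)) (\<lambda>z. flatten_mat n (H z))"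
    using H unfolding definable_homotopy_def by (elim conjE)
  from continuous_map_compose[OF this continuous_map_Rn_component[OF l]]
  show "continuous_map (cylinder_topology M) euclidean (\<lambda>z. H z $$ (i, j))"
    by (simp add: comp_def fl)
  fix c assume "c \<in> ichart M ` charts M"
  then obtain U \<phi> where c: "c = ichart M (U, \<phi>)" "(U, \<phi>) \<in> charts M" by auto
  note cf = chart_facts[OF man c(2)]
  let ?d = "mdim M" and ?N = "n * n"
  let ?guard = "\<lambda>e. vec ?d e \<in> \<phi> ` U \<and> 0 \<le> e ?d \<and> e ?d \<le> 1"
  let ?X = "(\<lambda>(p, t). \<phi> p @\<^sub>v vec1 t @\<^sub>v flatten_mat n (H (p, t))) ` (U \<times> {0..1})"
  have dim: "\<phi> p @\<^sub>v vec1 t @\<^sub>v flatten_mat n (H (p, t)) \<in> carrier_vec (?d + (1 + ?N))" if "p \<in> U" for p t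
    by (intro append_carrier_vec) (use cf(3) that in \<open>auto simp: vec1_def flatten_mat_def\<close>)
  have "definable_set S (?d + 1 + ?N) ?X"
    using H c(2) unfolding definable_homotopy_def by fast
  then have X: "dpred S (\<lambda>e. vec (?d + 1 + ?N) e \<in> ?X)" by (simp add: definable_set_iff_dpred)
  have mem: "vec (?d + 1 + ?N) e \<in> ?X \<longleftrightarrow> ?guard e \<and>
      flatten_mat n (H (inv_into U \<phi> (vec ?d e), e ?d)) = vec ?N (\<lambda>l. e (Suc ?d + l))" for e
  proof -
    have v: "vec (?d + 1 + ?N) e = vec ?d e @\<^sub>v vec1 (e ?d) @\<^sub>v vec ?N (\<lambda>l. e (Suc ?d + l))"
    proof (rule eq_vecI, goal_cases)
      case (1 i)
      show ?case
      proof (cases "i < ?d")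
        case False
        then obtain l where "i = ?d + l" by (metis le_Suc_ex not_less)
        then show ?thesis using 1 by (cases l) (simp_all add: vec1_def)
      qed (use 1 in \<open>simp add: vec1_def\<close>)
    qed (simp add: vec1_def)
    have v1: "vec1 a = vec1 b \<longleftrightarrow> a = b" for a b :: 'a
    proof -
      have "vec1 a $ 0 = a" for a :: 'a by (simp add: vec1_def)
      then show ?thesis by metis
    qed
    have eq: "vec ?d e @\<^sub>v vec1 (e ?d) @\<^sub>v vec ?N (\<lambda>l. e (Suc ?d + l)) = \<phi> p @\<^sub>v vec1 t @\<^sub>v flatten_mat n (H (p, t)) \<longleftrightarrow>
        vec ?d e = \<phi> p \<and> e ?d = t \<and> vec ?N (\<lambda>l. e (Suc ?d + l)) = flatten_mat n (H (p, t))" if "p \<in> U" for p t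
    proof -
      have "\<phi> p \<in> carrier_vec ?d" using cf(3) that by blast
      moreover have "vec1 a \<in> carrier_vec 1" for a :: 'a by (simp add: vec1_def)
      ultimately show ?thesis
        by (simp add: append_vec_eq[of _ ?d] append_vec_eq[of _ 1] v1)
    qed
    show ?thesis (is "?l \<longleftrightarrow> ?r")
    proof
      assume ?l
      then obtain p t where p: "p \<in> U" "t \<in> {0..1}" "vec (?d + 1 + ?N) e = \<phi> p @\<^sub>v vec1 t @\<^sub>v flatten_mat n (H (p, t))" by auto
      then have "vec ?d e = \<phi> p \<and> e ?d = t \<and> vec ?N (\<lambda>l. e (Suc ?d + l)) = flatten_mat n (H (p, t))"
        using p(3)[unfolded v] iffD1[OF eq[OF p(1)]] by blast
      then show ?r using p(1,2) cf(1) by auto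
    next
      assume r: ?r
      let ?p = "inv_into U \<phi> (vec ?d e)"
      have p: "?p \<in> U" "\<phi> ?p = vec ?d e" using r by (auto simp: inv_into_into f_inv_into_f)
      have "vec (?d + 1 + ?N) e = \<phi> ?p @\<^sub>v vec1 (e ?d) @\<^sub>v flatten_mat n (H (?p, e ?d))"
        using v p(2) r by simp
      then show ?l using p(1) r by (intro image_eqI[of _ _ "(?p, e ?d)"]) auto
    qed
  qed
  let ?E = "\<lambda>e i. if i \<le> ?d then e (?N + Suc i) else e (i - Suc ?d)"
  \<comment> \<open>Layout of the environment: first the \<open>?N\<close> matrix entries, to be
    bound, then the selected value, then the chart coordinates and the time.\<close>
  have "dpred S (\<lambda>e. vec (?d + 1 + ?N) (\<lambda>i. e (if i \<le> ?d then ?N + Suc i else i - Suc ?d)) \<in> ?X \<and> e (i * n + j) = e ?N)"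
    by (intro dintros dpred_ren[OF X])
  from dpred_exn[OF this, of ?N]
  have "dpred S (\<lambda>e. \<exists>v. vec (?d + 1 + ?N) (\<lambda>i. if i \<le> ?d then e (Suc i) else v (i - Suc ?d)) \<in> ?X \<and> v (i * n + j) = e 0)"
  proof (rule back_subst[of "dpred S"], intro ext ex_cong1)
    fix e and v :: "nat \<Rightarrow> 'a"
    have 1: "vec (?d + 1 + ?N) (\<lambda>i. (\<lambda>i. if i < ?N then v i else e (i - ?N)) (if i \<le> ?d then ?N + Suc i else i - Suc ?d)) =
        vec (?d + 1 + ?N) (\<lambda>i. if i \<le> ?d then e (Suc i) else v (i - Suc ?d))"
      by (rule eq_vecI) auto
    then show "(vec (?d + 1 + ?N) (\<lambda>i. (\<lambda>i. if i < ?N then v i else e (i - ?N)) (if i \<le> ?d then ?N + Suc i else i - Suc ?d)) \<in> ?X \<and>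
        (if i * n + j < ?N then v (i * n + j) else e (i * n + j - ?N)) = (if ?N < ?N then v ?N else e (?N - ?N))) =
      (vec (?d + 1 + ?N) (\<lambda>i. if i \<le> ?d then e (Suc i) else v (i - Suc ?d)) \<in> ?X \<and> v (i * n + j) = e 0)"
      unfolding 1 using l by simp
  qed
  then have G: "dpred S (\<lambda>e. ?guard (\<lambda>i. e (Suc i)) \<and> e 0 = pull c (\<lambda>z. H z $$ (i, j)) (\<lambda>i. e (Suc i)))"
  proof (rule back_subst[of "dpred S"], intro ext)
    fix e :: "nat \<Rightarrow> 'a"
    let ?T = "\<lambda>i. e (Suc i)"
    have 1: "vec ?d (\<lambda>i. if i \<le> ?d then e (Suc i) else v (i - Suc ?d)) = vec ?d ?T" for v by (rule eq_vecI) auto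
    have 2: "(\<lambda>l. if Suc ?d + l \<le> ?d then e (Suc (Suc ?d + l)) else v (Suc ?d + l - Suc ?d)) = v" for v by auto
    have 3: "(if ?d \<le> ?d then e (Suc ?d) else v (?d - Suc ?d)) = ?T ?d" for v by simp
    let ?g = "flatten_mat n (H (inv_into U \<phi> (vec ?d ?T), ?T ?d))"
    have "(\<exists>v. vec (?d + 1 + ?N) (\<lambda>i. if i \<le> ?d then e (Suc i) else v (i - Suc ?d)) \<in> ?X \<and> v (i * n + j) = e 0) \<longleftrightarrow>
      (\<exists>v. (?guard ?T \<and> ?g = vec ?N v) \<and> v (i * n + j) = e 0)"
      unfolding mem 1 2 3 by (rule refl)
    also have "\<dots> \<longleftrightarrow> ?guard ?T \<and> e 0 = ?g $ (i * n + j)"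
    proof
      assume r: "?guard ?T \<and> e 0 = ?g $ (i * n + j)"
      have "?g = vec ?N (\<lambda>l. ?g $ l)" by (rule eq_vecI) (auto simp: flatten_mat_def)
      then show "\<exists>v. (?guard ?T \<and> ?g = vec ?N v) \<and> v (i * n + j) = e 0"
        by (intro exI[of _ "\<lambda>l. ?g $ l"] conjI[OF _ conjunct2[OF r, symmetric]] conjI[OF conjunct1[OF r]])
    qed (use l in auto)
    also have "\<dots> \<longleftrightarrow> ?guard ?T \<and> e 0 = pull c (\<lambda>z. H z $$ (i, j)) ?T"
      unfolding fl c(1) pull_ichart by (cases "?guard ?T") (simp_all only: simp_thms if_True if_False)
    finally show "(\<exists>v. vec (?d + 1 + ?N) (\<lambda>i. if i \<le> ?d then e (Suc i) else v (i - Suc ?d)) \<in> ?X \<and> v (i * n + j) = e 0) =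
      (?guard ?T \<and> e 0 = pull c (\<lambda>z. H z $$ (i, j)) ?T)" .
  qed
  have "dpred S (\<lambda>e. (?guard (\<lambda>i. e (Suc i)) \<and> e 0 = pull c (\<lambda>z. H z $$ (i, j)) (\<lambda>i. e (Suc i))) \<or>
      (\<not> ?guard (\<lambda>i. e (Suc i)) \<and> e 0 = 0))"
    by (intro dpred_disj G) (intro dintros dpred_ren[OF cf(4)])
  then show "dfun S (pull c (\<lambda>z. H z $$ (i, j)))"
    unfolding dfun_def
  proof (rule back_subst[of "dpred S"], intro ext)
    fix e :: "nat \<Rightarrow> 'a"
    let ?T = "\<lambda>i. e (Suc i)"
    show "(?guard ?T \<and> e 0 = pull c (\<lambda>z. H z $$ (i, j)) ?T \<or> \<not> ?guard ?T \<and> e 0 = 0) = (e 0 = pull c (\<lambda>z. H z $$ (i, j)) ?T)"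
      unfolding c(1) pull_ichart by (cases "?guard ?T") (simp_all only: simp_thms if_True if_False)
  qed
qed

section \<open>Gram-Schmidt orthonormalisation over an ordered field\<close>

definition ip :: "nat \<Rightarrow> (nat \<Rightarrow> 'a::comm_ring_1) \<Rightarrow> (nat \<Rightarrow> 'a) \<Rightarrow> 'a" where
  "ip n u v = (\<Sum>i<n. u i * v i)"

text \<open>Matrices are handled as functions of two indices, of which only the values below
  \<open>n\<close> count; the matrix type enters for determinants and one-sided inverses.\<close>

abbreviation sqmat :: "nat \<Rightarrow> (nat \<Rightarrow> nat \<Rightarrow> 'a) \<Rightarrow> 'a mat" where
  "sqmat n g \<equiv> mat n n (\<lambda>(i, j). g i j)"

definition mmul :: "nat \<Rightarrow> (nat \<Rightarrow> nat \<Rightarrow> 'a::comm_ring_1) \<Rightarrow> (nat \<Rightarrow> nat \<Rightarrow> 'a) \<Rightarrow> nat \<Rightarrow> nat \<Rightarrow> 'a" where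
  "mmul n g h i j = (\<Sum>k<n. g i k * h k j)"

lemma sqmat_mult: "sqmat n g * sqmat n h = sqmat n (mmul n g h)"
  by (rule eq_matI) (simp_all add: mmul_def scalar_prod_def atLeast0LessThan)

lemma det_upper:
  assumes "\<And>i j. j < i \<Longrightarrow> i < n \<Longrightarrow> g i j = (0 :: 'a::comm_ring_1)"
  shows "det (sqmat n g) = (\<Prod>i<n. g i i)"
proof -
  have "det (sqmat n g) = prod_list (diag_mat (sqmat n g))"
    by (rule det_upper_triangular[of _ n]) (auto simp: upper_triangular_def assms)
  also have "\<dots> = (\<Prod>i<n. sqmat n g $$ (i, i))"
    by (simp add: prod_list_diag_prod atLeast0LessThan)
  finally show ?thesis by simp
qed

text \<open>Division by a vanishing norm yields \<open>0\<close>, so the columns are orthogonal without any hypothesis.\<close>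

fun gram_schmidt_col :: "nat \<Rightarrow> (nat \<Rightarrow> nat \<Rightarrow> 'a::field) \<Rightarrow> nat \<Rightarrow> nat \<Rightarrow> 'a" where
  "gram_schmidt_col n g k i = g i k -
     (\<Sum>j<k. ip n (\<lambda>i. g i k) (gram_schmidt_col n g j) / ip n (gram_schmidt_col n g j) (gram_schmidt_col n g j) *
        gram_schmidt_col n g j i)"

declare gram_schmidt_col.simps [simp del]

lemma ip_commute: "ip n u v = ip n v u"
  by (simp add: ip_def mult.commute)

lemma ip_self_nonneg: "0 \<le> ip n u (u :: nat \<Rightarrow> 'a::linordered_idom)"
  by (simp add: ip_def sum_nonneg)

lemma ip_self_zero: "ip n u u = (0 :: 'a::linordered_idom) \<Longrightarrow> i < n \<Longrightarrow> u i = 0"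
  unfolding ip_def by (subst (asm) sum_nonneg_eq_0_iff) auto

lemma gram_schmidt_orthogonal:
  fixes g :: "nat \<Rightarrow> nat \<Rightarrow> 'a::linordered_field"
  shows "l < k \<Longrightarrow> ip n (gram_schmidt_col n g k) (gram_schmidt_col n g l) = 0"
proof (induction k arbitrary: l rule: less_induct)
  case (less k)
  let ?w = "gram_schmidt_col n g"
  have orth: "ip n (?w j) (?w l) = 0" if "j < k" "j \<noteq> l" for j
    using less.IH[OF that(1), of l] less.IH[OF less.prems, of j] that(2)
    by (cases j l rule: linorder_cases) (auto simp: ip_commute)
  let ?c = "\<lambda>j. ip n (\<lambda>i. g i k) (?w j) / ip n (?w j) (?w j)"
  have "ip n (?w k) (?w l) = (\<Sum>i<n. (g i k - (\<Sum>j<k. ?c j * ?w j i)) * ?w l i)"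
    unfolding ip_def[of n "?w k" "?w l"] by (subst gram_schmidt_col.simps) (rule refl)
  also have "\<dots> = ip n (\<lambda>i. g i k) (?w l) - (\<Sum>i<n. \<Sum>j<k. ?c j * (?w j i * ?w l i))"
    by (simp add: ip_def[of n "\<lambda>i. g i k" "?w l"] left_diff_distrib sum_subtractf sum_distrib_right mult.assoc)
  also have "(\<Sum>i<n. \<Sum>j<k. ?c j * (?w j i * ?w l i)) = (\<Sum>j<k. ?c j * ip n (?w j) (?w l))"
    unfolding ip_def[of n "?w _" "?w l"] sum_distrib_left by (rule sum.swap)
  also have "\<dots> = (\<Sum>j<k. if j = l then ?c l * ip n (?w l) (?w l) else 0)"
    using orth by (intro sum.cong) auto
  also have "\<dots> = ?c l * ip n (?w l) (?w l)" using less.prems by simp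
  also have "\<dots> = ip n (\<lambda>i. g i k) (?w l)"
  \<comment> \<open>A vanishing square norm means that the column vanishes, and then both sides are
    0.\<close>
  proof (cases "ip n (?w l) (?w l) = 0")
    case True
    then have "ip n (\<lambda>i. g i k) (?w l) = 0"
      unfolding ip_def[of n "\<lambda>i. g i k"] using ip_self_zero[OF True] by (intro sum.neutral) auto
    then show ?thesis using True by simp
  qed simp
  finally show ?case by simp
qed

definition qr_q :: "nat \<Rightarrow> (nat \<Rightarrow> nat \<Rightarrow> 'a::real_closed_field) \<Rightarrow> nat \<Rightarrow> nat \<Rightarrow> 'a" where
  "qr_q n g i j = gram_schmidt_col n g j i / rsqrt (ip n (gram_schmidt_col n g j) (gram_schmidt_col n g j))"

definition orthogonal_mat :: "nat \<Rightarrow> (nat \<Rightarrow> nat \<Rightarrow> 'a::comm_ring_1) \<Rightarrow> bool" where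
  "orthogonal_mat n q \<longleftrightarrow> (\<forall>a<n. \<forall>b<n. (\<Sum>i<n. q i a * q i b) = (if a = b then 1 else 0))"

text \<open>With W the orthogonal, not yet normalised columns, g = W T1 for a unipotent upper
  triangular T1, so det W = 1. The diagonal matrix W^T W then has determinant 1, so no column
  vanishes. The product of the lengths is positive with square 1, hence 1, and normalising changes
  no determinant.\<close>

lemma qr_decomposition:
  fixes g :: "nat \<Rightarrow> nat \<Rightarrow> 'a::real_closed_field"
  assumes det: "det (sqmat n g) = 1"
  defines "w \<equiv> gram_schmidt_col n g"
  shows "\<And>j. j < n \<Longrightarrow> 0 < ip n (w j) (w j)" "orthogonal_mat n (qr_q n g)" "det (sqmat n (qr_q n g)) = 1"
    "\<exists>T. (\<forall>i<n. \<forall>k<n. g i k = mmul n (qr_q n g) T i k) \<and> (\<forall>j k. k < j \<longrightarrow> T j k = 0) \<and>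
       (\<forall>j<n. T j j \<noteq> 0) \<and> (\<Prod>j<n. T j j) = 1"
proof -
  define c where "c j k = ip n (\<lambda>i. g i k) (w j) / ip n (w j) (w j)" for j k
  define T1 where "T1 j k = (if j < k then c j k else if j = k then 1 else 0)" for j k
  have dec: "g i k = (\<Sum>j<n. w j i * T1 j k)" if "k < n" for i k
  proof -
    have "g i k = w k i + (\<Sum>j<k. c j k * w j i)"
      unfolding w_def c_def using gram_schmidt_col.simps[of n g k i] by simp
    also have "\<dots> = (\<Sum>j<Suc k. w j i * T1 j k)" by (simp add: T1_def mult.commute)
    also have "\<dots> = (\<Sum>j<n. w j i * T1 j k)"
      by (rule sum.mono_neutral_left) (use that in \<open>auto simp: T1_def\<close>)
    finally show ?thesis .
  qed
  have orth: "ip n (w a) (w b) = 0" if "a \<noteq> b" for a b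
    using gram_schmidt_orthogonal[of a b n g] gram_schmidt_orthogonal[of b a n g] that
    unfolding w_def by (cases a b rule: linorder_cases) (auto simp: ip_commute)
  let ?W = "\<lambda>i j. w j i"
  have "sqmat n g = sqmat n ?W * sqmat n T1"
    unfolding sqmat_mult by (rule eq_matI) (simp_all add: mmul_def dec)
  then have "det (sqmat n g) = det (sqmat n ?W) * det (sqmat n T1)"
    using det_mult[of "sqmat n ?W" n "sqmat n T1"] by simp
  moreover have "det (sqmat n T1) = 1" by (subst det_upper) (auto simp: T1_def)
  ultimately have detW: "det (sqmat n ?W) = 1" using det by simp
  have "transpose_mat (sqmat n ?W) = sqmat n w" by (rule eq_matI) auto
  then have "det (sqmat n w) = 1" using detW det_transpose[of "sqmat n ?W" n] by simp
  then have "1 = det (sqmat n w * sqmat n ?W)"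
    using det_mult[of "sqmat n w" n "sqmat n ?W"] detW by simp
  also have "sqmat n w * sqmat n ?W = sqmat n (\<lambda>a b. ip n (w a) (w b))"
    unfolding sqmat_mult by (rule eq_matI) (simp_all add: mmul_def ip_def)
  also have "det \<dots> = (\<Prod>j<n. ip n (w j) (w j))" by (rule det_upper) (use orth in auto)
  finally have prod1: "(\<Prod>j<n. ip n (w j) (w j)) = 1" by simp
  show pos: "0 < ip n (w j) (w j)" if "j < n" for j
  proof -
    have "ip n (w j) (w j) \<noteq> 0"
    proof
      assume "ip n (w j) (w j) = 0"
      then have "(\<Prod>j<n. ip n (w j) (w j)) = 0" using that by (intro prod_zero) auto
      then show False using prod1 by simp
    qed
    then show ?thesis using ip_self_nonneg[of n "w j"] by simp
  qed
  define s where "s j = rsqrt (ip n (w j) (w j))" for j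
  have s: "0 < s j" "s j * s j = ip n (w j) (w j)" if "j < n" for j
    using rsqrt_pos[OF pos[OF that]] rsqrt[OF less_imp_le[OF pos[OF that]]] by (auto simp: s_def)
  have q: "qr_q n g i j = w j i / s j" for i j by (simp add: qr_q_def s_def w_def)
  have "(\<Prod>j<n. s j) * (\<Prod>j<n. s j) = 1"
    unfolding prod.distrib[symmetric] using prod1 s(2) by simp
  moreover have "0 < (\<Prod>j<n. s j)" using s(1) by (intro prod_pos) auto
  ultimately have prods: "(\<Prod>j<n. s j) = 1"
    by (metis abs_of_pos abs_mult_self_eq abs_1 mult_1_right power2_eq_square power2_eq_iff_nonneg less_imp_le zero_le_one)
  show "orthogonal_mat n (qr_q n g)"
    unfolding orthogonal_mat_def q
  proof (intro allI impI)
    fix a b assume ab: "a < n" "b < n"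
    have "(\<Sum>i<n. w a i / s a * (w b i / s b)) = ip n (w a) (w b) / (s a * s b)"
      by (simp add: ip_def sum_divide_distrib)
    then show "(\<Sum>i<n. w a i / s a * (w b i / s b)) = (if a = b then 1 else 0)"
      using orth[of a b] s[OF ab(1)] by auto
  qed
  define T where "T j k = s j * T1 j k" for j k
  have gq: "g i k = mmul n (qr_q n g) T i k" if "k < n" for i k
  proof -
    have "w j i * T1 j k = w j i / s j * (s j * T1 j k)" if "j < n" for j using s(1)[OF that] by simp
    then show ?thesis unfolding mmul_def q T_def dec[OF that] by (intro sum.cong) auto
  qed
  have Td: "T j j = s j" "k < j \<Longrightarrow> T j k = 0" for j k by (auto simp: T_def T1_def)
  have "sqmat n g = sqmat n (qr_q n g) * sqmat n T"
    unfolding sqmat_mult by (rule eq_matI) (simp_all add: gq)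
  then have "det (sqmat n g) = det (sqmat n (qr_q n g)) * det (sqmat n T)"
    using det_mult[of "sqmat n (qr_q n g)" n "sqmat n T"] by simp
  moreover have "det (sqmat n T) = 1" by (subst det_upper) (auto simp: Td prods)
  ultimately show "det (sqmat n (qr_q n g)) = 1" using det by simp
  show "\<exists>T. (\<forall>i<n. \<forall>k<n. g i k = mmul n (qr_q n g) T i k) \<and> (\<forall>j k. k < j \<longrightarrow> T j k = 0) \<and>
       (\<forall>j<n. T j j \<noteq> 0) \<and> (\<Prod>j<n. T j j) = 1"
  proof (intro exI[of _ T] conjI allI impI)
    show "T j j \<noteq> 0" if "j < n" for j using s(1)[OF that] by (simp add: Td)
    show "(\<Prod>j<n. T j j) = 1" using prods by (simp add: Td)
  qed (use gq Td in auto)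
qed

lemma orthogonal_mat_bound:
  assumes "orthogonal_mat n (q :: nat \<Rightarrow> nat \<Rightarrow> 'a::linordered_idom)" "i < n" "j < n"
  shows "\<bar>q i j\<bar> \<le> 1"
proof -
  have "(\<Sum>i<n. q i j * q i j) = 1" using assms by (simp add: orthogonal_mat_def)
  moreover have "q i j * q i j \<le> (\<Sum>i<n. q i j * q i j)" using assms by (intro member_le_sum) auto
  ultimately have "\<bar>q i j\<bar> * \<bar>q i j\<bar> \<le> 1" by simp
  then show ?thesis
    by (metis abs_ge_zero less_1_mult not_le)
qed

section \<open>Elimination from the last row and column\<close>

text \<open>The Schur complement of the last diagonal entry. Eliminating from the end leaves a
  matrix on the indices below \<open>n\<close>, without reindexing, in accordance with the
  stabilisation by ones at the lower right.\<close>

definition schur :: "nat \<Rightarrow> (nat \<Rightarrow> nat \<Rightarrow> 'a::field) \<Rightarrow> nat \<Rightarrow> nat \<Rightarrow> 'a" where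
  "schur n g i j = g i j - g i n * g n j / g n n"

primrec nonzero_pivots :: "nat \<Rightarrow> (nat \<Rightarrow> nat \<Rightarrow> 'a::field) \<Rightarrow> bool" where
  "nonzero_pivots 0 g = True"
| "nonzero_pivots (Suc n) g = (g n n \<noteq> 0 \<and> nonzero_pivots n (schur n g))"

primrec pivot_prod :: "nat \<Rightarrow> (nat \<Rightarrow> nat \<Rightarrow> 'a::field) \<Rightarrow> 'a" where
  "pivot_prod 0 g = 1"
| "pivot_prod (Suc n) g = pivot_prod n (schur n g) * g n n"

lemma pivots_cong:
  "(\<And>i j. i < n \<Longrightarrow> j < n \<Longrightarrow> g i j = h i j) \<Longrightarrow> nonzero_pivots n g = nonzero_pivots n h \<and> pivot_prod n g = pivot_prod n h"
proof (induction n arbitrary: g h)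
  case (Suc n)
  have "nonzero_pivots n (schur n g) = nonzero_pivots n (schur n h) \<and> pivot_prod n (schur n g) = pivot_prod n (schur n h)"
    by (rule Suc.IH) (simp add: schur_def Suc.prems)
  then show ?case using Suc.prems[of n n] by simp
qed simp

text \<open>The last row vanishes left of the diagonal, so elimination changes nothing.\<close>

lemma pivots_upper:
  assumes "\<And>i j. j < i \<Longrightarrow> i < n \<Longrightarrow> g i j = 0" "\<And>i. i < n \<Longrightarrow> g i i \<noteq> 0"
  shows "nonzero_pivots n g \<and> pivot_prod n g = (\<Prod>i<n. g i i)"
  using assms
proof (induction n)
  case (Suc n)
  have "nonzero_pivots n (schur n g) = nonzero_pivots n g \<and> pivot_prod n (schur n g) = pivot_prod n g"
    by (rule pivots_cong) (simp add: schur_def Suc.prems)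
  then show ?case using Suc by simp
qed simp

text \<open>Multiplication on the right by the unipotent \<open>?E\<close> subtracts multiples of
  the last column so as to clear the last row; what remains is block upper triangular.\<close>

lemma det_schur:
  fixes g :: "nat \<Rightarrow> nat \<Rightarrow> 'a::field"
  assumes "g n n \<noteq> 0"
  shows "det (sqmat (Suc n) g) = det (sqmat n (schur n g)) * g n n"
proof -
  let ?E = "\<lambda>i j. if i = j then 1 else if i = n \<and> j < n then - g n j / g n n else 0"
  let ?B = "\<lambda>i j. if i < n \<and> j < n then schur n g i j else if j = n then g i n else 0"
  have eq: "sqmat (Suc n) g * sqmat (Suc n) ?E = sqmat (Suc n) ?B"
    unfolding sqmat_mult
  proof (rule eq_matI, goal_cases)
    case (1 i j)
    have "(\<Sum>k<Suc n. g i k * ?E k j) = ?B i j" if "i \<le> n" "j \<le> n"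
    proof (cases "j = n")
      case True
      have "(\<Sum>k<n. g i k * ?E k n) = 0" by (intro sum.neutral) auto
      then show ?thesis using True by simp
    next
      case False
      then have j: "j < n" using that by simp
      have "(\<Sum>k<n. g i k * ?E k j) = (\<Sum>k<n. if k = j then g i j else 0)" by (intro sum.cong) auto
      also have "\<dots> = g i j" using j by simp
      finally have "(\<Sum>k<Suc n. g i k * ?E k j) = g i j + g i n * (- g n j / g n n)" using j by simp
      then show ?thesis using j that assms by (cases "i = n") (auto simp: schur_def)
    qed
    then show ?case using 1 by (simp add: mmul_def)
  qed auto
  have "transpose_mat (sqmat (Suc n) ?E) = sqmat (Suc n) (\<lambda>i j. ?E j i)" by (rule eq_matI) auto
  moreover have "det (sqmat (Suc n) (\<lambda>i j. ?E j i)) = 1" by (subst det_upper) auto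
  ultimately have "det (sqmat (Suc n) ?E) = 1" using det_transpose[of "sqmat (Suc n) ?E" "Suc n"] by simp
  then have "det (sqmat (Suc n) g) = det (sqmat (Suc n) ?B)"
    using det_mult[of "sqmat (Suc n) g" "Suc n" "sqmat (Suc n) ?E"] unfolding eq by simp
  also have "sqmat (Suc n) ?B = four_block_mat (sqmat n (schur n g)) (mat n 1 (\<lambda>(i, j). g i n)) (0\<^sub>m 1 n) (mat 1 1 (\<lambda>_. g n n))"
    by (rule eq_matI) (auto simp: less_Suc_eq)
  also have "det \<dots> = det (sqmat n (schur n g)) * det (mat 1 1 (\<lambda>_. g n n))"
    by (rule det_four_block_mat_lower_left_zero) auto
  also have "det (mat 1 1 (\<lambda>_. g n n)) = g n n" by (simp add: det_single)
  finally show ?thesis .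
qed

lemma pivot_prod_det: "nonzero_pivots n g \<Longrightarrow> pivot_prod n g = det (sqmat n g)"
proof (induction n arbitrary: g)
  case 0
  show ?case by simp
next
  case (Suc n)
  then show ?case by (simp add: det_schur del: mat_def)
qed

section \<open>Positive forms and close orthogonal matrices\<close>

definition positive_form :: "nat \<Rightarrow> (nat \<Rightarrow> nat \<Rightarrow> 'a::linordered_field) \<Rightarrow> bool" where
  "positive_form n g \<longleftrightarrow> (\<forall>v. (\<exists>i<n. v i \<noteq> 0) \<longrightarrow> 0 < (\<Sum>i<n. \<Sum>j<n. v i * g i j * v j))"

text \<open>A vector \<open>w\<close> extends to a vector whose image under \<open>g\<close> has last coordinate \<open>0\<close>; on it the two
  forms agree.\<close>

lemma positive_form_pivots: "positive_form n g \<Longrightarrow> nonzero_pivots n g"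
proof (induction n arbitrary: g)
  case (Suc n)
  have "0 < g n n"
  proof -
    let ?v = "\<lambda>i. if i = n then 1 else (0::'a)"
    have "(\<Sum>i<Suc n. \<Sum>j<Suc n. ?v i * g i j * ?v j) = g n n" by simp
    moreover have "0 < (\<Sum>i<Suc n. \<Sum>j<Suc n. ?v i * g i j * ?v j)"
      using Suc.prems unfolding positive_form_def by (elim allE[of _ ?v] impE) auto
    ultimately show ?thesis by simp
  qed
  moreover have "positive_form n (schur n g)"
    unfolding positive_form_def
  proof (intro allI impI)
    fix w :: "nat \<Rightarrow> 'a" assume w: "\<exists>i<n. w i \<noteq> 0"
    define x where "x = - (\<Sum>j<n. g n j * w j) / g n n"
    define v where "v i = (if i = n then x else w i)" for i
    have gv: "(\<Sum>j<Suc n. g i j * v j) = (if i = n then 0 else \<Sum>j<n. schur n g i j * w j)" if "i \<le> n" for i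
    proof -
      have "(\<Sum>j<Suc n. g i j * v j) = (\<Sum>j<n. g i j * w j) + g i n * x" by (simp add: v_def)
      also have "g i n * x = - (\<Sum>j<n. g i n * g n j / g n n * w j)"
        by (simp add: x_def sum_distrib_left sum_divide_distrib mult.assoc)
      also have "(\<Sum>j<n. g i j * w j) + \<dots> = (\<Sum>j<n. schur n g i j * w j)"
        by (simp add: schur_def left_diff_distrib sum_subtractf)
      also have "\<dots> = (if i = n then 0 else \<Sum>j<n. schur n g i j * w j)"
        using \<open>0 < g n n\<close> by (auto simp: schur_def)
      finally show ?thesis .
    qed
    have "\<exists>i<Suc n. v i \<noteq> 0" using w by (auto simp: v_def intro: less_SucI)
    then have "0 < (\<Sum>i<Suc n. \<Sum>j<Suc n. v i * g i j * v j)"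
      using Suc.prems unfolding positive_form_def by blast
    also have "\<dots> = (\<Sum>i<Suc n. v i * (\<Sum>j<Suc n. g i j * v j))"
      unfolding sum_distrib_left mult.assoc by (rule refl)
    also have "\<dots> = (\<Sum>i<Suc n. v i * (if i = n then 0 else \<Sum>j<n. schur n g i j * w j))"
      by (intro sum.cong refl arg_cong2[where f = "(*)"] gv) auto
    also have "\<dots> = (\<Sum>i<n. w i * (\<Sum>j<n. schur n g i j * w j))" by (simp add: v_def)
    finally show "0 < (\<Sum>i<n. \<Sum>j<n. w i * schur n g i j * w j)"
      unfolding sum_distrib_left mult.assoc .
  qed
  ultimately show ?case using Suc.IH by simp
qed simp

text \<open>By Lagrange's identity, twice the difference of the two sides is a sum of
  squares.\<close>

lemma Cauchy_Schwarz_sum: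
  fixes x y :: "'i \<Rightarrow> 'a::linordered_idom"
  shows "(\<Sum>i\<in>I. x i * y i) * (\<Sum>i\<in>I. x i * y i) \<le> (\<Sum>i\<in>I. x i * x i) * (\<Sum>i\<in>I. y i * y i)"
proof -
  have "0 \<le> (\<Sum>i\<in>I. \<Sum>j\<in>I. (x i * y j - x j * y i) * (x i * y j - x j * y i))"
    by (intro sum_nonneg) simp
  also have "\<dots> = (\<Sum>i\<in>I. \<Sum>j\<in>I. x i * x i * (y j * y j)) + (\<Sum>i\<in>I. \<Sum>j\<in>I. y i * y i * (x j * x j))
      - 2 * (\<Sum>i\<in>I. \<Sum>j\<in>I. x i * y i * (x j * y j))"
    unfolding sum_distrib_left sum.distrib[symmetric] sum_subtractf[symmetric]
    by (intro sum.cong refl) (simp add: algebra_simps)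
  also have "\<dots> = 2 * ((\<Sum>i\<in>I. x i * x i) * (\<Sum>i\<in>I. y i * y i)) - 2 * ((\<Sum>i\<in>I. x i * y i) * (\<Sum>i\<in>I. x i * y i))"
    unfolding sum_product[symmetric] by (simp add: mult.commute)
  finally show ?thesis by simp
qed

text \<open>Polarisation: \<open>2 \<langle>Q v, Q' v\<rangle> = 2 \<bar>v\<bar>\<^sup>2 - \<bar>(Q' - Q) v\<bar>\<^sup>2\<close>.\<close>

lemma close_orthogonal_positive:
  fixes q q' :: "nat \<Rightarrow> nat \<Rightarrow> 'a::linordered_field"
  assumes q: "orthogonal_mat n q" and q': "orthogonal_mat n q'"
    and close: "(\<Sum>i<n. \<Sum>j<n. (q' i j - q i j) * (q' i j - q i j)) < 2"
  shows "positive_form n (mmul n (\<lambda>i j. q j i) q')"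
  unfolding positive_form_def
proof (intro allI impI)
  fix v :: "nat \<Rightarrow> 'a" assume v: "\<exists>i<n. v i \<noteq> 0"
  define N where "N = (\<Sum>i<n. v i * v i)"
  have N: "N > 0" using v unfolding N_def by (intro sum_pos2[of "{..<n}" "SOME i. i < n \<and> v i \<noteq> 0"])
      (use someI_ex[OF v] in \<open>auto simp: zero_less_mult_iff linorder_neq_iff\<close>)
  let ?x = "\<lambda>q i. \<Sum>a<n. q i a * v a"
  have form: "(\<Sum>i<n. ?x r i * ?x r' i) = (\<Sum>a<n. \<Sum>b<n. v a * mmul n (\<lambda>i j. r j i) r' a b * v b)" for r r' :: "nat \<Rightarrow> nat \<Rightarrow> 'a"
  proof -
    have "(\<Sum>i<n. ?x r i * ?x r' i) = (\<Sum>i<n. \<Sum>a<n. \<Sum>b<n. v a * (r i a * r' i b) * v b)"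
      unfolding sum_product by (intro sum.cong refl) (simp add: algebra_simps)
    also have "\<dots> = (\<Sum>a<n. \<Sum>i<n. \<Sum>b<n. v a * (r i a * r' i b) * v b)" by (rule sum.swap)
    also have "\<dots> = (\<Sum>a<n. \<Sum>b<n. \<Sum>i<n. v a * (r i a * r' i b) * v b)"
      by (intro sum.cong refl sum.swap)
    finally show ?thesis by (simp add: mmul_def sum_distrib_left sum_distrib_right)
  qed
  have norm: "(\<Sum>i<n. ?x r i * ?x r i) = N" if "orthogonal_mat n r" for r
  proof -
    have "(\<Sum>i<n. ?x r i * ?x r i) = (\<Sum>a<n. \<Sum>b<n. if b = a then v a * v a else 0)"
      unfolding form using that by (intro sum.cong refl) (auto simp: orthogonal_mat_def mmul_def)
    also have "\<dots> = N" unfolding N_def by (intro sum.cong refl) auto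
    finally show ?thesis .
  qed
  \<comment> \<open>Cauchy-Schwarz row by row: |(Q' - Q) v|^2 is at most the squared Frobenius
    distance times |v|^2.\<close>
  have "(\<Sum>i<n. (?x q' i - ?x q i) * (?x q' i - ?x q i)) \<le> (\<Sum>i<n. (\<Sum>j<n. (q' i j - q i j) * (q' i j - q i j)) * N)"
  proof (rule sum_mono)
    fix i
    have "?x q' i - ?x q i = (\<Sum>a<n. (q' i a - q i a) * v a)"
      by (simp add: left_diff_distrib sum_subtractf)
    then show "(?x q' i - ?x q i) * (?x q' i - ?x q i) \<le> (\<Sum>j<n. (q' i j - q i j) * (q' i j - q i j)) * N"
      unfolding N_def using Cauchy_Schwarz_sum[of "\<lambda>a. q' i a - q i a" v "{..<n}"] by simp
  qed
  also have "\<dots> = (\<Sum>i<n. \<Sum>j<n. (q' i j - q i j) * (q' i j - q i j)) * N" by (simp add: sum_distrib_right)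
  also have "\<dots> < 2 * N" using close N by (intro mult_strict_right_mono)
  finally have "(\<Sum>i<n. (?x q' i - ?x q i) * (?x q' i - ?x q i)) < 2 * N" .
  moreover have "(\<Sum>i<n. (y i - x i) * (y i - x i)) =
      (\<Sum>i<n. y i * y i) + (\<Sum>i<n. x i * x i) - 2 * (\<Sum>i<n. x i * y i)" for x y :: "nat \<Rightarrow> 'a"
    unfolding sum_distrib_left sum.distrib[symmetric] sum_subtractf[symmetric]
    by (intro sum.cong refl) (simp add: algebra_simps)
  note this[of "?x q'" "?x q"]
  ultimately have "0 < (\<Sum>i<n. ?x q i * ?x q' i)" unfolding norm[OF q] norm[OF q'] by linarith
  then show "0 < (\<Sum>i<n. \<Sum>j<n. v i * mmul n (\<lambda>i j. q j i) q' i j * v j)" unfolding form .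
qed

section \<open>The group \<open>GL\<close> of the ring of definable continuous functions\<close>

definition extend_mat :: "nat \<Rightarrow> (nat \<Rightarrow> nat \<Rightarrow> 'a::comm_ring_1) \<Rightarrow> nat \<Rightarrow> nat \<Rightarrow> 'a" where
  "extend_mat n g i j = (if i < n \<and> j < n then g i j else if i = j then 1 else 0)"

lemma sum_extend_mat:
  assumes "n \<le> B" "i < B" "j < B"
  shows "(\<Sum>k<B. extend_mat n g i k * extend_mat n h k j) = extend_mat n (mmul n g h) i j"
proof (cases "i < n")
  case False
  have "(\<Sum>k<B. extend_mat n g i k * extend_mat n h k j) = (\<Sum>k<B. if k = i then extend_mat n h i j else 0)"
    using False by (intro sum.cong) (auto simp: extend_mat_def)
  also have "\<dots> = extend_mat n h i j" using assms(2) by simp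
  finally show ?thesis using False by (simp add: extend_mat_def)
next
  case i: True
  have "(\<Sum>k<B. extend_mat n g i k * extend_mat n h k j) = (\<Sum>k<n. extend_mat n g i k * extend_mat n h k j)"
    by (rule sum.mono_neutral_right) (use i assms in \<open>auto simp: extend_mat_def\<close>)
  also have "\<dots> = (if j < n then mmul n g h i j else 0)"
    using i by (auto simp: extend_mat_def mmul_def intro!: sum.neutral)
  finally show ?thesis using i by (simp add: extend_mat_def)
qed

lemma mmul_extend_mat:
  "n \<le> B \<Longrightarrow> i < B \<Longrightarrow> j < B \<Longrightarrow> mmul B (extend_mat n g) (extend_mat n h) i j = extend_mat n (mmul n g h) i j"
  unfolding mmul_def[of B] by (rule sum_extend_mat)

lemma pivot_prod_nonzero: "nonzero_pivots n g \<Longrightarrow> pivot_prod n g \<noteq> 0"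
  by (induction n arbitrary: g) auto

lemma mmul_assoc: "mmul n (mmul n f g) h i j = mmul n f (mmul n g h) i j"
proof -
  have "mmul n (mmul n f g) h i j = (\<Sum>k<n. \<Sum>l<n. f i l * g l k * h k j)"
    by (simp add: mmul_def sum_distrib_right)
  also have "\<dots> = (\<Sum>l<n. \<Sum>k<n. f i l * g l k * h k j)" by (rule sum.swap)
  finally show ?thesis by (simp add: mmul_def sum_distrib_left mult.assoc)
qed

lemma mmul_cong:
  "(\<And>k. k < n \<Longrightarrow> f i k = f' i k) \<Longrightarrow> (\<And>k. k < n \<Longrightarrow> g k j = g' k j) \<Longrightarrow> mmul n f g i j = mmul n f' g' i j"
  by (simp add: mmul_def)

section \<open>Matrices over the function ring as pointwise families\<close>

context
  fixes S :: "('f, 'p, 'a::real_closed_field) expansion" and M :: "('m, 'a) manifold" and r :: nat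
  assumes man: "definable_Cr_manifold S r M"
begin

abbreviation (input) "CA \<equiv> Cdf0 S M"

lemma Cdf0_simps:
  "f \<otimes>\<^bsub>CA\<^esub> h = (\<lambda>p\<in>points M. f p * h p)" "f \<oplus>\<^bsub>CA\<^esub> h = (\<lambda>p\<in>points M. f p + h p)"
  "\<one>\<^bsub>CA\<^esub> = (\<lambda>p\<in>points M. 1)" "\<zero>\<^bsub>CA\<^esub> = (\<lambda>p\<in>points M. 0)"
  by (simp_all add: Cdf0_def)

lemma mcont_cong: "(\<And>p. p \<in> points M \<Longrightarrow> f p = h p) \<Longrightarrow> mcont S M f = mcont S M h"
  by (rule dcont_cong[OF definable_charts_manifold[OF man]]) (simp add: topspace_manifold_topology[OF man])

lemma restrict_carrier: "(\<lambda>p\<in>points M. f p) \<in> carrier CA \<longleftrightarrow> mcont S M f"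
  unfolding mcont_iff_carrier[OF man] using mcont_cong[of "\<lambda>p\<in>points M. f p" f] by simp

lemmas C = definable_charts_manifold[OF man]

text \<open>Lets matrix products over the ring be computed point by point.\<close>

lemma finsum_Cdf0:
  assumes "finite I" "\<And>i. i \<in> I \<Longrightarrow> f i \<in> carrier CA"
  shows "finsum CA f I = (\<lambda>p\<in>points M. \<Sum>i\<in>I. f i p)"
proof -
  have "abelian_monoid CA"
  proof (rule abelian_monoidI)
    show "x \<oplus>\<^bsub>CA\<^esub> y \<in> carrier CA" if "x \<in> carrier CA" "y \<in> carrier CA" for x y
      using that unfolding Cdf0_simps restrict_carrier
      by (intro dcont_plus[OF C]) (simp_all add: mcont_iff_carrier[OF man])
    show "\<zero>\<^bsub>CA\<^esub> \<in> carrier CA" unfolding Cdf0_simps restrict_carrier by (rule dcont_const[OF C])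
    show "\<zero>\<^bsub>CA\<^esub> \<oplus>\<^bsub>CA\<^esub> x = x" if "x \<in> carrier CA" for x
      using that mcont_iff_carrier[OF man, of x] by (auto simp: Cdf0_simps fun_eq_iff extensional_def)
  qed (auto simp: Cdf0_simps algebra_simps)
  then interpret abelian_monoid CA .
  show ?thesis
    using assms
  proof (induction I rule: finite_induct)
    case empty
    show ?case by (simp add: Cdf0_simps)
  next
    case (insert i I)
    then have "finsum CA f (insert i I) = f i \<oplus>\<^bsub>CA\<^esub> finsum CA f I" by (intro finsum_insert) auto
    then show ?case using insert by (simp add: Cdf0_simps cong: restrict_cong)
  qed
qed

definition cmat :: "nat \<Rightarrow> ('m \<Rightarrow> nat \<Rightarrow> nat \<Rightarrow> 'a) \<Rightarrow> bool" where
  "cmat n g \<longleftrightarrow> (\<forall>i<n. \<forall>j<n. mcont S M (\<lambda>p. g p i j))"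

text \<open>The inverse is carried along because its entries must again lie in the ring, which
  invertibility at each point does not say by itself.\<close>

definition inv_pair :: "nat \<Rightarrow> ('m \<Rightarrow> nat \<Rightarrow> nat \<Rightarrow> 'a) \<Rightarrow> ('m \<Rightarrow> nat \<Rightarrow> nat \<Rightarrow> 'a) \<Rightarrow> bool" where
  "inv_pair n g h \<longleftrightarrow> cmat n g \<and> cmat n h \<and> (\<forall>p\<in>points M. \<forall>i<n. \<forall>j<n.
     mmul n (g p) (h p) i j = (if i = j then 1 else 0) \<and> mmul n (h p) (g p) i j = (if i = j then 1 else 0))"

definition emb :: "nat \<Rightarrow> ('m \<Rightarrow> nat \<Rightarrow> nat \<Rightarrow> 'a) \<Rightarrow> nat \<Rightarrow> nat \<Rightarrow> 'm \<Rightarrow> 'a" where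
  "emb n g i j = (\<lambda>p\<in>points M. extend_mat n (g p) i j)"

lemma emb_cong: "(\<And>p i j. p \<in> points M \<Longrightarrow> i < n \<Longrightarrow> j < n \<Longrightarrow> g p i j = h p i j) \<Longrightarrow> emb n g = emb n h"
  by (auto simp: emb_def extend_mat_def fun_eq_iff)

lemma emb_extend: "n \<le> N \<Longrightarrow> emb N (\<lambda>p. extend_mat n (g p)) = emb n g"
  by (auto simp: emb_def extend_mat_def fun_eq_iff)

lemma cmat_extend:
  assumes "cmat n g"
  shows "mcont S M (\<lambda>p. extend_mat n (g p) i j)"
  using assms dcont_const[OF C] by (cases "i < n \<and> j < n") (auto simp: extend_mat_def cmat_def)

lemma cmat_mmul: "cmat n g \<Longrightarrow> cmat n h \<Longrightarrow> cmat n (\<lambda>p. mmul n (g p) (h p))"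
  unfolding cmat_def mmul_def by (intro allI impI dcont_sum[OF C] dcont_times[OF C]) auto

lemma inv_pair_sym: "inv_pair n g h \<Longrightarrow> inv_pair n h g"
  by (auto simp: inv_pair_def)

lemma inv_pair_extend: "inv_pair n g h \<Longrightarrow> n \<le> N \<Longrightarrow> inv_pair N (\<lambda>p. extend_mat n (g p)) (\<lambda>p. extend_mat n (h p))"
  unfolding inv_pair_def
  by (auto simp: mmul_extend_mat cmat_def[of N] cmat_extend) (auto simp: extend_mat_def)

lemma emb_mult:
  assumes "cmat n g" "cmat n h"
  shows "emb n g \<otimes>\<^bsub>GL CA\<^esub> emb n h = emb n (\<lambda>p. mmul n (g p) (h p))"
proof (intro ext)
  fix i j p
  let ?x = "emb n g" and ?y = "emb n h"
  let ?t = "\<lambda>k. ?x i k \<otimes>\<^bsub>CA\<^esub> ?y k j"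
  let ?K = "{k. ?t k \<noteq> \<zero>\<^bsub>CA\<^esub>}"
  \<comment> \<open>Beyond \<open>n\<close> the factors are the identity, which still contributes at
    the indices \<open>i\<close> and \<open>j\<close>; past \<open>B\<close> every summand is
    0.\<close>
  define B where "B = Suc (max n (max i j))"
  have B: "n \<le> B" "i < B" "j < B" by (auto simp: B_def)
  have t: "?t k = (\<lambda>p\<in>points M. extend_mat n (g p) i k * extend_mat n (h p) k j)" for k
    by (auto simp: Cdf0_simps emb_def)
  have K: "?K \<subseteq> {..<B}"
  proof
    fix k assume "k \<in> ?K"
    moreover have "?t k = \<zero>\<^bsub>CA\<^esub>" if "B \<le> k"
      unfolding t using that B by (auto simp: Cdf0_simps extend_mat_def fun_eq_iff)
    ultimately show "k \<in> {..<B}" by (meson lessThan_iff mem_Collect_eq not_le)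
  qed
  have tc: "?t k \<in> carrier CA" for k
    unfolding t restrict_carrier by (intro dcont_times[OF C] cmat_extend assms)
  have "(?x \<otimes>\<^bsub>GL CA\<^esub> ?y) i j = finsum CA ?t ?K" by (simp add: GL_def)
  also have "\<dots> = (\<lambda>p\<in>points M. \<Sum>k\<in>?K. ?t k p)"
    by (rule finsum_Cdf0) (use K finite_subset tc in auto)
  finally have *: "(?x \<otimes>\<^bsub>GL CA\<^esub> ?y) i j = (\<lambda>p\<in>points M. \<Sum>k\<in>?K. ?t k p)" .
  show "(?x \<otimes>\<^bsub>GL CA\<^esub> ?y) i j p = emb n (\<lambda>p. mmul n (g p) (h p)) i j p"
  proof (cases "p \<in> points M")
    case True
    have "(\<Sum>k\<in>?K. ?t k p) = (\<Sum>k<B. ?t k p)"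
      by (rule sum.mono_neutral_left) (use K True in \<open>auto simp: Cdf0_simps(4)\<close>)
    also have "\<dots> = (\<Sum>k<B. extend_mat n (g p) i k * extend_mat n (h p) k j)"
      unfolding t using True by simp
    also have "\<dots> = extend_mat n (mmul n (g p) (h p)) i j" by (rule sum_extend_mat[OF B])
    finally show ?thesis using True unfolding * by (simp add: emb_def)
  next
    case False
    then show ?thesis unfolding * by (simp add: emb_def)
  qed
qed

lemma one_GL: "\<one>\<^bsub>GL CA\<^esub> = emb n (\<lambda>p i j. if i = j then 1 else 0)"
  by (auto simp: GL_def emb_def extend_mat_def Cdf0_simps fun_eq_iff)

lemma matrix_monoid_entry:
  assumes "x \<in> carrier (matrix_monoid CA n)" "i < n" "j < n"
  shows "x $$ (i, j) \<in> carrier CA"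
proof -
  have "x \<in> carrier_mat n n" "elements_mat x \<subseteq> carrier CA" using assms(1) by (auto simp: matrix_monoid_def)
  then show ?thesis using elements_matI[of x n n i j] assms(2,3) by blast
qed

lemma stab_emb:
  assumes "g \<in> carrier (GLn CA n)"
  shows "stab CA g = emb n (\<lambda>p i j. (g $$ (i, j)) p)" "cmat n (\<lambda>p i j. (g $$ (i, j)) p)"
    "\<exists>h. inv_pair n (\<lambda>p i j. (g $$ (i, j)) p) h"
proof -
  have ev: "(x \<otimes>\<^bsub>matrix_monoid CA n\<^esub> y) $$ (i, j) = (\<lambda>p\<in>points M. mmul n (\<lambda>i j. (x $$ (i, j)) p) (\<lambda>i j. (y $$ (i, j)) p) i j)"
    if "x \<in> carrier (matrix_monoid CA n)" "y \<in> carrier (matrix_monoid CA n)" "i < n" "j < n" for x y i j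
  proof -
    have e: "x $$ (i, k) \<otimes>\<^bsub>CA\<^esub> y $$ (k, j) \<in> carrier CA" if "k < n" for k
    proof -
      have "x $$ (i, k) \<in> carrier CA" "y $$ (k, j) \<in> carrier CA"
        using \<open>x \<in> carrier (matrix_monoid CA n)\<close> \<open>y \<in> carrier (matrix_monoid CA n)\<close> \<open>i < n\<close> \<open>j < n\<close> \<open>k < n\<close>
        by (blast intro: matrix_monoid_entry)+
      then have "mcont S M (x $$ (i, k))" "mcont S M (y $$ (k, j))"
        by (simp_all add: mcont_iff_carrier[OF man])
      then show ?thesis unfolding Cdf0_simps restrict_carrier by (intro dcont_times[OF C])
    qed
    have "(x \<otimes>\<^bsub>matrix_monoid CA n\<^esub> y) $$ (i, j) = finsum CA (\<lambda>k. x $$ (i, k) \<otimes>\<^bsub>CA\<^esub> y $$ (k, j)) {0..<n}"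
      using that by (simp add: matrix_monoid_def)
    also have "\<dots> = (\<lambda>p\<in>points M. \<Sum>k\<in>{0..<n}. (x $$ (i, k) \<otimes>\<^bsub>CA\<^esub> y $$ (k, j)) p)"
      by (rule finsum_Cdf0) (use e in auto)
    also have "\<dots> = (\<lambda>p\<in>points M. mmul n (\<lambda>i j. (x $$ (i, j)) p) (\<lambda>i j. (y $$ (i, j)) p) i j)"
      by (auto simp: mmul_def Cdf0_simps atLeast0LessThan fun_eq_iff)
    finally show ?thesis .
  qed
  obtain h where gh: "g \<in> carrier (matrix_monoid CA n)" "h \<in> carrier (matrix_monoid CA n)"
    "h \<otimes>\<^bsub>matrix_monoid CA n\<^esub> g = \<one>\<^bsub>matrix_monoid CA n\<^esub>" "g \<otimes>\<^bsub>matrix_monoid CA n\<^esub> h = \<one>\<^bsub>matrix_monoid CA n\<^esub>"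
    using assms by (auto simp: GLn_def units_of_def Units_def)
  have cm: "cmat n (\<lambda>p i j. (x $$ (i, j)) p)" and dim: "dim_row x = n" "dim_col x = n"
    and ex: "\<And>i j. i < n \<Longrightarrow> j < n \<Longrightarrow> x $$ (i, j) \<in> extensional (points M)"
    if "x \<in> carrier (matrix_monoid CA n)" for x
  proof -
    have c: "x $$ (i, j) \<in> carrier CA" if "i < n" "j < n" for i j
      by (rule matrix_monoid_entry[OF \<open>x \<in> carrier (matrix_monoid CA n)\<close> that])
    then show "cmat n (\<lambda>p i j. (x $$ (i, j)) p)" by (simp add: cmat_def mcont_iff_carrier[OF man])
    show "dim_row x = n" "dim_col x = n" using that by (auto simp: matrix_monoid_def)
    show "x $$ (i, j) \<in> extensional (points M)" if "i < n" "j < n" for i j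
      using c[OF that] by (simp add: mcont_iff_carrier[OF man])
  qed
  have "stab CA g i j = emb n (\<lambda>p i j. (g $$ (i, j)) p) i j" for i j
  proof (cases "i < n \<and> j < n")
    case True
    then show ?thesis using ex[OF gh(1), of i j] dim[OF gh(1)]
      by (auto simp: stab_def emb_def extend_mat_def extensional_def fun_eq_iff)
  next
    case False
    then show ?thesis using dim[OF gh(1)]
      by (auto simp: stab_def emb_def extend_mat_def Cdf0_simps fun_eq_iff)
  qed
  then show "stab CA g = emb n (\<lambda>p i j. (g $$ (i, j)) p)" by blast
  show "cmat n (\<lambda>p i j. (g $$ (i, j)) p)" by (rule cm[OF gh(1)])
  have "inv_pair n (\<lambda>p i j. (g $$ (i, j)) p) (\<lambda>p i j. (h $$ (i, j)) p)"
    unfolding inv_pair_def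
  proof (intro conjI cm gh ballI allI impI)
    fix p i j assume p: "p \<in> points M" and ij: "i < n" "j < n"
    have one: "(\<one>\<^bsub>matrix_monoid CA n\<^esub> $$ (i, j)) p = (if i = j then 1 else 0)"
      using p ij by (simp add: matrix_monoid_def Cdf0_simps)
    show "mmul n (\<lambda>i j. (g $$ (i, j)) p) (\<lambda>i j. (h $$ (i, j)) p) i j = (if i = j then 1 else 0)"
      using ev[OF gh(1,2) ij] p one unfolding gh(4) by simp
    show "mmul n (\<lambda>i j. (h $$ (i, j)) p) (\<lambda>i j. (g $$ (i, j)) p) i j = (if i = j then 1 else 0)"
      using ev[OF gh(2,1) ij] p one unfolding gh(3) by simp
  qed
  then show "\<exists>h. inv_pair n (\<lambda>p i j. (g $$ (i, j)) p) h" by blast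
qed

lemma emb_in_GL:
  assumes "inv_pair n g h"
  shows "emb n g \<in> carrier (GL CA)"
proof -
  let ?m = "\<lambda>g. mat n n (\<lambda>(i, j). \<lambda>p\<in>points M. g p i j) :: ('m \<Rightarrow> 'a) mat"
  have c: "?m g \<in> carrier (matrix_monoid CA n)" if "cmat n g" for g
    using that restrict_carrier by (auto simp: matrix_monoid_def elements_mat_def cmat_def)
  have m: "?m g \<otimes>\<^bsub>matrix_monoid CA n\<^esub> ?m h = \<one>\<^bsub>matrix_monoid CA n\<^esub>" if gh: "inv_pair n g h" for g h
  proof (rule eq_matI, goal_cases)
    case (1 i j)
    then have ij: "i < n" "j < n" by (auto simp: matrix_monoid_def)
    have e: "?m g $$ (i, k) \<otimes>\<^bsub>CA\<^esub> ?m h $$ (k, j) = (\<lambda>p\<in>points M. g p i k * h p k j)" if "k < n" for k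
      using ij that by (auto simp: Cdf0_simps)
    have "(?m g \<otimes>\<^bsub>matrix_monoid CA n\<^esub> ?m h) $$ (i, j) = finsum CA (\<lambda>k. ?m g $$ (i, k) \<otimes>\<^bsub>CA\<^esub> ?m h $$ (k, j)) {0..<n}"
      using ij by (simp add: matrix_monoid_def)
    also have "\<dots> = (\<lambda>p\<in>points M. \<Sum>k\<in>{0..<n}. (?m g $$ (i, k) \<otimes>\<^bsub>CA\<^esub> ?m h $$ (k, j)) p)"
    proof (rule finsum_Cdf0)
      fix k assume "k \<in> {0..<n}"
      then have "k < n" by simp
      then show "?m g $$ (i, k) \<otimes>\<^bsub>CA\<^esub> ?m h $$ (k, j) \<in> carrier CA"
        unfolding e[OF \<open>k < n\<close>] restrict_carrier using gh ij
        by (intro dcont_times[OF C]) (auto simp: inv_pair_def cmat_def)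
    qed simp
    also have "\<dots> = (\<lambda>p\<in>points M. mmul n (g p) (h p) i j)"
      by (intro restrict_ext) (simp add: mmul_def atLeast0LessThan e)
    also have "\<dots> = \<one>\<^bsub>matrix_monoid CA n\<^esub> $$ (i, j)"
      using gh ij by (auto simp: matrix_monoid_def inv_pair_def Cdf0_simps fun_eq_iff)
    finally show ?case .
  qed (auto simp: matrix_monoid_def)
  have "?m g \<in> carrier (GLn CA n)"
    using c[of g] c[of h] m[OF assms] m[OF inv_pair_sym[OF assms]] assms
    by (auto simp: GLn_def units_of_def Units_def inv_pair_def)
  moreover have "emb n g = stab CA (?m g)"
    using stab_emb(1)[OF \<open>?m g \<in> carrier (GLn CA n)\<close>]
    by (auto simp: emb_def extend_mat_def fun_eq_iff)
  ultimately show ?thesis by (auto simp: GL_def)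
qed

lemma GL_cases:
  assumes "x \<in> carrier (GL CA)"
  obtains n g h where "x = emb n g" "inv_pair n g h"
proof -
  obtain n m where m: "m \<in> carrier (GLn CA n)" "x = stab CA m" using assms by (auto simp: GL_def)
  then show thesis using stab_emb[OF m(1)] that by metis
qed

text \<open>Finitely many elements can thus be written with one common size, where products and
  inverses are those of finite matrices.\<close>

lemma GL_resize:
  assumes "x \<in> carrier (GL CA)"
  shows "\<exists>n. \<forall>N\<ge>n. \<exists>g h. x = emb N g \<and> inv_pair N g h"
proof -
  obtain n g h where gh: "x = emb n g" "inv_pair n g h" using GL_cases[OF assms] .
  have "x = emb N (\<lambda>p. extend_mat n (g p)) \<and> inv_pair N (\<lambda>p. extend_mat n (g p)) (\<lambda>p. extend_mat n (h p))" if "n \<le> N" for N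
    using gh emb_extend[OF that, of g] inv_pair_extend[OF gh(2) that] by simp
  then show ?thesis by blast
qed

lemma mmul_inverse:
  fixes a b a' b' :: "nat \<Rightarrow> nat \<Rightarrow> 'a"
  assumes "\<And>i j. i < n \<Longrightarrow> j < n \<Longrightarrow> mmul n b b' i j = (if i = j then 1 else 0)"
    "\<And>i j. i < n \<Longrightarrow> j < n \<Longrightarrow> mmul n a a' i j = (if i = j then 1 else 0)" "i < n" "j < n"
  shows "mmul n (mmul n a b) (mmul n b' a') i j = (if i = j then 1 else 0)"
proof -
  have "mmul n b (mmul n b' a') k j = a' k j" if "k < n" for k
  proof -
    have "mmul n b (mmul n b' a') k j = (\<Sum>l<n. mmul n b b' k l * a' l j)"
      unfolding mmul_assoc[symmetric] by (simp add: mmul_def[of n "mmul n b b'"])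
    also have "\<dots> = (\<Sum>l<n. if l = k then a' l j else 0)"
      using that assms(1) by (intro sum.cong) auto
    finally show ?thesis using that by simp
  qed
  then have "mmul n a (mmul n b (mmul n b' a')) i j = mmul n a a' i j" by (intro mmul_cong) auto
  then show ?thesis using assms(2-4) by (simp add: mmul_assoc)
qed

lemma inv_pair_mmul:
  assumes "inv_pair n g h" "inv_pair n g' h'"
  shows "inv_pair n (\<lambda>p. mmul n (g p) (g' p)) (\<lambda>p. mmul n (h' p) (h p))"
  unfolding inv_pair_def
proof (intro conjI ballI allI impI)
  show "cmat n (\<lambda>p. mmul n (g p) (g' p))" "cmat n (\<lambda>p. mmul n (h' p) (h p))"
    using assms by (auto simp: inv_pair_def intro!: cmat_mmul)
  fix p i j assume "p \<in> points M" "i < n" "j < n"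
  then show "mmul n (mmul n (g p) (g' p)) (mmul n (h' p) (h p)) i j = (if i = j then 1 else 0)"
    "mmul n (mmul n (h' p) (h p)) (mmul n (g p) (g' p)) i j = (if i = j then 1 else 0)"
    using assms unfolding inv_pair_def by (intro mmul_inverse; simp)+
qed

lemma group_GL: "group (GL CA)"
proof (rule groupI)
  fix x y assume x: "x \<in> carrier (GL CA)" and y: "y \<in> carrier (GL CA)"
  obtain n1 where n1: "\<And>N. N \<ge> n1 \<Longrightarrow> \<exists>g h. x = emb N g \<and> inv_pair N g h" using GL_resize[OF x] by blast
  obtain n2 where n2: "\<And>N. N \<ge> n2 \<Longrightarrow> \<exists>g h. y = emb N g \<and> inv_pair N g h" using GL_resize[OF y] by blast
  define N where "N = max n1 n2"
  obtain g h g' h' where g: "x = emb N g" "inv_pair N g h" "y = emb N g'" "inv_pair N g' h'"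
    using n1[of N] n2[of N] by (auto simp: N_def)
  have "x \<otimes>\<^bsub>GL CA\<^esub> y = emb N (\<lambda>p. mmul N (g p) (g' p))"
    using g by (simp add: emb_mult inv_pair_def)
  then show "x \<otimes>\<^bsub>GL CA\<^esub> y \<in> carrier (GL CA)"
    using emb_in_GL[OF inv_pair_mmul[OF g(2,4)]] by simp
  fix z assume z: "z \<in> carrier (GL CA)"
  obtain n3 where n3: "\<And>N. N \<ge> n3 \<Longrightarrow> \<exists>g h. z = emb N g \<and> inv_pair N g h" using GL_resize[OF z] by blast
  define N where "N = max n1 (max n2 n3)"
  have N: "n1 \<le> N" "n2 \<le> N" "n3 \<le> N" by (auto simp: N_def)
  obtain a a' where "x = emb N a" "inv_pair N a a'" using n1[OF N(1)] by blast
  moreover obtain b b' where "y = emb N b" "inv_pair N b b'" using n2[OF N(2)] by blast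
  moreover obtain c c' where "z = emb N c" "inv_pair N c c'" using n3[OF N(3)] by blast
  ultimately have g: "x = emb N a" "inv_pair N a a'" "y = emb N b" "inv_pair N b b'" "z = emb N c" "inv_pair N c c'" .
  have c: "cmat N a" "cmat N b" "cmat N c" using g by (auto simp: inv_pair_def)
  show "x \<otimes>\<^bsub>GL CA\<^esub> y \<otimes>\<^bsub>GL CA\<^esub> z = x \<otimes>\<^bsub>GL CA\<^esub> (y \<otimes>\<^bsub>GL CA\<^esub> z)"
    unfolding g(1,3,5) emb_mult[OF c(1,2)] emb_mult[OF c(2,3)] emb_mult[OF cmat_mmul[OF c(1,2)] c(3)]
      emb_mult[OF c(1) cmat_mmul[OF c(2,3)]]
    by (rule emb_cong) (rule mmul_assoc)
next
  have "inv_pair 0 (\<lambda>p i j. if i = j then 1 else 0) (\<lambda>p i j. if i = j then 1 else 0)" by (simp add: inv_pair_def cmat_def)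
  then show "\<one>\<^bsub>GL CA\<^esub> \<in> carrier (GL CA)" unfolding one_GL[of 0] by (rule emb_in_GL)
next
  fix x assume "x \<in> carrier (GL CA)"
  then obtain n g h where g: "x = emb n g" "inv_pair n g h" using GL_cases by metis
  have c: "cmat n g" "cmat n h" using g by (auto simp: inv_pair_def)
  have c1: "cmat n (\<lambda>p i j. if i = j then 1 else 0)" by (auto simp: cmat_def intro: dcont_const[OF C])
  show "\<one>\<^bsub>GL CA\<^esub> \<otimes>\<^bsub>GL CA\<^esub> x = x"
    unfolding one_GL[of n] g(1) emb_mult[OF c1 c(1)]
    by (rule emb_cong) (simp add: mmul_def if_distrib[of "\<lambda>x. x * _"] cong: if_cong)
  have "emb n h \<otimes>\<^bsub>GL CA\<^esub> x = \<one>\<^bsub>GL CA\<^esub>"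
    unfolding one_GL[of n] g(1) emb_mult[OF c(2,1)]
    by (rule emb_cong) (use g(2) in \<open>auto simp: inv_pair_def\<close>)
  then show "\<exists>y\<in>carrier (GL CA). y \<otimes>\<^bsub>GL CA\<^esub> x = \<one>\<^bsub>GL CA\<^esub>"
    using emb_in_GL[OF inv_pair_sym[OF g(2)]] by blast
qed

section \<open>The abelianisation of the general linear group\<close>

definition kap :: "(nat \<Rightarrow> nat \<Rightarrow> 'm \<Rightarrow> 'a) \<Rightarrow> (nat \<Rightarrow> nat \<Rightarrow> 'm \<Rightarrow> 'a) set" where
  "kap x = Comm CA #>\<^bsub>GL CA\<^esub> x"

text \<open>Cosets are taken in GL and not in SL, since the factors produced by elimination need not
  have determinant 1.\<close>

abbreviation "QG \<equiv> GL CA Mod Comm CA"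

lemma comm_group_QG: "comm_group QG"
  unfolding Comm_def by (rule group.derived_quot_is_comm_group[OF group_GL])

lemma kap_hom: "kap \<in> hom (GL CA) QG"
  unfolding kap_def Comm_def
  by (rule normal.r_coset_hom_Mod) (rule group.derived_self_is_normal[OF group_GL])

lemma kap_mult: "x \<in> carrier (GL CA) \<Longrightarrow> y \<in> carrier (GL CA) \<Longrightarrow> kap (x \<otimes>\<^bsub>GL CA\<^esub> y) = kap x \<otimes>\<^bsub>QG\<^esub> kap y"
  by (rule hom_mult[OF kap_hom])

lemma kap_closed: "x \<in> carrier (GL CA) \<Longrightarrow> kap x \<in> carrier QG"
  using kap_hom by (rule hom_in_carrier)

lemma kap_one: "kap \<one>\<^bsub>GL CA\<^esub> = \<one>\<^bsub>QG\<^esub>"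
proof -
  interpret Q: comm_group QG by (rule comm_group_QG)
  show ?thesis by (rule hom_one[OF kap_hom group_GL Q.group_axioms])
qed

lemma kap_conj:
  assumes "s \<in> carrier (GL CA)" "x \<in> carrier (GL CA)" "y \<in> carrier (GL CA)" "s \<otimes>\<^bsub>GL CA\<^esub> x = y \<otimes>\<^bsub>GL CA\<^esub> s"
  shows "kap x = kap y"
proof -
  interpret Q: comm_group QG by (rule comm_group_QG)
  have "kap s \<otimes>\<^bsub>QG\<^esub> kap x = kap y \<otimes>\<^bsub>QG\<^esub> kap s"
    using assms kap_mult by metis
  then have "kap s \<otimes>\<^bsub>QG\<^esub> kap x = kap s \<otimes>\<^bsub>QG\<^esub> kap y" using assms kap_closed Q.m_comm by metis
  then show ?thesis using assms kap_closed by (metis Q.Units_l_cancel Q.Units_eq)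
qed

text \<open>Conjugate elements have the same class in an abelian quotient, so the class of x equals
  its own square.\<close>

lemma kap_square_conj:
  assumes "s \<in> carrier (GL CA)" "x \<in> carrier (GL CA)" "s \<otimes>\<^bsub>GL CA\<^esub> x = (x \<otimes>\<^bsub>GL CA\<^esub> x) \<otimes>\<^bsub>GL CA\<^esub> s"
  shows "kap x = \<one>\<^bsub>QG\<^esub>"
proof -
  interpret Q: comm_group QG by (rule comm_group_QG)
  interpret G: group "GL CA" by (rule group_GL)
  have "kap x = kap (x \<otimes>\<^bsub>GL CA\<^esub> x)" by (rule kap_conj[OF assms(1,2) _ assms(3)]) (use assms in simp)
  also have "\<dots> = kap x \<otimes>\<^bsub>QG\<^esub> kap x" by (rule kap_mult[OF assms(2,2)])
  finally show ?thesis using kap_closed[OF assms(2)] by (metis Q.l_cancel_one')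
qed

lemma mcont_if:
  "(b \<Longrightarrow> mcont S M f) \<Longrightarrow> (\<not> b \<Longrightarrow> mcont S M h) \<Longrightarrow> mcont S M (\<lambda>p. if b then f p else h p)"
  by (cases b) simp_all

text \<open>Conjugation by the matrix \<open>?P\<close> of the transposition of 0 and n moves the
  entry to the first place, where the matrix is the stabilisation of a 1 x 1 matrix.\<close>

lemma kap_diag_last:
  assumes u: "mcont S M u" and nz: "\<And>p. p \<in> points M \<Longrightarrow> u p \<noteq> 0"
  defines "D \<equiv> \<lambda>k p i j. if i = j then (if i = k then u p else 1) else 0"
  shows "emb (Suc n) (D n) \<in> carrier (GL CA)" "kap (emb (Suc n) (D n)) = kap (emb 1 (\<lambda>p i j. u p))"
proof -
  let ?D = "\<lambda>u k p i j. if i = j then (if i = k then u p else 1) else (0::'a)"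
  have v: "mcont S M (\<lambda>p. inverse (u p))"
    by (rule dcont_inverse[OF C u]) (simp add: nz topspace_manifold_topology[OF man])
  have c: "cmat N (?D f k)" if "mcont S M f" for f N k
    unfolding cmat_def by (intro allI impI mcont_if that dcont_const[OF C])
  have ip: "inv_pair N (?D u k) (?D (\<lambda>p. inverse (u p)) k)" for N k
    unfolding inv_pair_def
  proof (intro conjI c u v ballI allI impI)
    fix p i j assume "p \<in> points M" "i < N" "j < N"
    then show "mmul N (?D u k p) (?D (\<lambda>p. inverse (u p)) k p) i j = (if i = j then 1 else 0)"
      "mmul N (?D (\<lambda>p. inverse (u p)) k p) (?D u k p) i j = (if i = j then 1 else 0)"
      using nz[of p] by (auto simp: mmul_def if_distrib[of "\<lambda>x. x * _"] cong: if_cong)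
  qed
  have G: "emb N (D k) \<in> carrier (GL CA)" for N k
    unfolding D_def by (rule emb_in_GL[OF ip])
  then show "emb (Suc n) (D n) \<in> carrier (GL CA)" .
  let ?\<sigma> = "\<lambda>i::nat. if i = 0 then n else if i = n then 0 else i"
  let ?P = "\<lambda>(p::'m) i j. if j = ?\<sigma> i then 1 else (0::'a)"
  have cP: "cmat (Suc n) ?P" by (auto simp: cmat_def intro: dcont_const[OF C])
  have P: "mmul (Suc n) (?P p) g i j = g (?\<sigma> i) j" "mmul (Suc n) g (?P p) i j = g i (?\<sigma> j)"
    if "i < Suc n" "j < Suc n" for g :: "nat \<Rightarrow> nat \<Rightarrow> 'a" and p :: 'm and i j
  proof -
    have "(\<Sum>k<Suc n. ?P p i k * g k j) = (\<Sum>k<Suc n. if k = ?\<sigma> i then g k j else 0)"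
      by (intro sum.cong) auto
    then show "mmul (Suc n) (?P p) g i j = g (?\<sigma> i) j" using that by (simp add: mmul_def del: sum.lessThan_Suc)
    have "(\<Sum>k<Suc n. g i k * ?P p k j) = (\<Sum>k<Suc n. if k = ?\<sigma> j then g i k else 0)"
      by (intro sum.cong) auto
    then show "mmul (Suc n) g (?P p) i j = g i (?\<sigma> j)" using that by (simp add: mmul_def del: sum.lessThan_Suc)
  qed
  have "inv_pair (Suc n) ?P ?P"
    unfolding inv_pair_def by (intro conjI cP ballI allI impI) (auto simp: P)
  then have GP: "emb (Suc n) ?P \<in> carrier (GL CA)" by (rule emb_in_GL)
  have "kap (emb (Suc n) (D n)) = kap (emb (Suc n) (D 0))"
  proof (rule kap_conj[OF GP G G])
    have cD: "cmat (Suc n) (D k)" for k unfolding D_def by (rule c[OF u])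
    show "emb (Suc n) ?P \<otimes>\<^bsub>GL CA\<^esub> emb (Suc n) (D n) = emb (Suc n) (D 0) \<otimes>\<^bsub>GL CA\<^esub> emb (Suc n) ?P"
      unfolding emb_mult[OF cP cD] emb_mult[OF cD cP]
      by (rule emb_cong) (auto simp: P D_def)
  qed
  also have "emb (Suc n) (D 0) = emb 1 (\<lambda>p i j. u p)"
    by (auto simp: emb_def extend_mat_def D_def fun_eq_iff)
  finally show "kap (emb (Suc n) (D n)) = kap (emb 1 (\<lambda>p i j. u p))" .
qed

text \<open>Conjugation by \<open>diag(2, \<dots>, 2, 1)\<close> or \<open>diag(1, \<dots>, 1, 2)\<close> squares the matrix.\<close>

lemma kap_elementary:
  assumes c: "\<And>i. i < n \<Longrightarrow> mcont S M (\<lambda>p. c p i)"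
  defines "L \<equiv> \<lambda>p i j. if i = j then 1 else if i < n \<and> j = n then c p i else 0"
    and "R \<equiv> \<lambda>p i j. if i = j then 1 else if i = n \<and> j < n then c p j else 0"
  shows "emb (Suc n) L \<in> carrier (GL CA)" "kap (emb (Suc n) L) = \<one>\<^bsub>QG\<^esub>"
    "emb (Suc n) R \<in> carrier (GL CA)" "kap (emb (Suc n) R) = \<one>\<^bsub>QG\<^esub>"
proof -
  let ?L = "\<lambda>c p i j. if i = j then 1 else if i < n \<and> j = n then c p i else (0::'a)"
  let ?R = "\<lambda>c p i j. if i = j then 1 else if i = n \<and> j < n then c p j else (0::'a)"
  let ?S = "\<lambda>(a::'a) b (p::'m) i j. if i = j then (if i < n then a else b) else (0::'a)"
  have cm: "cmat (Suc n) (?L d)" "cmat (Suc n) (?R d)" if "\<And>i. i < n \<Longrightarrow> mcont S M (\<lambda>p. d p i)" for d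
    unfolding cmat_def by (intro allI impI mcont_if dcont_const[OF C] that; simp)+
  have d: "mcont S M (\<lambda>p. - c p i)" if "i < n" for i by (intro dcont_uminus[OF C] c that)
  let ?l = "\<lambda>d i j. if i = j then 1 else if i < n \<and> j = n then d i else (0::'a)"
  let ?r = "\<lambda>d i j. if i = j then 1 else if i = n \<and> j < n then d j else (0::'a)"
  have Lm: "mmul (Suc n) (?l d) g i j = (if i < n then g i j + d i * g n j else g i j)"
    and Rm: "mmul (Suc n) g (?r d) i j = (if j < n then g i j + g i n * d j else g i j)"
    if "i < Suc n" "j < Suc n" for d i j and g :: "nat \<Rightarrow> nat \<Rightarrow> 'a"
  proof -
    have "(\<Sum>k<n. ?l d i k * g k j) = (\<Sum>k<n. if k = i then g i j else 0)" by (intro sum.cong) auto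
    then show "mmul (Suc n) (?l d) g i j = (if i < n then g i j + d i * g n j else g i j)"
      using that by (auto simp: mmul_def less_Suc_eq)
    have "(\<Sum>k<n. g i k * ?r d k j) = (\<Sum>k<n. if k = j then g i j else 0)" by (intro sum.cong) auto
    then show "mmul (Suc n) g (?r d) i j = (if j < n then g i j + g i n * d j else g i j)"
      using that by (auto simp: mmul_def less_Suc_eq)
  qed
  have Sm: "mmul (Suc n) (?S a b p) g i j = (if i < n then a else b) * g i j"
    "mmul (Suc n) g (?S a b p) i j = g i j * (if j < n then a else b)"
    if "i < Suc n" "j < Suc n" for a b i j and p :: 'm and g :: "nat \<Rightarrow> nat \<Rightarrow> 'a"
  proof -
    have "(\<Sum>k<Suc n. ?S a b p i k * g k j) = (\<Sum>k<Suc n. if k = i then (if i < n then a else b) * g i j else 0)"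
      by (intro sum.cong) auto
    then show "mmul (Suc n) (?S a b p) g i j = (if i < n then a else b) * g i j"
      using that by (simp add: mmul_def del: sum.lessThan_Suc)
    have "(\<Sum>k<Suc n. g i k * ?S a b p k j) = (\<Sum>k<Suc n. if k = j then g i j * (if j < n then a else b) else 0)"
      by (intro sum.cong) auto
    then show "mmul (Suc n) g (?S a b p) i j = g i j * (if j < n then a else b)"
      using that by (simp add: mmul_def del: sum.lessThan_Suc)
  qed
  have cS: "cmat (Suc n) (?S a b)" for a b by (auto simp: cmat_def intro: dcont_const[OF C])
  have "inv_pair (Suc n) (?L c) (?L (\<lambda>p i. - c p i))"
    unfolding inv_pair_def by (intro conjI cm c d ballI allI impI) (auto simp: Lm)
  then show GL: "emb (Suc n) L \<in> carrier (GL CA)" unfolding L_def by (rule emb_in_GL)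
  have "inv_pair (Suc n) (?R c) (?R (\<lambda>p i. - c p i))"
    unfolding inv_pair_def by (intro conjI cm c d ballI allI impI) (auto simp: Rm)
  then show GR: "emb (Suc n) R \<in> carrier (GL CA)" unfolding R_def by (rule emb_in_GL)
  have GS: "emb (Suc n) (?S a b) \<in> carrier (GL CA)" if "a \<noteq> 0" "b \<noteq> 0" for a b
  proof (rule emb_in_GL)
    show "inv_pair (Suc n) (?S a b) (?S (1 / a) (1 / b))"
      unfolding inv_pair_def by (intro conjI cS ballI allI impI) (use that in \<open>auto simp: Sm\<close>)
  qed
  have cL: "cmat (Suc n) L" and cR: "cmat (Suc n) R" unfolding L_def R_def by (intro cm c; assumption)+
  show "kap (emb (Suc n) L) = \<one>\<^bsub>QG\<^esub>"
  proof (rule kap_square_conj[OF GS[of 2 1] GL])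
    show "emb (Suc n) (?S 2 1) \<otimes>\<^bsub>GL CA\<^esub> emb (Suc n) L =
        emb (Suc n) L \<otimes>\<^bsub>GL CA\<^esub> emb (Suc n) L \<otimes>\<^bsub>GL CA\<^esub> emb (Suc n) (?S 2 1)"
      unfolding emb_mult[OF cS cL] emb_mult[OF cL cL] emb_mult[OF cmat_mmul[OF cL cL] cS]
      by (rule emb_cong) (auto simp: Sm Lm L_def)
  qed auto
  show "kap (emb (Suc n) R) = \<one>\<^bsub>QG\<^esub>"
  proof (rule kap_square_conj[OF GS[of 1 2] GR])
    show "emb (Suc n) (?S 1 2) \<otimes>\<^bsub>GL CA\<^esub> emb (Suc n) R =
        emb (Suc n) R \<otimes>\<^bsub>GL CA\<^esub> emb (Suc n) R \<otimes>\<^bsub>GL CA\<^esub> emb (Suc n) (?S 1 2)"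
      unfolding emb_mult[OF cS cR] emb_mult[OF cR cR] emb_mult[OF cmat_mmul[OF cR cR] cS]
      by (rule emb_cong) (auto simp: Sm Rm R_def)
  qed auto
qed


text \<open>One elimination step writes g as a product of an elementary column factor, the Schur
  complement, a diagonal matrix carrying the pivot, and an elementary row factor. The elementary
  factors have trivial class, and the pivots multiply as 1 x 1 matrices.\<close>

lemma kap_nonzero_pivots:
  assumes "cmat n g" "\<And>p. p \<in> points M \<Longrightarrow> nonzero_pivots n (g p)"
  shows "emb n g \<in> carrier (GL CA) \<and> mcont S M (\<lambda>p. pivot_prod n (g p)) \<and>
    kap (emb n g) = kap (emb 1 (\<lambda>p i j. pivot_prod n (g p)))"
  using assms
proof (induction n arbitrary: g)
  case 0
  have "emb 0 g = emb 1 (\<lambda>p i j. pivot_prod 0 (g p))"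
    by (auto simp: emb_def extend_mat_def fun_eq_iff)
  moreover have "inv_pair 0 g g" using 0 by (simp add: inv_pair_def)
  ultimately show ?case using emb_in_GL[of 0 g g] by (simp add: dcont_const[OF C])
next
  case (Suc n)
  interpret Q: comm_group QG by (rule comm_group_QG)
  interpret G: group "GL CA" by (rule group_GL)
  have g: "mcont S M (\<lambda>p. g p i j)" if "i \<le> n" "j \<le> n" for i j
    using Suc.prems(1) that by (simp add: cmat_def)
  have nz: "g p n n \<noteq> 0" if "p \<in> points M" for p using Suc.prems(2)[OF that] by simp
  have div: "mcont S M (\<lambda>p. g p i j / g p n n)" if "i \<le> n" "j \<le> n" for i j
    by (intro dcont_divide[OF C] g that order_refl) (simp add: nz topspace_manifold_topology[OF man])
  let ?h = "\<lambda>p. schur n (g p)"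
  have h: "cmat n ?h"
    unfolding cmat_def schur_def
    by (intro allI impI dcont_minus[OF C] dcont_divide[OF C] dcont_times[OF C] g)
      (auto simp: nz topspace_manifold_topology[OF man])
  have IH: "emb n ?h \<in> carrier (GL CA)" "mcont S M (\<lambda>p. pivot_prod n (?h p))"
    "kap (emb n ?h) = kap (emb 1 (\<lambda>p i j. pivot_prod n (?h p)))"
    using Suc.IH[OF h] Suc.prems(2) by auto
  let ?L = "\<lambda>p i j. if i = j then 1 else if i < n \<and> j = n then g p i n / g p n n else (0::'a)"
  let ?R = "\<lambda>p i j. if i = j then 1 else if i = n \<and> j < n then g p n j / g p n n else (0::'a)"
  let ?D = "\<lambda>p i j. if i = j then (if i = n then g p n n else 1) else (0::'a)"
  let ?e = "emb (Suc n)"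
  note L = kap_elementary(1,2)[of n "\<lambda>p i. g p i n / g p n n"]
  note R = kap_elementary(3,4)[of n "\<lambda>p j. g p n j / g p n n"]
  have L: "?e ?L \<in> carrier (GL CA)" "kap (?e ?L) = \<one>\<^bsub>QG\<^esub>" by (rule L; simp add: div)+
  have R: "?e ?R \<in> carrier (GL CA)" "kap (?e ?R) = \<one>\<^bsub>QG\<^esub>" by (rule R; simp add: div)+
  have D: "?e ?D \<in> carrier (GL CA)" "kap (?e ?D) = kap (emb 1 (\<lambda>p i j. g p n n))"
    using kap_diag_last[OF g[OF order_refl order_refl] nz, of n] by simp_all
  let ?H = "\<lambda>p. extend_mat n (?h p)"
  have H: "?e ?H = emb n ?h" by (rule emb_extend) simp
  have cL: "cmat (Suc n) ?L" and cR: "cmat (Suc n) ?R" and cD: "cmat (Suc n) ?D" and cH: "cmat (Suc n) ?H"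
    unfolding cmat_def
    by (intro allI impI mcont_if dcont_const[OF C] div g; simp)+ (simp add: cmat_extend[OF h])
  \<comment> \<open>\<open>?H\<close>, the stabilised Schur complement, times \<open>?D\<close> is
    block diagonal; \<open>?R\<close> restores the last row of g, and \<open>?L\<close> the last
    column together with the correction term of the Schur complement.\<close>
  have "?e g = ?e ?L \<otimes>\<^bsub>GL CA\<^esub> (emb n ?h \<otimes>\<^bsub>GL CA\<^esub> ?e ?D \<otimes>\<^bsub>GL CA\<^esub> ?e ?R)"
    unfolding H[symmetric] emb_mult[OF cH cD] emb_mult[OF cmat_mmul[OF cH cD] cR]
      emb_mult[OF cL cmat_mmul[OF cmat_mmul[OF cH cD] cR]]
  proof (rule emb_cong)
    fix p i j assume p: "p \<in> points M" and ij: "i < Suc n" "j < Suc n"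
    have HD: "mmul (Suc n) (?H p) (?D p) i j = (if i < n \<and> j < n then ?h p i j else if i = j then g p n n else 0)"
      if "i < Suc n" "j < Suc n" for i j
    proof -
      have "(\<Sum>k<Suc n. ?H p i k * ?D p k j) = (\<Sum>k<Suc n. if k = j then ?H p i j * ?D p j j else 0)"
        by (intro sum.cong) auto
      also have "\<dots> = ?H p i j * ?D p j j" using that by (simp del: sum.lessThan_Suc)
      finally show ?thesis using that by (auto simp: mmul_def extend_mat_def less_Suc_eq)
    qed
    have HDR: "mmul (Suc n) (mmul (Suc n) (?H p) (?D p)) (?R p) i j =
        (if i < n \<and> j < n then ?h p i j else if i = n then g p n j else 0)"
      if "i < Suc n" "j < Suc n" for i j
    proof -
      have "(\<Sum>k<n. mmul (Suc n) (?H p) (?D p) i k * ?R p k j) =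
          (\<Sum>k<n. if k = j then mmul (Suc n) (?H p) (?D p) i j else 0)"
        by (intro sum.cong) auto
      then have "mmul (Suc n) (mmul (Suc n) (?H p) (?D p)) (?R p) i j =
          (if j < n then mmul (Suc n) (?H p) (?D p) i j else 0) + mmul (Suc n) (?H p) (?D p) i n * ?R p n j"
        by (simp add: mmul_def[of "Suc n" "mmul _ _ _"])
      then show ?thesis using that nz[OF p] by (auto simp: HD less_Suc_eq)
    qed
    let ?B = "mmul (Suc n) (mmul (Suc n) (?H p) (?D p)) (?R p)"
    have "(\<Sum>k<n. ?L p i k * ?B k j) = (\<Sum>k<n. if k = i then ?B i j else 0)"
      by (intro sum.cong) auto
    then have "mmul (Suc n) (?L p) ?B i j = (if i < n then ?B i j else 0) + ?L p i n * ?B n j"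
      by (simp add: mmul_def[of "Suc n" "?L p"])
    then show "g p i j = mmul (Suc n) (?L p) ?B i j"
      using ij nz[OF p] by (auto simp: HDR less_Suc_eq schur_def)
  qed
  then have e: "?e g = ?e ?L \<otimes>\<^bsub>GL CA\<^esub> (emb n ?h \<otimes>\<^bsub>GL CA\<^esub> ?e ?D \<otimes>\<^bsub>GL CA\<^esub> ?e ?R)" .
  have c1: "cmat 1 (\<lambda>p i j. pivot_prod n (?h p))" "cmat 1 (\<lambda>p i j. g p n n)"
    using IH(2) g[of n n] by (simp_all add: cmat_def)
  \<comment> \<open>A 1 x 1 product: the pivot product is split off by its last factor without any
    matrix identity.\<close>
  have "emb 1 (\<lambda>p i j. pivot_prod (Suc n) (g p)) =
      emb 1 (\<lambda>p i j. pivot_prod n (?h p)) \<otimes>\<^bsub>GL CA\<^esub> emb 1 (\<lambda>p i j. g p n n)"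
    unfolding emb_mult[OF c1] by (rule emb_cong) (simp add: mmul_def)
  moreover have inv1: "emb 1 (\<lambda>p i j. f p) \<in> carrier (GL CA)"
    if "mcont S M f" "\<And>p. p \<in> points M \<Longrightarrow> f p \<noteq> 0" for f
  proof (rule emb_in_GL)
    have "mcont S M (\<lambda>p. inverse (f p))"
      by (rule dcont_inverse[OF C that(1)]) (simp add: that(2) topspace_manifold_topology[OF man])
    then show "inv_pair 1 (\<lambda>p i j. f p) (\<lambda>p i j. inverse (f p))"
      using that by (simp add: inv_pair_def cmat_def mmul_def)
  qed
  moreover have "pivot_prod n (?h p) \<noteq> 0" if "p \<in> points M" for p
    using Suc.prems(2)[OF that] pivot_prod_nonzero[of n "?h p"] by simp
  ultimately have "kap (emb 1 (\<lambda>p i j. pivot_prod (Suc n) (g p))) = kap (emb n ?h) \<otimes>\<^bsub>QG\<^esub> kap (?e ?D)"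
    using IH(2,3) D(2) g[of n n] nz by (simp add: kap_mult)
  moreover have "kap (?e g) = kap (emb n ?h) \<otimes>\<^bsub>QG\<^esub> kap (?e ?D)"
  proof -
    have "kap (?e g) = kap (?e ?L) \<otimes>\<^bsub>QG\<^esub> (kap (emb n ?h) \<otimes>\<^bsub>QG\<^esub> kap (?e ?D) \<otimes>\<^bsub>QG\<^esub> kap (?e ?R))"
      unfolding e using L(1) R(1) D(1) IH(1) by (simp only: kap_mult G.m_closed)
    also have "\<dots> = kap (emb n ?h) \<otimes>\<^bsub>QG\<^esub> kap (?e ?D)"
      unfolding L(2) R(2) using kap_closed[OF IH(1)] kap_closed[OF D(1)]
      by (simp only: Q.l_one Q.r_one Q.m_closed)
    finally show ?thesis .
  qed
  moreover have "?e g \<in> carrier (GL CA)" unfolding e using L R D(1) IH(1) by simp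
  moreover have "mcont S M (\<lambda>p. pivot_prod (Suc n) (g p))"
    using dcont_times[OF C IH(2) g[OF order_refl order_refl]] by simp
  ultimately show ?case by simp
qed

lemma kap_unit_pivots:
  assumes "cmat n g" "\<And>p. p \<in> points M \<Longrightarrow> nonzero_pivots n (g p) \<and> pivot_prod n (g p) = 1"
  shows "emb n g \<in> carrier (GL CA)" "kap (emb n g) = \<one>\<^bsub>QG\<^esub>"
proof -
  note k = kap_nonzero_pivots[OF assms(1)]
  show "emb n g \<in> carrier (GL CA)" using k assms(2) by blast
  have "emb 1 (\<lambda>p i j. pivot_prod n (g p)) = \<one>\<^bsub>GL CA\<^esub>"
    unfolding one_GL[of 1] by (rule emb_cong) (simp add: assms(2))
  then show "kap (emb n g) = \<one>\<^bsub>QG\<^esub>" using k assms(2) kap_one by metis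
qed

section \<open>Classes of orthogonal factors\<close>

lemma orthogonal_mat_mmul:
  fixes q :: "nat \<Rightarrow> nat \<Rightarrow> 'b::field"
  assumes "orthogonal_mat n q" "i < n" "j < n"
  shows "mmul n (\<lambda>i j. q j i) q i j = (if i = j then 1 else 0)"
    "mmul n q (\<lambda>i j. q j i) i j = (if i = j then 1 else 0)"
proof -
  have m: "mmul n (\<lambda>i j. q j i) q i j = (if i = j then 1 else 0)" if "i < n" "j < n" for i j
    using assms(1) that by (simp add: orthogonal_mat_def mmul_def)
  then show "mmul n (\<lambda>i j. q j i) q i j = (if i = j then 1 else 0)" using assms by blast
  have "sqmat n (\<lambda>i j. q j i) * sqmat n q = 1\<^sub>m n"
    unfolding sqmat_mult by (rule eq_matI) (simp_all add: m)
  then have "sqmat n q * sqmat n (\<lambda>i j. q j i) = 1\<^sub>m n"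
    by (rule mat_mult_left_right_inverse[rotated 2]) auto
  from arg_cong[OF this[unfolded sqmat_mult], of "\<lambda>m. m $$ (i, j)"]
  show "mmul n q (\<lambda>i j. q j i) i j = (if i = j then 1 else 0)" using assms by simp
qed

lemma emb_orthogonal:
  assumes "cmat n q" "\<And>p. p \<in> points M \<Longrightarrow> orthogonal_mat n (q p)"
  shows "emb n q \<in> carrier (GL CA)"
proof (rule emb_in_GL)
  show "inv_pair n q (\<lambda>p i j. q p j i)"
    using assms by (auto simp: inv_pair_def cmat_def orthogonal_mat_mmul)
qed

text \<open>g = q (q^T g), and the second factor reduces to a 1 x 1 matrix with entry 1.\<close>

lemma kap_orthogonal_factor:
  assumes q: "cmat n q" "\<And>p. p \<in> points M \<Longrightarrow> orthogonal_mat n (q p)" and g: "cmat n g"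
    and pivots: "\<And>p. p \<in> points M \<Longrightarrow>
      nonzero_pivots n (mmul n (\<lambda>i j. q p j i) (g p)) \<and> pivot_prod n (mmul n (\<lambda>i j. q p j i) (g p)) = 1"
  shows "kap (emb n g) = kap (emb n q)"
proof -
  interpret Q: comm_group QG by (rule comm_group_QG)
  let ?t = "\<lambda>p. mmul n (\<lambda>i j. q p j i) (g p)"
  have qt: "cmat n (\<lambda>p i j. q p j i)" using q(1) by (simp add: cmat_def)
  have t: "cmat n ?t" by (rule cmat_mmul[OF qt g])
  have kt: "emb n ?t \<in> carrier (GL CA)" "kap (emb n ?t) = \<one>\<^bsub>QG\<^esub>"
    by (rule kap_unit_pivots[OF t]; use pivots in blast)+
  have Q: "emb n q \<in> carrier (GL CA)" by (rule emb_orthogonal[OF q])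
  have "emb n q \<otimes>\<^bsub>GL CA\<^esub> emb n ?t = emb n g"
    unfolding emb_mult[OF q(1) t]
  proof (rule emb_cong)
    fix p i j assume p: "p \<in> points M" and ij: "i < n" "j < n"
    have "mmul n (q p) (?t p) i j = (\<Sum>k<n. mmul n (q p) (\<lambda>i j. q p j i) i k * g p k j)"
      unfolding mmul_assoc[symmetric] by (simp add: mmul_def[of n "mmul n _ _"])
    also have "\<dots> = (\<Sum>k<n. if k = i then g p k j else 0)"
      by (intro sum.cong refl) (use ij orthogonal_mat_mmul(2)[OF q(2)[OF p]] in auto)
    finally show "mmul n (q p) (?t p) i j = g p i j" using ij by simp
  qed
  then have "kap (emb n g) = kap (emb n q) \<otimes>\<^bsub>QG\<^esub> kap (emb n ?t)" using kap_mult[OF Q kt(1)] by simp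
  also have "\<dots> = kap (emb n q)" unfolding kt(2) by (rule Q.r_one[OF kap_closed[OF Q]])
  finally show ?thesis .
qed

text \<open>Here q^T g is the upper triangular factor, whose pivots are its diagonal entries, with
  product 1.\<close>

lemma kap_qr:
  assumes g: "cmat n g" and q: "cmat n (\<lambda>p. qr_q n (g p))"
    and det: "\<And>p. p \<in> points M \<Longrightarrow> det (sqmat n (g p)) = 1"
  shows "kap (emb n g) = kap (emb n (\<lambda>p. qr_q n (g p)))"
proof (rule kap_orthogonal_factor[OF q _ g])
  fix p assume p: "p \<in> points M"
  note qr = qr_decomposition[OF det[OF p]]
  show "orthogonal_mat n (qr_q n (g p))" by (rule qr(2))
  let ?q = "qr_q n (g p)"
  obtain T where T: "\<And>i k. i < n \<Longrightarrow> k < n \<Longrightarrow> g p i k = mmul n ?q T i k"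
    "\<And>j k. k < j \<Longrightarrow> T j k = 0" "\<And>j. j < n \<Longrightarrow> T j j \<noteq> 0" "(\<Prod>j<n. T j j) = 1"
    using qr(4) by blast
  have "mmul n (\<lambda>i j. ?q j i) (g p) i j = T i j" if ij: "i < n" "j < n" for i j
  proof -
    have "mmul n (\<lambda>i j. ?q j i) (g p) i j = mmul n (\<lambda>i j. ?q j i) (mmul n ?q T) i j"
      by (rule mmul_cong) (simp_all add: T(1) ij)
    also have "\<dots> = (\<Sum>k<n. mmul n (\<lambda>i j. ?q j i) ?q i k * T k j)"
      unfolding mmul_assoc[symmetric] by (simp add: mmul_def[of n "mmul n _ _"])
    also have "\<dots> = (\<Sum>k<n. if k = i then T k j else 0)"
      by (intro sum.cong refl) (use ij orthogonal_mat_mmul(1)[OF qr(2)] in auto)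
    finally show ?thesis using ij by simp
  qed
  then have "nonzero_pivots n (mmul n (\<lambda>i j. ?q j i) (g p)) = nonzero_pivots n T \<and>
      pivot_prod n (mmul n (\<lambda>i j. ?q j i) (g p)) = pivot_prod n T" by (rule pivots_cong)
  then show "nonzero_pivots n (mmul n (\<lambda>i j. ?q j i) (g p)) \<and> pivot_prod n (mmul n (\<lambda>i j. ?q j i) (g p)) = 1"
    using pivots_upper[of n T] T(2-4) by simp
qed

text \<open>Closeness makes q^T q' a positive form, so its pivots are nonzero; their product is its
  determinant, which is 1.\<close>

lemma kap_close_orthogonal:
  assumes "cmat n q" "cmat n q'"
    and "\<And>p. p \<in> points M \<Longrightarrow> orthogonal_mat n (q p) \<and> det (sqmat n (q p)) = 1"
    and "\<And>p. p \<in> points M \<Longrightarrow> orthogonal_mat n (q' p) \<and> det (sqmat n (q' p)) = 1"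
    and close: "\<And>p. p \<in> points M \<Longrightarrow> (\<Sum>i<n. \<Sum>j<n. (q' p i j - q p i j) * (q' p i j - q p i j)) < 2"
  shows "kap (emb n q') = kap (emb n q)"
proof (rule kap_orthogonal_factor)
  fix p assume p: "p \<in> points M"
  then show "orthogonal_mat n (q p)" using assms by blast
  let ?t = "mmul n (\<lambda>i j. q p j i) (q' p)"
  have pv: "nonzero_pivots n ?t"
    by (rule positive_form_pivots[OF close_orthogonal_positive]) (use assms p in auto)
  have "sqmat n (\<lambda>i j. q p j i) = transpose_mat (sqmat n (q p))" by (rule eq_matI) auto
  then have "det (sqmat n (\<lambda>i j. q p j i)) = 1" using assms(3)[OF p] det_transpose[of "sqmat n (q p)" n] by simp
  then have "det (sqmat n ?t) = 1"
    unfolding sqmat_mult[symmetric] using assms(4)[OF p] det_mult[of "sqmat n (\<lambda>i j. q p j i)" n "sqmat n (q' p)"] by simp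
  then show "nonzero_pivots n ?t \<and> pivot_prod n ?t = 1" using pv pivot_prod_det[OF pv] by simp
qed (use assms in auto)

end

text \<open>Determinant 1 keeps all square norms nonzero, so the divisions in the recursion are
  continuous.\<close>

lemma dcont_gram_schmidt_col:
  assumes C: "definable_charts S X C"
    and g: "\<And>i j. i < n \<Longrightarrow> j < n \<Longrightarrow> dcont S X C (\<lambda>x. g x i j)"
    and det: "\<And>x. x \<in> topspace X \<Longrightarrow> det (sqmat n (g x)) = 1"
  shows "i < n \<Longrightarrow> k < n \<Longrightarrow> dcont S X C (\<lambda>x. gram_schmidt_col n (g x) k i)"
proof (induction k arbitrary: i rule: less_induct)
  case (less k)
  let ?w = "\<lambda>j x. gram_schmidt_col n (g x) j"
  have nz: "ip n (?w j x) (?w j x) \<noteq> 0" if "j < n" "x \<in> topspace X" for j x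
    using qr_decomposition(1)[OF det[OF that(2)] that(1)] by simp
  have w: "dcont S X C (\<lambda>x. ?w j x i)" if "i < n" "j < k" for i j
    by (rule less.IH[OF that(2,1)]) (use that(2) less.prems(2) in simp)
  have ipw: "dcont S X C (\<lambda>x. ip n (\<lambda>i. g x i k) (?w j x))" "dcont S X C (\<lambda>x. ip n (?w j x) (?w j x))"
    if "j < k" for j
    unfolding ip_def by (intro dcont_sum[OF C] dcont_times[OF C] w g that less.prems(2); simp)+
  show ?case
    unfolding gram_schmidt_col.simps[of n _ k]
    by (intro dcont_minus[OF C] dcont_sum[OF C] dcont_times[OF C] dcont_divide[OF C] g less.prems w ipw nz)
      (use less.prems(2) in auto)
qed

lemma dcont_qr_q:
  assumes C: "definable_charts S X C"
    and g: "\<And>i j. i < n \<Longrightarrow> j < n \<Longrightarrow> dcont S X C (\<lambda>x. g x i j)"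
    and det: "\<And>x. x \<in> topspace X \<Longrightarrow> det (sqmat n (g x)) = 1"
    and ij: "i < n" "j < n"
  shows "dcont S X C (\<lambda>x. qr_q n (g x) i j)"
proof -
  have pos: "0 < ip n (gram_schmidt_col n (g x) j) (gram_schmidt_col n (g x) j)" if "x \<in> topspace X" for x
    by (rule qr_decomposition(1)[OF det[OF that] ij(2)])
  have w: "dcont S X C (\<lambda>x. gram_schmidt_col n (g x) j i)" if "i < n" for i
    by (rule dcont_gram_schmidt_col[OF C g det that ij(2)])
  have "dcont S X C (\<lambda>x. ip n (gram_schmidt_col n (g x) j) (gram_schmidt_col n (g x) j))"
    unfolding ip_def by (intro dcont_sum[OF C] dcont_times[OF C] w) auto
  then show ?thesis
    unfolding qr_q_def
    by (intro dcont_divide[OF C] dcont_rsqrt[OF C] w ij pos) (use rsqrt_pos[OF pos] in \<open>simp_all add: less_imp_neq[symmetric]\<close>)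
qed

theorem theorem4p5:
  fixes S :: "('f, 'p, 'a::real_closed_field) expansion"
    and M :: "('m, 'a) manifold"
    and A B :: "('m \<Rightarrow> 'a) mat"
    and r n :: nat
  assumes "o_minimal S"
    and "affine_definable_Cr_manifold S r M"
    and "A \<in> SLn (Cdf0 S M) n"
    and "B \<in> SLn (Cdf0 S M) n"
    and "definably_homotopic S M n A B"
  shows "SK1_class (Cdf0 S M) A = SK1_class (Cdf0 S M) B"
proof -
  have om: "o_minimal S" by (rule assms(1))
  have man: "definable_Cr_manifold S r M" using assms(2) unfolding affine_definable_Cr_manifold_def by blast
  obtain H where H: "definable_homotopy S M n H"
    and H01: "\<And>p. p \<in> points M \<Longrightarrow> H (p, 0) = value_at A p" "\<And>p. p \<in> points M \<Longrightarrow> H (p, 1) = value_at B p"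
    using assms(5) unfolding definably_homotopic_def by blast
  let ?h = "\<lambda>z i j. H z $$ (i, j)"
  let ?q = "\<lambda>z. qr_q n (?h z)"
  have Hdet: "det (sqmat n (?h (p, u))) = 1" if "p \<in> points M" "0 \<le> u" "u \<le> 1" for p u
  proof -
    have "H (p, u) \<in> SLn_R n" using H that unfolding definable_homotopy_def by auto
    moreover from this have "sqmat n (?h (p, u)) = H (p, u)" by (intro eq_matI) (auto simp: SLn_R_def)
    ultimately show ?thesis by (simp add: SLn_R_def)
  qed
  have h: "icont S M (\<lambda>z. ?h z i j)" if "i < n" "j < n" for i j
    by (rule icont_homotopy_entry[OF man H that])
  have q: "icont S M (\<lambda>z. ?q z i j)" if "i < n" "j < n" for i j
  proof (rule dcont_qr_q[OF definable_charts_cylinder[OF man] h _ that])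
    show "det (sqmat n (?h z)) = 1" if "z \<in> topspace (cylinder_topology M)" for z
      using that Hdet[of "fst z" "snd z"] by (auto simp: topspace_manifold_topology[OF man])
  qed
  have orth: "orthogonal_mat n (?q (p, u))" "det (sqmat n (?q (p, u))) = 1"
    if "p \<in> points M" "0 \<le> u" "u \<le> 1" for p u
    using qr_decomposition(2,3)[OF Hdet[OF that]] by auto
  \<comment> \<open>The index \<open>None\<close> stands for the time itself, as the subdivision
    requires; the other indices are the entries of the orthogonal factor.\<close>
  define L where "L = insert None (Some ` ({..<n} \<times> {..<n}))"
  define f where "f l = (case l of None \<Rightarrow> snd | Some (i, j) \<Rightarrow> \<lambda>z. ?q z i j)" for l
  have "\<exists>K t. (\<forall>j. mcont S M (t j)) \<and> (\<forall>p\<in>points M. t 0 p = 0 \<and> t K p = 1 \<and>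
    (\<forall>j. 0 \<le> t j p \<and> t j p \<le> 1 \<and> deviation L f p (t j p) (t (Suc j) p) < 2))"
  proof (rule continuous_subdivision[OF om man])
    show "icont S M (f l)" if "l \<in> L" for l
      using that q by (auto simp: L_def f_def icont_snd[OF om man])
    show "\<bar>f l (p, u)\<bar> \<le> 1" if "l \<in> L" "p \<in> points M" "0 \<le> u" "u \<le> 1" for l p u
      using that orthogonal_mat_bound[OF orth(1)] by (auto simp: L_def f_def)
  qed (auto simp: L_def f_def)
  then obtain K t where t: "\<And>j. mcont S M (t j)"
    "\<And>p. p \<in> points M \<Longrightarrow> t 0 p = 0" "\<And>p. p \<in> points M \<Longrightarrow> t K p = 1"
    "\<And>p j. p \<in> points M \<Longrightarrow> 0 \<le> t j p \<and> t j p \<le> 1"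
    "\<And>p j. p \<in> points M \<Longrightarrow> deviation L f p (t j p) (t (Suc j) p) < 2" by blast
  \<comment> \<open>The deviation also contains the square of the elapsed time, hence only an
    inequality.\<close>
  have close: "(\<Sum>i<n. \<Sum>j<n. (?q (p, t (Suc k) p) i j - ?q (p, t k p) i j) * (?q (p, t (Suc k) p) i j - ?q (p, t k p) i j)) < 2"
    if "p \<in> points M" for p k
  proof -
    have "(\<Sum>i<n. \<Sum>j<n. (?q (p, v) i j - ?q (p, u) i j) * (?q (p, v) i j - ?q (p, u) i j)) \<le> deviation L f p u v" for u v
      unfolding deviation_def[OF om man] L_def
      by (subst sum.insert) (auto simp: sum.reindex sum.cartesian_product f_def split_def)
    then show ?thesis using t(5)[OF that, of k] by (rule le_less_trans)
  qed
  have G: "cmat S M n (\<lambda>p. ?h (p, t k p))" and Q: "cmat S M n (\<lambda>p. ?q (p, t k p))" for k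
    unfolding cmat_def[OF man] using mcont_comp[OF om man h t(1,4)] mcont_comp[OF om man q t(1,4)] by auto
  have qr: "kap S M (emb M n (\<lambda>p. ?h (p, t k p))) = kap S M (emb M n (\<lambda>p. ?q (p, t k p)))" for k
    by (rule kap_qr[OF man G Q]) (rule Hdet; simp add: t(4))
  \<comment> \<open>Consecutive orthogonal factors are close, so the class is carried along the
    subdivision; \<open>qr\<close> then transfers this to the homotopy itself.\<close>
  have "kap S M (emb M n (\<lambda>p. ?q (p, t k p))) = kap S M (emb M n (\<lambda>p. ?q (p, t 0 p)))" for k
  proof (induction k)
    case (Suc k)
    have "kap S M (emb M n (\<lambda>p. ?q (p, t (Suc k) p))) = kap S M (emb M n (\<lambda>p. ?q (p, t k p)))"
      by (rule kap_close_orthogonal[OF man Q Q _ _ close]) (use orth t(4) in auto)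
    then show ?case using Suc by simp
  qed simp
  then have hom: "kap S M (emb M n (\<lambda>p. ?h (p, t K p))) = kap S M (emb M n (\<lambda>p. ?h (p, t 0 p)))"
    unfolding qr .
  \<comment> \<open>SL has the multiplication of GL, so the coset of \<open>Comm\<close> in the
    definition of the class is literally the one formed in GL.\<close>
  have cls: "SK1_class (Cdf0 S M) D = kap S M (emb M n (\<lambda>p i j. (D $$ (i, j)) p))"
    and dim: "D \<in> carrier_mat n n" if "D \<in> SLn (Cdf0 S M) n" for D
  proof -
    have D: "D \<in> carrier (GLn (Cdf0 S M) n)" using that by (simp add: SLn_def)
    show "SK1_class (Cdf0 S M) D = kap S M (emb M n (\<lambda>p i j. (D $$ (i, j)) p))"
      unfolding stab_emb(1)[OF man D, symmetric] by (simp add: SK1_class_def kap_def[OF man] SL_def r_coset_def)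
    show "D \<in> carrier_mat n n" using D by (auto simp: GLn_def units_of_def Units_def matrix_monoid_def)
  qed
  have "emb M n (\<lambda>p i j. (A $$ (i, j)) p) = emb M n (\<lambda>p. ?h (p, t 0 p))"
    using dim[OF assms(3)] by (intro emb_cong[OF man]) (simp add: t(2) H01(1) value_at_def)
  moreover have "emb M n (\<lambda>p i j. (B $$ (i, j)) p) = emb M n (\<lambda>p. ?h (p, t K p))"
    using dim[OF assms(4)] by (intro emb_cong[OF man]) (simp add: t(3) H01(2) value_at_def)
  ultimately show ?thesis unfolding cls[OF assms(3)] cls[OF assms(4)] using hom by simp
qed

end
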